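(* Let $p\colon A\to B$ be a Grothendieck fibration. Then the oplax sum pseudofunctor $\Sigma^{\mathrm{opl}}_p\colon \mathbf{Fib}_A\to\mathbf{Fib}_B$ (postcomposition with $p$) has a right pseudo-adjoint, given by the oplax base change 2-functor $\Delta^{\mathrm{opl}}_p\colon \mathbf{Fib}_B\to\mathbf{Fib}_A$.
   Context: All fibred categories are assumed cloven (equipped with chosen cartesian lifts) but not necessarily split. For a category $B$, $\mathbf{Fib}_B$ is the 2-category whose 0-cells are fibred categories over $B$ (Grothendieck fibrations with codomain $B$), whose 1-cells are fibred functors over $B$ (functors strictly commuting with the projections to $B$ and preserving cartesian arrows, but not necessarily the cleavings), and whose 2-cells are natural transformations with vertical components. Oplax sum. For a fibration $p\colon A\to B$, the 2-functor $\Sigma^{\mathrm{opl}}_p\colon\mathbf{Fib}_A\to\mathbf{Fib}_B$ sends a fibration $q\colon E\to A$ to $p\circ q\colon E\to B$. Representables. For $a\in A$, $\mathbf{y}_A(a)\in\mathbf{Fib}_A$ is the discrete domain fibration $A/a\to A$; for $a_{01}\colon a_0\to a_1$, $\mathbf{y}_A(a_{01})\colon\mathbf{y}_A(a_0)\to\mathbf{y}_A(a_1)$ is postcomposition with $a_{01}$. Oplax base change. For $E\in\mathbf{Fib}_B$, the fibred category $\Delta^{\mathrm{opl}}_p(E)$ over $A$ is: an object over $a\in A$ is a fibred functor $e\colon\Sigma^{\mathrm{opl}}_p(\mathbf{y}_A(a))\to E$ over $B$; an arrow $e_0\to e_1$ over $a_{01}\colon a_0\to a_1$ is a 2-cell $e_{01}\colon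 e_0\Rightarrow e_1\circ\Sigma^{\mathrm{opl}}_p(\mathbf{y}_A(a_{01}))$ in $\mathbf{Fib}_B(\Sigma^{\mathrm{opl}}_p(\mathbf{y}_A(a_0)),E)$; identities are identity 2-cells; the composite of $e_{01}$ over $a_{01}$ with $e_{12}$ over $a_{12}$ is $e_{01}$ followed by the whiskering $e_{12}\,\Sigma^{\mathrm{opl}}_p(\mathbf{y}_A(a_{01}))$. The chosen cartesian lift of $a_{01}$ at $e_1$ has domain $e_1\circ\Sigma^{\mathrm{opl}}_p(\mathbf{y}_A(a_{01}))$ and is given by the identity 2-cell. On a fibred functor $f\colon E\to F$, $\Delta^{\mathrm{opl}}_p(f)$ sends an object $e$ to $f\circ e$ and an arrow $e_{01}$ to the whiskering $f e_{01}$; on a 2-cell $f_{01}\colon f_0\Rightarrow f_1$, $\Delta^{\mathrm{opl}}_p(f_{01})$ has component at $e$ the whiskering $f_{01}e$. A right pseudo-adjoint $R$ of $L$ means: equivalences of categories $\mathbf{Fib}_A(E,R(F))\simeq\mathbf{Fib}_B(L(E),F)$, pseudo-natural in $E\in\mathbf{Fib}_A$ and $F\in\mathbf{Fib}_B$. *)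

theory Defs
  imports "HOL-Library.FuncSet"
begin

section \<open>Categories, functors, natural transformations\<close>

record ('o, 'm) cat =
  Obj :: "'o set"
  Arr :: "'m set"
  Dom :: "'m \<Rightarrow> 'o"
  Cod :: "'m \<Rightarrow> 'o"
  Ide :: "'o \<Rightarrow> 'm"
  Comp :: "'m \<Rightarrow> 'm \<Rightarrow> 'm"  (infixr "\<cdot>\<index>" 70)

text \<open>Composition is written in the classical order: \<open>g \<cdot> f\<close> is \<open>f\<close> followed by \<open>g\<close>.\<close>

definition hom :: "('o, 'm) cat \<Rightarrow> 'o \<Rightarrow> 'o \<Rightarrow> 'm set" where
  "hom C x y = {f \<in> Arr C. Dom C f = x \<and> Cod C f = y}"

locale category =
  fixes C :: "('o, 'm) cat" (structure)
  assumes dom_obj: "f \<in> Arr C \<Longrightarrow> Dom C f \<in> Obj C"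
    and cod_obj: "f \<in> Arr C \<Longrightarrow> Cod C f \<in> Obj C"
    and ide_hom: "x \<in> Obj C \<Longrightarrow> Ide C x \<in> hom C x x"
    and comp_hom: "f \<in> hom C x y \<Longrightarrow> g \<in> hom C y z \<Longrightarrow> g \<cdot> f \<in> hom C x z"
    and comp_ide_right: "f \<in> hom C x y \<Longrightarrow> f \<cdot> Ide C x = f"
    and comp_ide_left: "f \<in> hom C x y \<Longrightarrow> Ide C y \<cdot> f = f"
    and comp_assoc: "f \<in> hom C w x \<Longrightarrow> g \<in> hom C x y \<Longrightarrow> h \<in> hom C y z
      \<Longrightarrow> (h \<cdot> g) \<cdot> f = h \<cdot> (g \<cdot> f)"

definition iso_arrow :: "('o, 'm) cat \<Rightarrow> 'm \<Rightarrow> bool" where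
  "iso_arrow C f \<longleftrightarrow> f \<in> Arr C \<and>
    (\<exists>g \<in> hom C (Cod C f) (Dom C f).
      g \<cdot>\<^bsub>C\<^esub> f = Ide C (Dom C f) \<and> f \<cdot>\<^bsub>C\<^esub> g = Ide C (Cod C f))"

definition prod_cat :: "('o, 'm) cat \<Rightarrow> ('p, 'n) cat \<Rightarrow> ('o \<times> 'p, 'm \<times> 'n) cat" where
  "prod_cat C D = \<lparr>
    Obj = Obj C \<times> Obj D,
    Arr = Arr C \<times> Arr D,
    Dom = map_prod (Dom C) (Dom D),
    Cod = map_prod (Cod C) (Cod D),
    Ide = map_prod (Ide C) (Ide D),
    Comp = (\<lambda>(g, g') (f, f'). (g \<cdot>\<^bsub>C\<^esub> f, g' \<cdot>\<^bsub>D\<^esub> f'))\<rparr>"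

text \<open>Functors and natural transformations are required to be extensional (\<open>undefined\<close> outside
  the carriers of their source category), so that HOL equality of functors and of natural
  transformations is the mathematical one.\<close>

record ('o, 'm, 'p, 'n) funct =
  fob :: "'o \<Rightarrow> 'p"
  far :: "'m \<Rightarrow> 'n"

locale cat_functor = C: category C + D: category D
  for C :: "('o, 'm) cat" and D :: "('p, 'n) cat" +
  fixes F :: "('o, 'm, 'p, 'n) funct"
  assumes fob_PiE: "fob F \<in> Obj C \<rightarrow>\<^sub>E Obj D"
    and far_ext: "far F \<in> extensional (Arr C)"
    and far_hom: "f \<in> hom C x y \<Longrightarrow> far F f \<in> hom D (fob F x) (fob F y)"
    and far_ide: "x \<in> Obj C \<Longrightarrow> far F (Ide C x) = Ide D (fob F x)"
    and far_comp: "f \<in> hom C x y \<Longrightarrow> g \<in> hom C y z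
      \<Longrightarrow> far F (g \<cdot>\<^bsub>C\<^esub> f) = far F g \<cdot>\<^bsub>D\<^esub> far F f"

definition id_func :: "('o, 'm) cat \<Rightarrow> ('o, 'm, 'o, 'm) funct" where
  "id_func C = \<lparr>fob = (\<lambda>x \<in> Obj C. x), far = (\<lambda>f \<in> Arr C. f)\<rparr>"

text \<open>In \<open>comp_func\<close> and the operations below, the first argument is the source category, needed
  only to keep the result extensional.\<close>

definition comp_func ::
  "('o, 'm) cat \<Rightarrow> ('p, 'n, 'q, 'r) funct \<Rightarrow> ('o, 'm, 'p, 'n) funct \<Rightarrow> ('o, 'm, 'q, 'r) funct" where
  "comp_func C G F = \<lparr>fob = compose (Obj C) (fob G) (fob F), far = compose (Arr C) (far G) (far F)\<rparr>"

record ('o, 'm, 'p, 'n) nt =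
  NDom :: "('o, 'm, 'p, 'n) funct"
  NCod :: "('o, 'm, 'p, 'n) funct"
  component :: "'o \<Rightarrow> 'n"

locale nat_transformation =
  NDom: cat_functor C D "NDom \<tau>" + NCod: cat_functor C D "NCod \<tau>"
  for C :: "('o, 'm) cat" and D :: "('p, 'n) cat" and \<tau> :: "('o, 'm, 'p, 'n) nt" +
  assumes component_ext: "component \<tau> \<in> extensional (Obj C)"
    and component_hom: "x \<in> Obj C \<Longrightarrow> component \<tau> x \<in> hom D (fob (NDom \<tau>) x) (fob (NCod \<tau>) x)"
    and naturality: "f \<in> hom C x y
      \<Longrightarrow> component \<tau> y \<cdot>\<^bsub>D\<^esub> far (NDom \<tau>) f = far (NCod \<tau>) f \<cdot>\<^bsub>D\<^esub> component \<tau> x"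

definition nat_iso :: "('o, 'm) cat \<Rightarrow> ('p, 'n) cat \<Rightarrow> ('o, 'm, 'p, 'n) nt \<Rightarrow> bool" where
  "nat_iso C D \<tau> \<longleftrightarrow> nat_transformation C D \<tau> \<and> (\<forall>x \<in> Obj C. iso_arrow D (component \<tau> x))"

definition id_nt :: "('o, 'm) cat \<Rightarrow> ('p, 'n) cat \<Rightarrow> ('o, 'm, 'p, 'n) funct \<Rightarrow> ('o, 'm, 'p, 'n) nt" where
  "id_nt C D F = \<lparr>NDom = F, NCod = F, component = (\<lambda>x \<in> Obj C. Ide D (fob F x))\<rparr>"

definition vcomp ::
  "('o, 'm) cat \<Rightarrow> ('p, 'n) cat \<Rightarrow> ('o, 'm, 'p, 'n) nt \<Rightarrow> ('o, 'm, 'p, 'n) nt \<Rightarrow> ('o, 'm, 'p, 'n) nt" where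
  "vcomp C D \<beta> \<alpha> = \<lparr>NDom = NDom \<alpha>, NCod = NCod \<beta>,
    component = (\<lambda>x \<in> Obj C. component \<beta> x \<cdot>\<^bsub>D\<^esub> component \<alpha> x)\<rparr>"

definition hcomp ::
  "('o, 'm) cat \<Rightarrow> ('q, 'r) cat \<Rightarrow> ('p, 'n, 'q, 'r) nt \<Rightarrow> ('o, 'm, 'p, 'n) nt \<Rightarrow> ('o, 'm, 'q, 'r) nt" where
  "hcomp C E \<beta> \<alpha> = \<lparr>NDom = comp_func C (NDom \<beta>) (NDom \<alpha>), NCod = comp_func C (NCod \<beta>) (NCod \<alpha>),
    component = (\<lambda>x \<in> Obj C.
      component \<beta> (fob (NCod \<alpha>) x) \<cdot>\<^bsub>E\<^esub> far (NDom \<beta>) (component \<alpha> x))\<rparr>"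

text \<open>\<open>whisker_left C G \<alpha>\<close> is \<open>G \<alpha>\<close>, and \<open>whisker_right C \<alpha> F\<close> is \<open>\<alpha> F\<close>.\<close>

definition whisker_left ::
  "('o, 'm) cat \<Rightarrow> ('p, 'n, 'q, 'r) funct \<Rightarrow> ('o, 'm, 'p, 'n) nt \<Rightarrow> ('o, 'm, 'q, 'r) nt" where
  "whisker_left C G \<alpha> = \<lparr>NDom = comp_func C G (NDom \<alpha>), NCod = comp_func C G (NCod \<alpha>),
    component = (\<lambda>x \<in> Obj C. far G (component \<alpha> x))\<rparr>"

definition whisker_right ::
  "('o, 'm) cat \<Rightarrow> ('p, 'n, 'q, 'r) nt \<Rightarrow> ('o, 'm, 'p, 'n) funct \<Rightarrow> ('o, 'm, 'q, 'r) nt" where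
  "whisker_right C \<alpha> F = \<lparr>NDom = comp_func C (NDom \<alpha>) F, NCod = comp_func C (NCod \<alpha>) F,
    component = (\<lambda>x \<in> Obj C. component \<alpha> (fob F x))\<rparr>"

definition cat_equivalence :: "('o, 'm) cat \<Rightarrow> ('p, 'n) cat \<Rightarrow> ('o, 'm, 'p, 'n) funct \<Rightarrow> bool" where
  "cat_equivalence C D F \<longleftrightarrow> cat_functor C D F \<and>
    (\<exists>G \<eta> \<epsilon>. cat_functor D C G \<and>
      nat_iso C C \<eta> \<and> NDom \<eta> = id_func C \<and> NCod \<eta> = comp_func C G F \<and>
      nat_iso D D \<epsilon> \<and> NDom \<epsilon> = comp_func D F G \<and> NCod \<epsilon> = id_func D)"

section \<open>Strict 2-categories and 2-functors\<close>

text \<open>Composition is indexed by the three 0-cells, as for categories enriched in categories: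
  \<open>Comp1 K x y z g f\<close> composes \<open>f : x \<rightarrow> y\<close> with \<open>g : y \<rightarrow> z\<close>, and
  \<open>Comp2\<close> is horizontal composition of 2-cells.\<close>

record ('x, 'f, 't) two_cat =
  Cell0 :: "'x set"
  HomCat :: "'x \<Rightarrow> 'x \<Rightarrow> ('f, 't) cat"
  Id1 :: "'x \<Rightarrow> 'f"
  Comp1 :: "'x \<Rightarrow> 'x \<Rightarrow> 'x \<Rightarrow> 'f \<Rightarrow> 'f \<Rightarrow> 'f"
  Comp2 :: "'x \<Rightarrow> 'x \<Rightarrow> 'x \<Rightarrow> 't \<Rightarrow> 't \<Rightarrow> 't"

locale two_category =
  fixes K :: "('x, 'f, 't) two_cat"
  assumes hom_category: "x \<in> Cell0 K \<Longrightarrow> y \<in> Cell0 K \<Longrightarrow> category (HomCat K x y)"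
    and id1_obj: "x \<in> Cell0 K \<Longrightarrow> Id1 K x \<in> Obj (HomCat K x x)"
    and comp1_obj: "\<lbrakk>x \<in> Cell0 K; y \<in> Cell0 K; z \<in> Cell0 K;
        f \<in> Obj (HomCat K x y); g \<in> Obj (HomCat K y z)\<rbrakk>
      \<Longrightarrow> Comp1 K x y z g f \<in> Obj (HomCat K x z)"
    and comp2_hom: "\<lbrakk>x \<in> Cell0 K; y \<in> Cell0 K; z \<in> Cell0 K;
        \<alpha> \<in> hom (HomCat K x y) f f'; \<beta> \<in> hom (HomCat K y z) g g'\<rbrakk>
      \<Longrightarrow> Comp2 K x y z \<beta> \<alpha> \<in> hom (HomCat K x z) (Comp1 K x y z g f) (Comp1 K x y z g' f')"
    and comp2_ide: "\<lbrakk>x \<in> Cell0 K; y \<in> Cell0 K; z \<in> Cell0 K;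
        f \<in> Obj (HomCat K x y); g \<in> Obj (HomCat K y z)\<rbrakk>
      \<Longrightarrow> Comp2 K x y z (Ide (HomCat K y z) g) (Ide (HomCat K x y) f)
        = Ide (HomCat K x z) (Comp1 K x y z g f)"
    and interchange: "\<lbrakk>x \<in> Cell0 K; y \<in> Cell0 K; z \<in> Cell0 K;
        \<alpha> \<in> hom (HomCat K x y) f f'; \<alpha>' \<in> hom (HomCat K x y) f' f'';
        \<beta> \<in> hom (HomCat K y z) g g'; \<beta>' \<in> hom (HomCat K y z) g' g''\<rbrakk>
      \<Longrightarrow> Comp2 K x y z (\<beta>' \<cdot>\<^bsub>HomCat K y z\<^esub> \<beta>) (\<alpha>' \<cdot>\<^bsub>HomCat K x y\<^esub> \<alpha>)
        = Comp2 K x y z \<beta>' \<alpha>' \<cdot>\<^bsub>HomCat K x z\<^esub> Comp2 K x y z \<beta> \<alpha>"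
    and comp1_id_right: "\<lbrakk>x \<in> Cell0 K; y \<in> Cell0 K; f \<in> Obj (HomCat K x y)\<rbrakk>
      \<Longrightarrow> Comp1 K x x y f (Id1 K x) = f"
    and comp1_id_left: "\<lbrakk>x \<in> Cell0 K; y \<in> Cell0 K; f \<in> Obj (HomCat K x y)\<rbrakk>
      \<Longrightarrow> Comp1 K x y y (Id1 K y) f = f"
    and comp2_id_right: "\<lbrakk>x \<in> Cell0 K; y \<in> Cell0 K; \<alpha> \<in> Arr (HomCat K x y)\<rbrakk>
      \<Longrightarrow> Comp2 K x x y \<alpha> (Ide (HomCat K x x) (Id1 K x)) = \<alpha>"
    and comp2_id_left: "\<lbrakk>x \<in> Cell0 K; y \<in> Cell0 K; \<alpha> \<in> Arr (HomCat K x y)\<rbrakk>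
      \<Longrightarrow> Comp2 K x y y (Ide (HomCat K y y) (Id1 K y)) \<alpha> = \<alpha>"
    and comp1_assoc: "\<lbrakk>w \<in> Cell0 K; x \<in> Cell0 K; y \<in> Cell0 K; z \<in> Cell0 K;
        f \<in> Obj (HomCat K w x); g \<in> Obj (HomCat K x y); h \<in> Obj (HomCat K y z)\<rbrakk>
      \<Longrightarrow> Comp1 K w x z (Comp1 K x y z h g) f = Comp1 K w y z h (Comp1 K w x y g f)"
    and comp2_assoc: "\<lbrakk>w \<in> Cell0 K; x \<in> Cell0 K; y \<in> Cell0 K; z \<in> Cell0 K;
        \<alpha> \<in> Arr (HomCat K w x); \<beta> \<in> Arr (HomCat K x y); \<gamma> \<in> Arr (HomCat K y z)\<rbrakk>
      \<Longrightarrow> Comp2 K w x z (Comp2 K x y z \<gamma> \<beta>) \<alpha> = Comp2 K w y z \<gamma> (Comp2 K w x y \<beta> \<alpha>)"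

definition two_op :: "('x, 'f, 't) two_cat \<Rightarrow> ('x, 'f, 't) two_cat" where
  "two_op K = \<lparr>
    Cell0 = Cell0 K,
    HomCat = (\<lambda>x y. HomCat K y x),
    Id1 = Id1 K,
    Comp1 = (\<lambda>x y z g f. Comp1 K z y x f g),
    Comp2 = (\<lambda>x y z \<beta> \<alpha>. Comp2 K z y x \<alpha> \<beta>)\<rparr>"

definition two_prod ::
  "('x, 'f, 't) two_cat \<Rightarrow> ('y, 'g, 's) two_cat \<Rightarrow> ('x \<times> 'y, 'f \<times> 'g, 't \<times> 's) two_cat" where
  "two_prod K L = \<lparr>
    Cell0 = Cell0 K \<times> Cell0 L,
    HomCat = (\<lambda>(x, y) (x', y'). prod_cat (HomCat K x x') (HomCat L y y')),
    Id1 = (\<lambda>(x, y). (Id1 K x, Id1 L y)),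
    Comp1 = (\<lambda>(x, y) (x', y') (x'', y'') (g, g') (f, f').
      (Comp1 K x x' x'' g f, Comp1 L y y' y'' g' f')),
    Comp2 = (\<lambda>(x, y) (x', y') (x'', y'') (\<beta>, \<beta>') (\<alpha>, \<alpha>').
      (Comp2 K x x' x'' \<beta> \<alpha>, Comp2 L y y' y'' \<beta>' \<alpha>'))\<rparr>"

record ('x, 'f, 't, 'y, 'g, 's) two_fun =
  on0 :: "'x \<Rightarrow> 'y"
  on_hom :: "'x \<Rightarrow> 'x \<Rightarrow> ('f, 't, 'g, 's) funct"

locale two_functor = K: two_category K + L: two_category L
  for K :: "('x, 'f, 't) two_cat" and L :: "('y, 'g, 's) two_cat" +
  fixes S :: "('x, 'f, 't, 'y, 'g, 's) two_fun"
  assumes on0_cell: "x \<in> Cell0 K \<Longrightarrow> on0 S x \<in> Cell0 L"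
    and on_hom_functor: "x \<in> Cell0 K \<Longrightarrow> y \<in> Cell0 K
      \<Longrightarrow> cat_functor (HomCat K x y) (HomCat L (on0 S x) (on0 S y)) (on_hom S x y)"
    and on_hom_id1: "x \<in> Cell0 K \<Longrightarrow> fob (on_hom S x x) (Id1 K x) = Id1 L (on0 S x)"
    and on_hom_comp1: "\<lbrakk>x \<in> Cell0 K; y \<in> Cell0 K; z \<in> Cell0 K;
        f \<in> Obj (HomCat K x y); g \<in> Obj (HomCat K y z)\<rbrakk>
      \<Longrightarrow> fob (on_hom S x z) (Comp1 K x y z g f)
        = Comp1 L (on0 S x) (on0 S y) (on0 S z) (fob (on_hom S y z) g) (fob (on_hom S x y) f)"
    and on_hom_comp2: "\<lbrakk>x \<in> Cell0 K; y \<in> Cell0 K; z \<in> Cell0 K;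
        \<alpha> \<in> Arr (HomCat K x y); \<beta> \<in> Arr (HomCat K y z)\<rbrakk>
      \<Longrightarrow> far (on_hom S x z) (Comp2 K x y z \<beta> \<alpha>)
        = Comp2 L (on0 S x) (on0 S y) (on0 S z) (far (on_hom S y z) \<beta>) (far (on_hom S x y) \<alpha>)"

definition id_two_fun :: "('x, 'f, 't) two_cat \<Rightarrow> ('x, 'f, 't, 'x, 'f, 't) two_fun" where
  "id_two_fun K = \<lparr>on0 = (\<lambda>x. x), on_hom = (\<lambda>x y. id_func (HomCat K x y))\<rparr>"

text \<open>A 2-functor with values in categories is given by \<open>two_fun\<close> data whose values on 0-cells,
  1-cells and 2-cells are categories, functors and natural transformations.\<close>

type_synonym ('x, 'f, 't, 'o, 'm) cat_valued =
  "('x, 'f, 't, ('o, 'm) cat, ('o, 'm, 'o, 'm) funct, ('o, 'm, 'o, 'm) nt) two_fun"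

text \<open>A pseudo-natural transformation from \<open>H\<close> to \<open>G\<close>, both strict 2-functors from \<open>K\<close> to
  categories: functors \<open>\<Phi> x : H x \<rightarrow> G x\<close> and natural isomorphisms
  \<open>\<theta> x y k : G k \<circ> \<Phi> x \<Rightarrow> \<Phi> y \<circ> H k\<close> for 1-cells \<open>k : x \<rightarrow> y\<close>, natural in 2-cells and
  compatible with identities and composition.  The values of \<open>H\<close> and of \<open>G\<close> may live on
  different types.\<close>

locale pseudo_natural =
  fixes K :: "('x, 'f, 't) two_cat"
    and H :: "('x, 'f, 't, 'o, 'm) cat_valued"
    and G :: "('x, 'f, 't, 'p, 'n) cat_valued"
    and \<Phi> :: "'x \<Rightarrow> ('o, 'm, 'p, 'n) funct"
    and \<theta> :: "'x \<Rightarrow> 'x \<Rightarrow> 'f \<Rightarrow> ('o, 'm, 'p, 'n) nt"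
  assumes cmp_functor: "x \<in> Cell0 K \<Longrightarrow> cat_functor (on0 H x) (on0 G x) (\<Phi> x)"
    and sq_iso: "\<lbrakk>x \<in> Cell0 K; y \<in> Cell0 K; k \<in> Obj (HomCat K x y)\<rbrakk>
      \<Longrightarrow> nat_iso (on0 H x) (on0 G y) (\<theta> x y k)"
    and sq_dom: "\<lbrakk>x \<in> Cell0 K; y \<in> Cell0 K; k \<in> Obj (HomCat K x y)\<rbrakk>
      \<Longrightarrow> NDom (\<theta> x y k) = comp_func (on0 H x) (fob (on_hom G x y) k) (\<Phi> x)"
    and sq_cod: "\<lbrakk>x \<in> Cell0 K; y \<in> Cell0 K; k \<in> Obj (HomCat K x y)\<rbrakk>
      \<Longrightarrow> NCod (\<theta> x y k) = comp_func (on0 H x) (\<Phi> y) (fob (on_hom H x y) k)"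
    and sq_natural: "\<lbrakk>x \<in> Cell0 K; y \<in> Cell0 K; \<sigma> \<in> hom (HomCat K x y) k k'\<rbrakk>
      \<Longrightarrow> vcomp (on0 H x) (on0 G y) (\<theta> x y k')
            (whisker_right (on0 H x) (far (on_hom G x y) \<sigma>) (\<Phi> x))
        = vcomp (on0 H x) (on0 G y)
            (whisker_left (on0 H x) (\<Phi> y) (far (on_hom H x y) \<sigma>)) (\<theta> x y k)"
    and sq_id: "x \<in> Cell0 K \<Longrightarrow> \<theta> x x (Id1 K x) = id_nt (on0 H x) (on0 G x) (\<Phi> x)"
    and sq_comp: "\<lbrakk>x \<in> Cell0 K; y \<in> Cell0 K; z \<in> Cell0 K;
        k \<in> Obj (HomCat K x y); l \<in> Obj (HomCat K y z)\<rbrakk>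
      \<Longrightarrow> \<theta> x z (Comp1 K x y z l k)
        = vcomp (on0 H x) (on0 G z)
            (whisker_right (on0 H x) (\<theta> y z l) (fob (on_hom H x y) k))
            (whisker_left (on0 H x) (fob (on_hom G y z) l) (\<theta> x y k))"

definition pseudo_natural_equivalence ::
  "('x, 'f, 't) two_cat \<Rightarrow> ('x, 'f, 't, 'o, 'm) cat_valued \<Rightarrow> ('x, 'f, 't, 'p, 'n) cat_valued
    \<Rightarrow> ('x \<Rightarrow> ('o, 'm, 'p, 'n) funct) \<Rightarrow> ('x \<Rightarrow> 'x \<Rightarrow> 'f \<Rightarrow> ('o, 'm, 'p, 'n) nt) \<Rightarrow> bool" where
  "pseudo_natural_equivalence K H G \<Phi> \<theta> \<longleftrightarrow> pseudo_natural K H G \<Phi> \<theta> \<and>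
    (\<forall>x \<in> Cell0 K. cat_equivalence (on0 H x) (on0 G x) (\<Phi> x))"

section \<open>The 2-category of cloven fibrations over a category\<close>

text \<open>\<open>Lift E u e\<close> is the chosen cartesian arrow over \<open>u\<close> with codomain \<open>e\<close>; it is meaningful
  only if \<open>e\<close> lies over the codomain of \<open>u\<close>.\<close>

record ('o, 'm, 'bo, 'bm) fibration =
  Tot :: "('o, 'm) cat"
  Proj :: "('o, 'm, 'bo, 'bm) funct"
  Lift :: "'bm \<Rightarrow> 'o \<Rightarrow> 'm"

definition cartesian_arrow ::
  "('bo, 'bm) cat \<Rightarrow> ('o, 'm, 'bo, 'bm) fibration \<Rightarrow> 'm \<Rightarrow> bool" where
  "cartesian_arrow B E f \<longleftrightarrow> f \<in> Arr (Tot E) \<and>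
    (\<forall>g w. g \<in> Arr (Tot E) \<and> Cod (Tot E) g = Cod (Tot E) f \<and>
        w \<in> hom B (fob (Proj E) (Dom (Tot E) g)) (fob (Proj E) (Dom (Tot E) f)) \<and>
        far (Proj E) f \<cdot>\<^bsub>B\<^esub> w = far (Proj E) g
      \<longrightarrow> (\<exists>!h. h \<in> hom (Tot E) (Dom (Tot E) g) (Dom (Tot E) f) \<and>
            far (Proj E) h = w \<and> f \<cdot>\<^bsub>Tot E\<^esub> h = g))"

locale cloven_fibration = cat_functor "Tot E" B "Proj E"
  for B :: "('bo, 'bm) cat" and E :: "('o, 'm, 'bo, 'bm) fibration" +
  assumes lift: "\<lbrakk>u \<in> Arr B; e \<in> Obj (Tot E); fob (Proj E) e = Cod B u\<rbrakk>
    \<Longrightarrow> cartesian_arrow B E (Lift E u e) \<and> Cod (Tot E) (Lift E u e) = e \<and>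
      far (Proj E) (Lift E u e) = u"

locale fibred_functor = cat_functor "Tot E" "Tot F" f
  for B :: "('bo, 'bm) cat"
    and E :: "('o, 'm, 'bo, 'bm) fibration" and F :: "('p, 'n, 'bo, 'bm) fibration"
    and f :: "('o, 'm, 'p, 'n) funct" +
  assumes over_base: "comp_func (Tot E) (Proj F) f = Proj E"
    and preserves_cartesian: "cartesian_arrow B E x \<Longrightarrow> cartesian_arrow B F (far f x)"

locale fibred_nat = nat_transformation "Tot E" "Tot F" \<tau> +
  NDom: fibred_functor B E F "NDom \<tau>" + NCod: fibred_functor B E F "NCod \<tau>"
  for B :: "('bo, 'bm) cat"
    and E :: "('o, 'm, 'bo, 'bm) fibration" and F :: "('p, 'n, 'bo, 'bm) fibration"
    and \<tau> :: "('o, 'm, 'p, 'n) nt" +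
  assumes vertical: "x \<in> Obj (Tot E) \<Longrightarrow> far (Proj F) (component \<tau> x) = Ide B (fob (Proj E) x)"

definition Fib_hom ::
  "('bo, 'bm) cat \<Rightarrow> ('o, 'm, 'bo, 'bm) fibration \<Rightarrow> ('p, 'n, 'bo, 'bm) fibration
    \<Rightarrow> (('o, 'm, 'p, 'n) funct, ('o, 'm, 'p, 'n) nt) cat" where
  "Fib_hom B E F = \<lparr>
    Obj = {f. fibred_functor B E F f},
    Arr = {\<tau>. fibred_nat B E F \<tau>},
    Dom = NDom,
    Cod = NCod,
    Ide = id_nt (Tot E) (Tot F),
    Comp = vcomp (Tot E) (Tot F)\<rparr>"

text \<open>The types \<open>'o\<close>, \<open>'m\<close> of objects and arrows of the total categories play the role of the
  universe bounding the size of the 0-cells.\<close>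

definition Fib ::
  "('bo, 'bm) cat
    \<Rightarrow> (('o, 'm, 'bo, 'bm) fibration, ('o, 'm, 'o, 'm) funct, ('o, 'm, 'o, 'm) nt) two_cat" where
  "Fib B = \<lparr>
    Cell0 = {E. cloven_fibration B E},
    HomCat = Fib_hom B,
    Id1 = (\<lambda>E. id_func (Tot E)),
    Comp1 = (\<lambda>E F G. comp_func (Tot E)),
    Comp2 = (\<lambda>E F G. hcomp (Tot E) (Tot G))\<rparr>"

section \<open>Right pseudo-adjoints\<close>

text \<open>The functor \<open>g \<mapsto> v \<circ> g \<circ> u\<close> from \<open>Fib_hom B E F\<close> to \<open>Fib_hom B E' F'\<close> for
  \<open>u : E' \<rightarrow> E\<close>, \<open>v : F \<rightarrow> F'\<close>, and its action on 2-cells in \<open>u\<close> and \<open>v\<close>.\<close>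

definition hom_act1 where
  "hom_act1 B E F E' u v = \<lparr>
    fob = (\<lambda>g \<in> Obj (Fib_hom B E F). comp_func (Tot E') v (comp_func (Tot E') g u)),
    far = (\<lambda>\<gamma> \<in> Arr (Fib_hom B E F). whisker_left (Tot E') v (whisker_right (Tot E') \<gamma> u))\<rparr>"

definition hom_act2 where
  "hom_act2 B E F E' F' \<alpha> \<beta> = \<lparr>
    NDom = hom_act1 B E F E' (NDom \<alpha>) (NDom \<beta>),
    NCod = hom_act1 B E F E' (NCod \<alpha>) (NCod \<beta>),
    component = (\<lambda>g \<in> Obj (Fib_hom B E F).
      hcomp (Tot E') (Tot F') \<beta> (whisker_left (Tot E') g \<alpha>))\<rparr>"

text \<open>For \<open>S : K \<rightarrow> Fib B\<close> and \<open>T : L \<rightarrow> Fib B\<close>, possibly landing in fibrations of different sizes,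
  the 2-functor \<open>(x, y) \<mapsto> Fib_hom B (S x) (T y)\<close> from \<open>two_prod (two_op K) L\<close> to categories.\<close>

definition hom_two_fun ::
  "('bo, 'bm) cat \<Rightarrow> ('x, 'f, 't) two_cat \<Rightarrow> ('y, 'g, 's) two_cat
    \<Rightarrow> ('x, 'f, 't, ('o, 'm, 'bo, 'bm) fibration, ('o, 'm, 'o, 'm) funct, ('o, 'm, 'o, 'm) nt) two_fun
    \<Rightarrow> ('y, 'g, 's, ('p, 'n, 'bo, 'bm) fibration, ('p, 'n, 'p, 'n) funct, ('p, 'n, 'p, 'n) nt) two_fun
    \<Rightarrow> ('x \<times> 'y, 'f \<times> 'g, 't \<times> 's, ('o, 'm, 'p, 'n) funct, ('o, 'm, 'p, 'n) nt) cat_valued" where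
  "hom_two_fun B K L S T = \<lparr>
    on0 = (\<lambda>(x, y). Fib_hom B (on0 S x) (on0 T y)),
    on_hom = (\<lambda>(x, y) (x', y'). \<lparr>
      fob = (\<lambda>(u, v) \<in> Obj (prod_cat (HomCat K x' x) (HomCat L y y')).
        hom_act1 B (on0 S x) (on0 T y) (on0 S x')
          (fob (on_hom S x' x) u) (fob (on_hom T y y') v)),
      far = (\<lambda>(\<alpha>, \<beta>) \<in> Arr (prod_cat (HomCat K x' x) (HomCat L y y')).
        hom_act2 B (on0 S x) (on0 T y) (on0 S x') (on0 T y')
          (far (on_hom S x' x) \<alpha>) (far (on_hom T y y') \<beta>))\<rparr>)\<rparr>"

text \<open>Since \<open>R\<close> may increase the size of the fibrations, its codomain \<open>Fib A\<close> need not be at the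
  same types as the domain \<open>Fib A\<close> of \<open>L\<close>, and likewise for \<open>Fib B\<close>.\<close>

definition right_pseudo_adjoint ::
  "('ao, 'am) cat \<Rightarrow> ('bo, 'bm) cat
    \<Rightarrow> (('eo, 'em, 'ao, 'am) fibration, ('eo, 'em, 'eo, 'em) funct, ('eo, 'em, 'eo, 'em) nt,
        ('ho, 'hm, 'bo, 'bm) fibration, ('ho, 'hm, 'ho, 'hm) funct, ('ho, 'hm, 'ho, 'hm) nt) two_fun
    \<Rightarrow> (('fo, 'fm, 'bo, 'bm) fibration, ('fo, 'fm, 'fo, 'fm) funct, ('fo, 'fm, 'fo, 'fm) nt,
        ('go, 'gm, 'ao, 'am) fibration, ('go, 'gm, 'go, 'gm) funct, ('go, 'gm, 'go, 'gm) nt) two_fun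
    \<Rightarrow> bool" where
  "right_pseudo_adjoint A B L R \<longleftrightarrow>
    two_functor (Fib A) (Fib B) L \<and> two_functor (Fib B) (Fib A) R \<and>
    (\<exists>\<Phi> \<theta>. pseudo_natural_equivalence (two_prod (two_op (Fib A)) (Fib B))
      (hom_two_fun A (Fib A) (Fib B) (id_two_fun (Fib A)) R)
      (hom_two_fun B (Fib A) (Fib B) L (id_two_fun (Fib B))) \<Phi> \<theta>)"

section \<open>Oplax sum\<close>

definition sum_fib ::
  "('ao, 'am, 'bo, 'bm) fibration \<Rightarrow> ('o, 'm, 'ao, 'am) fibration \<Rightarrow> ('o, 'm, 'bo, 'bm) fibration" where
  "sum_fib p E = \<lparr>
    Tot = Tot E,
    Proj = comp_func (Tot E) (Proj p) (Proj E),
    Lift = (\<lambda>u e. Lift E (Lift p u (fob (Proj E) e)) e)\<rparr>"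

definition oplax_sum ::
  "('ao, 'am, 'bo, 'bm) fibration
    \<Rightarrow> (('o, 'm, 'ao, 'am) fibration, ('o, 'm, 'o, 'm) funct, ('o, 'm, 'o, 'm) nt,
        ('o, 'm, 'bo, 'bm) fibration, ('o, 'm, 'o, 'm) funct, ('o, 'm, 'o, 'm) nt) two_fun" where
  "oplax_sum p = \<lparr>
    on0 = sum_fib p,
    on_hom = (\<lambda>E F. id_func (Fib_hom (Tot p) E F))\<rparr>"

section \<open>Representables\<close>

text \<open>The arrow \<open>(h, g)\<close> of the slice over \<open>a\<close> is \<open>h\<close> regarded as an arrow from \<open>g \<cdot> h\<close> to \<open>g\<close>.\<close>

definition slice :: "('o, 'm) cat \<Rightarrow> 'o \<Rightarrow> ('m, 'm \<times> 'm) cat" where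
  "slice A a = \<lparr>
    Obj = {f \<in> Arr A. Cod A f = a},
    Arr = {(h, g). h \<in> Arr A \<and> g \<in> Arr A \<and> Cod A h = Dom A g \<and> Cod A g = a},
    Dom = (\<lambda>(h, g). g \<cdot>\<^bsub>A\<^esub> h),
    Cod = snd,
    Ide = (\<lambda>g. (Ide A (Dom A g), g)),
    Comp = (\<lambda>(h', g') (h, g). (h' \<cdot>\<^bsub>A\<^esub> h, g'))\<rparr>"

definition rep :: "('o, 'm) cat \<Rightarrow> 'o \<Rightarrow> ('m, 'm \<times> 'm, 'o, 'm) fibration" where
  "rep A a = \<lparr>
    Tot = slice A a,
    Proj = \<lparr>fob = (\<lambda>f \<in> Obj (slice A a). Dom A f), far = (\<lambda>(h, g) \<in> Arr (slice A a). h)\<rparr>,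
    Lift = (\<lambda>h g. (h, g))\<rparr>"

definition rep_map :: "('o, 'm) cat \<Rightarrow> 'm \<Rightarrow> ('m, 'm \<times> 'm, 'm, 'm \<times> 'm) funct" where
  "rep_map A a01 = \<lparr>
    fob = (\<lambda>f \<in> Obj (slice A (Dom A a01)). a01 \<cdot>\<^bsub>A\<^esub> f),
    far = (\<lambda>(h, g) \<in> Arr (slice A (Dom A a01)). (h, a01 \<cdot>\<^bsub>A\<^esub> g))\<rparr>"

section \<open>Oplax base change\<close>

text \<open>An object of the oplax base change of \<open>E\<close> is a pair \<open>(a, e)\<close>, with \<open>e\<close> a fibred functor from
  the sum of the representable at \<open>a\<close> to \<open>E\<close>.  An arrow to \<open>(a1, e1)\<close> is a triple
  \<open>(a01, e01, e1)\<close>; its domain \<open>e0\<close> is recovered as \<open>NDom e01\<close>, but \<open>e1\<close> is not determined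
  by \<open>e01 : e0 \<Rightarrow> e1 \<circ> rep_map A a01\<close> and has to be recorded.  Since \<open>oplax_sum\<close> is the
  identity on 1-cells, its image of \<open>rep_map A a01\<close> is again \<open>rep_map A a01\<close>.\<close>

type_synonym ('ao, 'am, 'eo, 'em) bc_obj = "'ao \<times> ('am, 'am \<times> 'am, 'eo, 'em) funct"

type_synonym ('am, 'eo, 'em) bc_arr =
  "'am \<times> ('am, 'am \<times> 'am, 'eo, 'em) nt \<times> ('am, 'am \<times> 'am, 'eo, 'em) funct"

definition bc_cat ::
  "('bo, 'bm) cat \<Rightarrow> ('ao, 'am, 'bo, 'bm) fibration \<Rightarrow> ('eo, 'em, 'bo, 'bm) fibration
    \<Rightarrow> (('ao, 'am, 'eo, 'em) bc_obj, ('am, 'eo, 'em) bc_arr) cat" where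
  "bc_cat B p E = \<lparr>
    Obj = {(a, e). a \<in> Obj (Tot p) \<and> e \<in> Obj (Fib_hom B (sum_fib p (rep (Tot p) a)) E)},
    Arr = {(a01, e01, e1). a01 \<in> Arr (Tot p) \<and>
      e1 \<in> Obj (Fib_hom B (sum_fib p (rep (Tot p) (Cod (Tot p) a01))) E) \<and>
      e01 \<in> Arr (Fib_hom B (sum_fib p (rep (Tot p) (Dom (Tot p) a01))) E) \<and>
      NCod e01 = comp_func (slice (Tot p) (Dom (Tot p) a01)) e1 (rep_map (Tot p) a01)},
    Dom = (\<lambda>(a01, e01, e1). (Dom (Tot p) a01, NDom e01)),
    Cod = (\<lambda>(a01, e01, e1). (Cod (Tot p) a01, e1)),
    Ide = (\<lambda>(a, e). (Ide (Tot p) a, id_nt (slice (Tot p) a) (Tot E) e, e)),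
    Comp = (\<lambda>(a12, e12, e2) (a01, e01, e1).
      (a12 \<cdot>\<^bsub>Tot p\<^esub> a01,
       vcomp (slice (Tot p) (Dom (Tot p) a01)) (Tot E)
         (whisker_right (slice (Tot p) (Dom (Tot p) a01)) e12 (rep_map (Tot p) a01)) e01,
       e2))\<rparr>"

definition bc_fib ::
  "('bo, 'bm) cat \<Rightarrow> ('ao, 'am, 'bo, 'bm) fibration \<Rightarrow> ('eo, 'em, 'bo, 'bm) fibration
    \<Rightarrow> (('ao, 'am, 'eo, 'em) bc_obj, ('am, 'eo, 'em) bc_arr, 'ao, 'am) fibration" where
  "bc_fib B p E = \<lparr>
    Tot = bc_cat B p E,
    Proj = \<lparr>fob = (\<lambda>(a, e) \<in> Obj (bc_cat B p E). a),
            far = (\<lambda>(a01, e01, e1) \<in> Arr (bc_cat B p E). a01)\<rparr>,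
    Lift = (\<lambda>a01 (a1, e1).
      (a01,
       id_nt (slice (Tot p) (Dom (Tot p) a01)) (Tot E)
         (comp_func (slice (Tot p) (Dom (Tot p) a01)) e1 (rep_map (Tot p) a01)),
       e1))\<rparr>"

definition bc_map1 ::
  "('bo, 'bm) cat \<Rightarrow> ('ao, 'am, 'bo, 'bm) fibration \<Rightarrow> ('eo, 'em, 'bo, 'bm) fibration
    \<Rightarrow> ('eo, 'em, 'fo, 'fm) funct
    \<Rightarrow> (('ao, 'am, 'eo, 'em) bc_obj, ('am, 'eo, 'em) bc_arr,
        ('ao, 'am, 'fo, 'fm) bc_obj, ('am, 'fo, 'fm) bc_arr) funct" where
  "bc_map1 B p E f = \<lparr>
    fob = (\<lambda>(a, e) \<in> Obj (bc_cat B p E). (a, comp_func (slice (Tot p) a) f e)),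
    far = (\<lambda>(a01, e01, e1) \<in> Arr (bc_cat B p E).
      (a01,
       whisker_left (slice (Tot p) (Dom (Tot p) a01)) f e01,
       comp_func (slice (Tot p) (Cod (Tot p) a01)) f e1))\<rparr>"

definition bc_map2 ::
  "('bo, 'bm) cat \<Rightarrow> ('ao, 'am, 'bo, 'bm) fibration \<Rightarrow> ('eo, 'em, 'bo, 'bm) fibration
    \<Rightarrow> ('eo, 'em, 'fo, 'fm) nt
    \<Rightarrow> (('ao, 'am, 'eo, 'em) bc_obj, ('am, 'eo, 'em) bc_arr,
        ('ao, 'am, 'fo, 'fm) bc_obj, ('am, 'fo, 'fm) bc_arr) nt" where
  "bc_map2 B p E \<phi> = \<lparr>
    NDom = bc_map1 B p E (NDom \<phi>),
    NCod = bc_map1 B p E (NCod \<phi>),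
    component = (\<lambda>(a, e) \<in> Obj (bc_cat B p E).
      (Ide (Tot p) a,
       whisker_right (slice (Tot p) a) \<phi> e,
       comp_func (slice (Tot p) a) (NCod \<phi>) e))\<rparr>"

definition oplax_base_change ::
  "('bo, 'bm) cat \<Rightarrow> ('ao, 'am, 'bo, 'bm) fibration
    \<Rightarrow> (('eo, 'em, 'bo, 'bm) fibration, ('eo, 'em, 'eo, 'em) funct, ('eo, 'em, 'eo, 'em) nt,
        (('ao, 'am, 'eo, 'em) bc_obj, ('am, 'eo, 'em) bc_arr, 'ao, 'am) fibration,
        (('ao, 'am, 'eo, 'em) bc_obj, ('am, 'eo, 'em) bc_arr,
         ('ao, 'am, 'eo, 'em) bc_obj, ('am, 'eo, 'em) bc_arr) funct,
        (('ao, 'am, 'eo, 'em) bc_obj, ('am, 'eo, 'em) bc_arr,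
         ('ao, 'am, 'eo, 'em) bc_obj, ('am, 'eo, 'em) bc_arr) nt) two_fun" where
  "oplax_base_change B p = \<lparr>
    on0 = bc_fib B p,
    on_hom = (\<lambda>E F. \<lparr>
      fob = (\<lambda>f \<in> Obj (Fib_hom B E F). bc_map1 B p E f),
      far = (\<lambda>\<phi> \<in> Arr (Fib_hom B E F). bc_map2 B p E \<phi>)\<rparr>)\<rparr>"

end

theory Submission
  imports Defs
begin

text \<open>
  The adjunction is given by a counit and a unit, of which only the second depends on cleavings.

  The counit \<open>\<epsilon> : \<Sigma> \<Delta> F \<rightarrow> F\<close> (\<open>bc_counit\<close>) evaluates at identities: it sends \<open>(a, e)\<close>, with \<open>e\<close> a fibred
  functor out of the slice over \<open>a\<close>, to the value of \<open>e\<close> at the identity of \<open>a\<close>.  It is strictly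
  2-natural in \<open>F\<close> (\<open>bc_counit_natural\<close>, \<open>bc_counit_natural2\<close>).  Hence the functors
  \<open>g \<mapsto> \<epsilon> \<circ> \<Sigma> g\<close> (\<open>left_transpose\<close>) from \<open>Fib A (E, \<Delta> F)\<close> to \<open>Fib B (\<Sigma> E, F)\<close> are strictly natural in \<open>E\<close>
  and \<open>F\<close>, and the structure cells of the required pseudo-natural transformation are identities
  (\<open>strict_natural_pseudo_natural\<close>).

  The unit \<open>\<eta> : E \<rightarrow> \<Delta> \<Sigma> E\<close> (\<open>bc_unit\<close>) sends \<open>x\<close> over \<open>a\<close> to the fibred functor on the slice over \<open>a\<close>
  that takes \<open>f\<close> to the domain of the chosen lift of \<open>f\<close> at \<open>x\<close> (\<open>lift_functor\<close>).  Fibred functors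
  need not preserve chosen lifts, so \<open>\<eta>\<close> is not strictly natural; but it is used only for fixed \<open>E\<close>
  and \<open>F\<close>, to define the inverse equivalence \<open>h \<mapsto> \<Delta> h \<circ> \<eta>\<close> (\<open>right_transpose\<close>).  One composite is
  \<open>h \<circ> \<epsilon> \<circ> \<eta>\<close>, and \<open>\<epsilon> \<circ> \<eta>\<close> is isomorphic to the identity by the chosen lifts of identities
  (\<open>lift_identities\<close>).  The other composite sends \<open>g\<close> to a functor whose value on \<open>x\<close> at \<open>f\<close> is that of
  \<open>g\<close> on the domain of the lift of \<open>f\<close> at the identity; the image of the lift under \<open>g\<close> compares
  it with the value of \<open>g\<close> on \<open>x\<close> at \<open>f\<close> (\<open>transpose_comparison\<close>).

  What makes these functors fibred and the comparison invertible are two descriptions of cartesian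
  arrows.  An arrow of \<open>\<Sigma> E\<close> is cartesian over \<open>B\<close> if and only if it is cartesian over \<open>A\<close> and its
  projection to \<open>A\<close> is cartesian over \<open>B\<close> (\<open>cartesian_sumI\<close>, \<open>cartesian_sumD\<close>).  An arrow of \<open>\<Delta> F\<close> is
  cartesian if and only if its 2-cell is invertible (\<open>bc_cartesianI\<close>, \<open>bc_cartesianD\<close>).
\<close>

section \<open>Categories, functors and natural transformations\<close>

lemma homD:
  assumes "f \<in> hom C x y"
  shows "f \<in> Arr C" and "Dom C f = x" and "Cod C f = y"
  using assms by (auto simp: hom_def)

lemma in_hom: "f \<in> Arr C \<Longrightarrow> f \<in> hom C (Dom C f) (Cod C f)"
  by (simp add: hom_def)

lemma hom_objD:
  assumes "category C" and "f \<in> hom C x y"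
  shows "x \<in> Obj C" and "y \<in> Obj C"
  using assms category.dom_obj category.cod_obj by (fastforce simp: hom_def)+

definition inv_arrow :: "('o, 'm) cat \<Rightarrow> 'm \<Rightarrow> 'm" where
  "inv_arrow C f = (SOME g. g \<in> hom C (Cod C f) (Dom C f) \<and>
      g \<cdot>\<^bsub>C\<^esub> f = Ide C (Dom C f) \<and> f \<cdot>\<^bsub>C\<^esub> g = Ide C (Cod C f))"

lemma inv_arrow:
  assumes "iso_arrow C f" and "f \<in> hom C x y"
  shows "inv_arrow C f \<in> hom C y x" and "inv_arrow C f \<cdot>\<^bsub>C\<^esub> f = Ide C x"
    and "f \<cdot>\<^bsub>C\<^esub> inv_arrow C f = Ide C y"
proof -
  have "\<exists>g. g \<in> hom C (Cod C f) (Dom C f) \<and>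
      g \<cdot>\<^bsub>C\<^esub> f = Ide C (Dom C f) \<and> f \<cdot>\<^bsub>C\<^esub> g = Ide C (Cod C f)"
    using assms(1) unfolding iso_arrow_def by blast
  from someI_ex[OF this] show "inv_arrow C f \<in> hom C y x" "inv_arrow C f \<cdot>\<^bsub>C\<^esub> f = Ide C x"
    "f \<cdot>\<^bsub>C\<^esub> inv_arrow C f = Ide C y"
    using homD[OF assms(2)] by (simp_all add: inv_arrow_def)
qed

lemma iso_arrowI:
  assumes "f \<in> hom C x y" and "g \<in> hom C y x"
    and "g \<cdot>\<^bsub>C\<^esub> f = Ide C x" and "f \<cdot>\<^bsub>C\<^esub> g = Ide C y"
  shows "iso_arrow C f"
  using assms unfolding iso_arrow_def by (auto simp: hom_def)

lemma iso_inv_arrow: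
  assumes "iso_arrow C f" and "f \<in> hom C x y"
  shows "iso_arrow C (inv_arrow C f)"
  using inv_arrow[OF assms] iso_arrowI assms(2) by metis

lemma (in category) iso_ide: "x \<in> Obj C \<Longrightarrow> iso_arrow C (Ide C x)"
  using ide_hom comp_ide_left iso_arrowI by metis

lemma cat_functorI:
  assumes "category C" and "category D"
    and "\<And>x. x \<in> Obj C \<Longrightarrow> fob F x \<in> Obj D" and "fob F \<in> extensional (Obj C)"
    and "far F \<in> extensional (Arr C)"
    and "\<And>f x y. f \<in> hom C x y \<Longrightarrow> far F f \<in> hom D (fob F x) (fob F y)"
    and "\<And>x. x \<in> Obj C \<Longrightarrow> far F (Ide C x) = Ide D (fob F x)"
    and "\<And>f g x y z. f \<in> hom C x y \<Longrightarrow> g \<in> hom C y z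
      \<Longrightarrow> far F (g \<cdot>\<^bsub>C\<^esub> f) = far F g \<cdot>\<^bsub>D\<^esub> far F f"
  shows "cat_functor C D F"
  using assms by (auto simp: cat_functor_def cat_functor_axioms_def PiE_def)

context cat_functor
begin

lemma fob_obj: "x \<in> Obj C \<Longrightarrow> fob F x \<in> Obj D"
  using fob_PiE by blast

lemma fob_ext: "fob F \<in> extensional (Obj C)"
  using fob_PiE by (simp add: PiE_def)

lemma far_iso:
  assumes "iso_arrow C f"
  shows "iso_arrow D (far F f)"
proof -
  from assms have f: "f \<in> hom C (Dom C f) (Cod C f)" by (simp add: iso_arrow_def hom_def)
  note i = inv_arrow[OF assms f]
  have "far F (inv_arrow C f) \<cdot>\<^bsub>D\<^esub> far F f = Ide D (fob F (Dom C f))"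
    using far_comp[OF f i(1)] i(2) far_ide C.dom_obj homD(1)[OF f] by simp
  moreover have "far F f \<cdot>\<^bsub>D\<^esub> far F (inv_arrow C f) = Ide D (fob F (Cod C f))"
    using far_comp[OF i(1) f] i(3) far_ide C.cod_obj homD(1)[OF f] by simp
  ultimately show ?thesis
    using far_hom[OF f] far_hom[OF i(1)] iso_arrowI by metis
qed

end

lemma funct_eqI:
  assumes "cat_functor C D F" and "cat_functor C D' G"
    and "\<And>x. x \<in> Obj C \<Longrightarrow> fob F x = fob G x" and "\<And>f. f \<in> Arr C \<Longrightarrow> far F f = far G f"
  shows "F = G"
proof -
  have "fob F = fob G"
    using cat_functor.fob_ext[OF assms(1)] cat_functor.fob_ext[OF assms(2)] assms(3)
    by (rule extensionalityI)
  moreover have "far F = far G"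
    using cat_functor.far_ext[OF assms(1)] cat_functor.far_ext[OF assms(2)] assms(4)
    by (rule extensionalityI)
  ultimately show ?thesis by simp
qed

lemma fob_comp_func [simp]: "x \<in> Obj C \<Longrightarrow> fob (comp_func C G F) x = fob G (fob F x)"
  and far_comp_func [simp]: "f \<in> Arr C \<Longrightarrow> far (comp_func C G F) f = far G (far F f)"
  by (simp_all add: comp_func_def compose_def)

lemma comp_func_ext [simp]:
  "fob (comp_func C G F) \<in> extensional (Obj C)" "far (comp_func C G F) \<in> extensional (Arr C)"
  by (simp_all add: comp_func_def)

lemma fob_id_func [simp]: "x \<in> Obj C \<Longrightarrow> fob (id_func C) x = x"
  and far_id_func [simp]: "f \<in> Arr C \<Longrightarrow> far (id_func C) f = f"
  by (simp_all add: id_func_def)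

lemma cat_functor_id: "category C \<Longrightarrow> cat_functor C C (id_func C)"
  using category.ide_hom[of C] category.comp_hom[of C] category.dom_obj[of C] category.cod_obj[of C]
  by (intro cat_functorI) (auto simp: id_func_def hom_def)

lemma cat_functor_comp:
  assumes "cat_functor C D F" and "cat_functor D E G"
  shows "cat_functor C E (comp_func C G F)"
proof -
  interpret F: cat_functor C D F by fact
  interpret G: cat_functor D E G by fact
  show ?thesis
  proof (rule cat_functorI)
    fix f x y assume f: "f \<in> hom C x y"
    then have "x \<in> Obj C" "y \<in> Obj C" "f \<in> Arr C"
      using hom_objD[OF F.C.category_axioms f] homD by auto
    then show "far (comp_func C G F) f \<in> hom E (fob (comp_func C G F) x) (fob (comp_func C G F) y)"
      using F.far_hom[OF f] G.far_hom by simp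
  next
    fix f g x y z assume f: "f \<in> hom C x y" and g: "g \<in> hom C y z"
    show "far (comp_func C G F) (g \<cdot>\<^bsub>C\<^esub> f) = far (comp_func C G F) g \<cdot>\<^bsub>E\<^esub> far (comp_func C G F) f"
      using F.far_comp[OF f g] G.far_comp[OF F.far_hom[OF f] F.far_hom[OF g]]
        homD(1)[OF f] homD(1)[OF g] homD(1)[OF F.C.comp_hom[OF f g]] by simp
  next
    fix x assume x: "x \<in> Obj C"
    show "far (comp_func C G F) (Ide C x) = Ide E (fob (comp_func C G F) x)"
      using x F.far_ide G.far_ide F.fob_obj homD(1)[OF F.C.ide_hom[OF x]] by simp
  qed (auto simp: F.fob_obj G.fob_obj F.C.category_axioms G.D.category_axioms)
qed

lemma comp_func_assoc:
  assumes "cat_functor C D F"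
  shows "comp_func C (comp_func D H G) F = comp_func C H (comp_func C G F)"
proof -
  interpret F: cat_functor C D F by fact
  have "far F m \<in> Arr D" if "m \<in> Arr C" for m
    using F.far_hom[OF in_hom[OF that]] homD by fast
  then have "far F \<in> Arr C \<rightarrow> Arr D" by blast
  moreover have "fob F \<in> Obj C \<rightarrow> Obj D" using F.fob_obj by blast
  ultimately show ?thesis by (simp add: comp_func_def compose_assoc)
qed

lemma comp_func_id_right:
  assumes "cat_functor C D F"
  shows "comp_func C F (id_func C) = F"
proof -
  have "category C" using assms by (simp add: cat_functor_def)
  then show ?thesis
    using assms cat_functor_comp[OF cat_functor_id[of C] assms] by (intro funct_eqI[of C D _ D]) auto
qed

lemma comp_func_id_left:
  assumes "cat_functor C D F"
  shows "comp_func C (id_func D) F = F"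
proof -
  interpret F: cat_functor C D F by fact
  have "far F m \<in> Arr D" if "m \<in> Arr C" for m
    using F.far_hom[OF in_hom[OF that]] homD by fast
  then show ?thesis
    using assms cat_functor_comp[OF assms cat_functor_id[OF F.D.category_axioms]] F.fob_obj
    by (intro funct_eqI[of C D _ D]) auto
qed

subsection \<open>Operations on natural transformations\<close>

lemma nt_eqI:
  fixes \<sigma> \<tau> :: "('o, 'm, 'p, 'n) nt" and C :: "('o, 'm) cat"
  assumes "component \<sigma> \<in> extensional (Obj C)" and "component \<tau> \<in> extensional (Obj C)"
    and "NDom \<sigma> = NDom \<tau>" and "NCod \<sigma> = NCod \<tau>"
    and "\<And>x. x \<in> Obj C \<Longrightarrow> component \<sigma> x = component \<tau> x"
  shows "\<sigma> = \<tau>"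
proof -
  have "component \<sigma> = component \<tau>" using assms(1,2,5) by (rule extensionalityI)
  then show ?thesis using assms(3,4) by simp
qed

lemma id_nt_simps [simp]:
  "NDom (id_nt C D F) = F" "NCod (id_nt C D F) = F"
  "x \<in> Obj C \<Longrightarrow> component (id_nt C D F) x = Ide D (fob F x)"
  "component (id_nt C D F) \<in> extensional (Obj C)"
  by (simp_all add: id_nt_def)

lemma vcomp_simps [simp]:
  "NDom (vcomp C D \<beta> \<alpha>) = NDom \<alpha>" "NCod (vcomp C D \<beta> \<alpha>) = NCod \<beta>"
  "x \<in> Obj C \<Longrightarrow> component (vcomp C D \<beta> \<alpha>) x = component \<beta> x \<cdot>\<^bsub>D\<^esub> component \<alpha> x"
  "component (vcomp C D \<beta> \<alpha>) \<in> extensional (Obj C)"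
  by (simp_all add: vcomp_def)

lemma hcomp_simps [simp]:
  "NDom (hcomp C E \<beta> \<alpha>) = comp_func C (NDom \<beta>) (NDom \<alpha>)"
  "NCod (hcomp C E \<beta> \<alpha>) = comp_func C (NCod \<beta>) (NCod \<alpha>)"
  "x \<in> Obj C \<Longrightarrow> component (hcomp C E \<beta> \<alpha>) x
    = component \<beta> (fob (NCod \<alpha>) x) \<cdot>\<^bsub>E\<^esub> far (NDom \<beta>) (component \<alpha> x)"
  "component (hcomp C E \<beta> \<alpha>) \<in> extensional (Obj C)"
  by (simp_all add: hcomp_def)

lemma whisker_left_simps [simp]:
  "NDom (whisker_left C G \<alpha>) = comp_func C G (NDom \<alpha>)"
  "NCod (whisker_left C G \<alpha>) = comp_func C G (NCod \<alpha>)"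
  "x \<in> Obj C \<Longrightarrow> component (whisker_left C G \<alpha>) x = far G (component \<alpha> x)"
  "component (whisker_left C G \<alpha>) \<in> extensional (Obj C)"
  by (simp_all add: whisker_left_def)

lemma whisker_right_simps [simp]:
  "NDom (whisker_right C \<beta> F) = comp_func C (NDom \<beta>) F"
  "NCod (whisker_right C \<beta> F) = comp_func C (NCod \<beta>) F"
  "x \<in> Obj C \<Longrightarrow> component (whisker_right C \<beta> F) x = component \<beta> (fob F x)"
  "component (whisker_right C \<beta> F) \<in> extensional (Obj C)"
  by (simp_all add: whisker_right_def)

lemma nat_transformationI:
  assumes "cat_functor C D (NDom \<tau>)" and "cat_functor C D (NCod \<tau>)"
    and "component \<tau> \<in> extensional (Obj C)"
    and "\<And>x. x \<in> Obj C \<Longrightarrow> component \<tau> x \<in> hom D (fob (NDom \<tau>) x) (fob (NCod \<tau>) x)"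
    and "\<And>f x y. f \<in> hom C x y
      \<Longrightarrow> component \<tau> y \<cdot>\<^bsub>D\<^esub> far (NDom \<tau>) f = far (NCod \<tau>) f \<cdot>\<^bsub>D\<^esub> component \<tau> x"
  shows "nat_transformation C D \<tau>"
  using assms by (simp add: nat_transformation_def nat_transformation_axioms_def)

lemma nat_transformation_id:
  assumes "cat_functor C D F"
  shows "nat_transformation C D (id_nt C D F)"
proof -
  interpret F: cat_functor C D F by fact
  show ?thesis
  proof (rule nat_transformationI)
    fix f x y assume f: "f \<in> hom C x y"
    show "component (id_nt C D F) y \<cdot>\<^bsub>D\<^esub> far (NDom (id_nt C D F)) f
      = far (NCod (id_nt C D F)) f \<cdot>\<^bsub>D\<^esub> component (id_nt C D F) x"
      using F.far_hom[OF f] F.D.comp_ide_left F.D.comp_ide_right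
        hom_objD[OF F.C.category_axioms f] by simp
  qed (auto simp: assms F.fob_obj F.D.ide_hom)
qed

lemma nat_transformation_vcomp:
  assumes "nat_transformation C D \<alpha>" and "nat_transformation C D \<beta>" and "NDom \<beta> = NCod \<alpha>"
  shows "nat_transformation C D (vcomp C D \<beta> \<alpha>)"
proof -
  interpret a: nat_transformation C D \<alpha> by fact
  interpret b: nat_transformation C D \<beta> by fact
  have comp: "component \<beta> x \<cdot>\<^bsub>D\<^esub> component \<alpha> x \<in> hom D (fob (NDom \<alpha>) x) (fob (NCod \<beta>) x)"
    if "x \<in> Obj C" for x
    using a.NDom.D.comp_hom[OF a.component_hom[OF that]] b.component_hom[OF that] assms(3) by simp
  show ?thesis
  proof (rule nat_transformationI)
    fix f x y assume f: "f \<in> hom C x y"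
    have x: "x \<in> Obj C" and y: "y \<in> Obj C"
      using hom_objD[OF a.NDom.C.category_axioms f] by auto
    have "(component \<beta> y \<cdot>\<^bsub>D\<^esub> component \<alpha> y) \<cdot>\<^bsub>D\<^esub> far (NDom \<alpha>) f
        = component \<beta> y \<cdot>\<^bsub>D\<^esub> (far (NCod \<alpha>) f \<cdot>\<^bsub>D\<^esub> component \<alpha> x)"
      using a.NDom.D.comp_assoc[OF a.NDom.far_hom[OF f] a.component_hom[OF y]]
        b.component_hom[OF y] assms(3) a.naturality[OF f] by simp
    also have "\<dots> = (component \<beta> y \<cdot>\<^bsub>D\<^esub> far (NDom \<beta>) f) \<cdot>\<^bsub>D\<^esub> component \<alpha> x"
      using a.NDom.D.comp_assoc[OF a.component_hom[OF x] a.NCod.far_hom[OF f]]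
        b.component_hom[OF y] assms(3) by simp
    also have "\<dots> = far (NCod \<beta>) f \<cdot>\<^bsub>D\<^esub> (component \<beta> x \<cdot>\<^bsub>D\<^esub> component \<alpha> x)"
      using a.NDom.D.comp_assoc[OF a.component_hom[OF x] _ b.NCod.far_hom[OF f]]
        b.component_hom[OF x] assms(3) b.naturality[OF f] by simp
    finally show "component (vcomp C D \<beta> \<alpha>) y \<cdot>\<^bsub>D\<^esub> far (NDom (vcomp C D \<beta> \<alpha>)) f
      = far (NCod (vcomp C D \<beta> \<alpha>)) f \<cdot>\<^bsub>D\<^esub> component (vcomp C D \<beta> \<alpha>) x"
      using x y by simp
  qed (auto simp: comp a.NDom.cat_functor_axioms b.NCod.cat_functor_axioms)
qed

lemma nat_transformation_whisker_left:
  assumes "nat_transformation C D \<alpha>" and "cat_functor D E G"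
  shows "nat_transformation C E (whisker_left C G \<alpha>)"
proof -
  interpret a: nat_transformation C D \<alpha> by fact
  interpret G: cat_functor D E G by fact
  show ?thesis
  proof (rule nat_transformationI)
    fix f x y assume f: "f \<in> hom C x y"
    have x: "x \<in> Obj C" and y: "y \<in> Obj C"
      using hom_objD[OF a.NDom.C.category_axioms f] by auto
    show "component (whisker_left C G \<alpha>) y \<cdot>\<^bsub>E\<^esub> far (NDom (whisker_left C G \<alpha>)) f
      = far (NCod (whisker_left C G \<alpha>)) f \<cdot>\<^bsub>E\<^esub> component (whisker_left C G \<alpha>) x"
      using G.far_comp[OF a.NDom.far_hom[OF f] a.component_hom[OF y]]
        G.far_comp[OF a.component_hom[OF x] a.NCod.far_hom[OF f]] a.naturality[OF f]
        x y homD(1)[OF f] by simp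
  next
    fix x assume "x \<in> Obj C"
    then show "component (whisker_left C G \<alpha>) x
      \<in> hom E (fob (NDom (whisker_left C G \<alpha>)) x) (fob (NCod (whisker_left C G \<alpha>)) x)"
      using G.far_hom[OF a.component_hom] by simp
  qed (auto simp: assms cat_functor_comp[OF a.NDom.cat_functor_axioms]
      cat_functor_comp[OF a.NCod.cat_functor_axioms])
qed

lemma nat_transformation_whisker_right:
  assumes "cat_functor C D F" and "nat_transformation D E \<beta>"
  shows "nat_transformation C E (whisker_right C \<beta> F)"
proof -
  interpret F: cat_functor C D F by fact
  interpret b: nat_transformation D E \<beta> by fact
  show ?thesis
  proof (rule nat_transformationI)
    fix f x y assume f: "f \<in> hom C x y"
    have x: "x \<in> Obj C" and y: "y \<in> Obj C"
      using hom_objD[OF F.C.category_axioms f] by auto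
    show "component (whisker_right C \<beta> F) y \<cdot>\<^bsub>E\<^esub> far (NDom (whisker_right C \<beta> F)) f
      = far (NCod (whisker_right C \<beta> F)) f \<cdot>\<^bsub>E\<^esub> component (whisker_right C \<beta> F) x"
      using b.naturality[OF F.far_hom[OF f]] x y homD(1)[OF f] by simp
  next
    fix x assume "x \<in> Obj C"
    then show "component (whisker_right C \<beta> F) x
      \<in> hom E (fob (NDom (whisker_right C \<beta> F)) x) (fob (NCod (whisker_right C \<beta> F)) x)"
      using b.component_hom[OF F.fob_obj] by simp
  qed (auto simp: assms cat_functor_comp[OF _ b.NDom.cat_functor_axioms]
      cat_functor_comp[OF _ b.NCod.cat_functor_axioms])
qed

text \<open>Horizontal composites reduce to whiskerings, so that closure properties need to be checked
  for the latter only.\<close>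

lemma hcomp_eq_vcomp_whisker:
  "hcomp C E \<beta> \<alpha> = vcomp C E (whisker_right C \<beta> (NCod \<alpha>)) (whisker_left C (NDom \<beta>) \<alpha>)"
  by (rule nt_eqI[where C = C]) auto

lemma nat_iso_inverse:
  assumes "nat_iso C D \<tau>"
  obtains \<sigma> where "nat_iso C D \<sigma>" and "NDom \<sigma> = NCod \<tau>" and "NCod \<sigma> = NDom \<tau>"
    and "\<And>x. x \<in> Obj C \<Longrightarrow> component \<sigma> x = inv_arrow D (component \<tau> x)"
proof -
  define \<sigma> where "\<sigma> = \<lparr>NDom = NCod \<tau>, NCod = NDom \<tau>,
    component = (\<lambda>x \<in> Obj C. inv_arrow D (component \<tau> x))\<rparr>"
  interpret t: nat_transformation C D \<tau> using assms by (simp add: nat_iso_def)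
  have iso: "iso_arrow D (component \<tau> x)" if "x \<in> Obj C" for x
    using assms that by (simp add: nat_iso_def)
  note inv = inv_arrow[OF iso t.component_hom]
  have "nat_transformation C D \<sigma>"
  proof (rule nat_transformationI)
    fix f x y assume f: "f \<in> hom C x y"
    have x: "x \<in> Obj C" and y: "y \<in> Obj C"
      using hom_objD[OF t.NDom.C.category_axioms f] by auto
    have F: "far (NDom \<tau>) f \<in> hom D (fob (NDom \<tau>) x) (fob (NDom \<tau>) y)"
      and G: "far (NCod \<tau>) f \<in> hom D (fob (NCod \<tau>) x) (fob (NCod \<tau>) y)"
      using t.NDom.far_hom[OF f] t.NCod.far_hom[OF f] by auto
    note ix = inv[OF x x] and iy = inv[OF y y]
    note cx = t.component_hom[OF x] and cy = t.component_hom[OF y]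
    let ?i = "inv_arrow D (component \<tau> x)" and ?j = "inv_arrow D (component \<tau> y)"
    have "?j \<cdot>\<^bsub>D\<^esub> far (NCod \<tau>) f = ?j \<cdot>\<^bsub>D\<^esub> (far (NCod \<tau>) f \<cdot>\<^bsub>D\<^esub> (component \<tau> x \<cdot>\<^bsub>D\<^esub> ?i))"
      using ix(3) t.NDom.D.comp_ide_right[OF G] by simp
    also have "\<dots> = ?j \<cdot>\<^bsub>D\<^esub> ((component \<tau> y \<cdot>\<^bsub>D\<^esub> far (NDom \<tau>) f) \<cdot>\<^bsub>D\<^esub> ?i)"
      using t.NDom.D.comp_assoc[OF ix(1) cx G] t.naturality[OF f] by simp
    also have "\<dots> = (?j \<cdot>\<^bsub>D\<^esub> component \<tau> y) \<cdot>\<^bsub>D\<^esub> (far (NDom \<tau>) f \<cdot>\<^bsub>D\<^esub> ?i)"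
      using t.NDom.D.comp_assoc[OF ix(1) F cy]
        t.NDom.D.comp_assoc[OF t.NDom.D.comp_hom[OF ix(1) F] cy iy(1)] by simp
    also have "\<dots> = far (NDom \<tau>) f \<cdot>\<^bsub>D\<^esub> ?i"
      using iy(2) t.NDom.D.comp_ide_left[OF t.NDom.D.comp_hom[OF ix(1) F]] by simp
    finally show "component \<sigma> y \<cdot>\<^bsub>D\<^esub> far (NDom \<sigma>) f = far (NCod \<sigma>) f \<cdot>\<^bsub>D\<^esub> component \<sigma> x"
      using x y by (simp add: \<sigma>_def)
  qed (auto simp: \<sigma>_def t.NDom.cat_functor_axioms t.NCod.cat_functor_axioms inv)
  moreover have "iso_arrow D (component \<sigma> x)" if "x \<in> Obj C" for x
    using iso_inv_arrow[OF iso[OF that] t.component_hom[OF that]] that by (simp add: \<sigma>_def)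
  ultimately have "nat_iso C D \<sigma>" by (simp add: nat_iso_def)
  then show ?thesis by (rule that) (auto simp: \<sigma>_def)
qed

text \<open>The unit is given here by its inverse \<open>G F \<Rightarrow> 1\<close>, the direction in which the comparison for
  transposition has an explicit formula.\<close>

lemma cat_equivalenceI:
  assumes "cat_functor C D F" and "cat_functor D C G"
    and "nat_iso C C \<rho>" and "NDom \<rho> = comp_func C G F" and "NCod \<rho> = id_func C"
    and "nat_iso D D \<epsilon>" and "NDom \<epsilon> = comp_func D F G" and "NCod \<epsilon> = id_func D"
  shows "cat_equivalence C D F"
proof -
  from nat_iso_inverse[OF assms(3)] obtain \<eta> where "nat_iso C C \<eta>" "NDom \<eta> = NCod \<rho>"
    "NCod \<eta> = NDom \<rho>" by blast
  with assms show ?thesis unfolding cat_equivalence_def by metis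
qed

section \<open>The 2-category of fibrations\<close>

lemma cloven_category:
  assumes "cloven_fibration B E"
  shows "category (Tot E)" and "category B" and "cat_functor (Tot E) B (Proj E)"
  using assms by (auto simp: cloven_fibration_def cat_functor_def)

context fibred_functor
begin

lemma proj_fob: "x \<in> Obj (Tot E) \<Longrightarrow> fob (Proj F) (fob f x) = fob (Proj E) x"
  using over_base fob_comp_func by metis

lemma proj_far: "m \<in> Arr (Tot E) \<Longrightarrow> far (Proj F) (far f m) = far (Proj E) m"
  using over_base far_comp_func by metis

end

lemma fibred_functorI:
  assumes "cat_functor (Tot E) (Tot F) f" and "cat_functor (Tot E) B (Proj E)"
    and "cat_functor (Tot F) B (Proj F)"
    and "\<And>x. x \<in> Obj (Tot E) \<Longrightarrow> fob (Proj F) (fob f x) = fob (Proj E) x"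
    and "\<And>m. m \<in> Arr (Tot E) \<Longrightarrow> far (Proj F) (far f m) = far (Proj E) m"
    and "\<And>m. cartesian_arrow B E m \<Longrightarrow> cartesian_arrow B F (far f m)"
  shows "fibred_functor B E F f"
proof -
  have "comp_func (Tot E) (Proj F) f = Proj E"
    using assms cat_functor_comp[OF assms(1,3)] by (intro funct_eqI[of "Tot E" B _ B]) auto
  with assms show ?thesis by (simp add: fibred_functor_def fibred_functor_axioms_def)
qed

lemma fibred_natI:
  assumes "nat_transformation (Tot E) (Tot F) \<tau>"
    and "fibred_functor B E F (NDom \<tau>)" and "fibred_functor B E F (NCod \<tau>)"
    and "\<And>x. x \<in> Obj (Tot E) \<Longrightarrow> far (Proj F) (component \<tau> x) = Ide B (fob (Proj E) x)"
  shows "fibred_nat B E F \<tau>"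
  using assms by (simp add: fibred_nat_def fibred_nat_axioms_def)

lemma fibred_natD:
  assumes "fibred_nat B E F \<tau>"
  shows "nat_transformation (Tot E) (Tot F) \<tau>"
    and "fibred_functor B E F (NDom \<tau>)" and "fibred_functor B E F (NCod \<tau>)"
    and "x \<in> Obj (Tot E) \<Longrightarrow> far (Proj F) (component \<tau> x) = Ide B (fob (Proj E) x)"
  using assms by (simp_all add: fibred_nat_def fibred_nat_axioms_def)

lemma fibred_functorD:
  assumes "fibred_functor B E F f"
  shows "cat_functor (Tot E) (Tot F) f"
  using assms by (simp add: fibred_functor_def)

lemma Fib_hom_simps [simp]:
  "f \<in> Obj (Fib_hom B E F) \<longleftrightarrow> fibred_functor B E F f"
  "\<tau> \<in> Arr (Fib_hom B E F) \<longleftrightarrow> fibred_nat B E F \<tau>"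
  "Dom (Fib_hom B E F) = NDom" "Cod (Fib_hom B E F) = NCod"
  "Ide (Fib_hom B E F) = id_nt (Tot E) (Tot F)" "Comp (Fib_hom B E F) = vcomp (Tot E) (Tot F)"
  by (simp_all add: Fib_hom_def)

lemma hom_Fib_hom:
  "\<tau> \<in> hom (Fib_hom B E F) f g \<longleftrightarrow> fibred_nat B E F \<tau> \<and> NDom \<tau> = f \<and> NCod \<tau> = g"
  by (simp add: hom_def)

lemma fibred_nat_eqI:
  assumes "fibred_nat B E F \<sigma>" and "fibred_nat B E' F' \<tau>" and "Tot E' = Tot E"
    and "NDom \<sigma> = NDom \<tau>" and "NCod \<sigma> = NCod \<tau>"
    and "\<And>x. x \<in> Obj (Tot E) \<Longrightarrow> component \<sigma> x = component \<tau> x"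
  shows "\<sigma> = \<tau>"
  using assms nat_transformation.component_ext[OF fibred_natD(1)[OF assms(1)]]
    nat_transformation.component_ext[OF fibred_natD(1)[OF assms(2)]]
  by (intro nt_eqI[of _ "Tot E"]) auto

lemma fibred_functor_id:
  assumes "cloven_fibration B E"
  shows "fibred_functor B E E (id_func (Tot E))"
  using cloven_category[OF assms]
  by (intro fibred_functorI) (auto simp: cat_functor_id cartesian_arrow_def)

lemma fibred_functor_comp:
  assumes f: "fibred_functor B E F f" and g: "fibred_functor B F G g"
  shows "fibred_functor B E G (comp_func (Tot E) g f)"
proof -
  interpret f: fibred_functor B E F f by fact
  interpret g: fibred_functor B F G g by fact
  have "comp_func (Tot E) (Proj G) (comp_func (Tot E) g f) = Proj E"
    using comp_func_assoc[OF f.cat_functor_axioms] g.over_base f.over_base by metis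
  moreover have "cartesian_arrow B G (far (comp_func (Tot E) g f) m)" if "cartesian_arrow B E m" for m
    using g.preserves_cartesian[OF f.preserves_cartesian[OF that]] that
    by (simp add: cartesian_arrow_def)
  ultimately show ?thesis
    using cat_functor_comp[OF f.cat_functor_axioms g.cat_functor_axioms]
    by (simp add: fibred_functor_def fibred_functor_axioms_def)
qed

lemma fibred_nat_id:
  assumes "cloven_fibration B F" and "fibred_functor B E F f"
  shows "fibred_nat B E F (id_nt (Tot E) (Tot F) f)"
proof -
  interpret f: fibred_functor B E F f by fact
  interpret F: cloven_fibration B F by fact
  show ?thesis
    using assms(2) nat_transformation_id[OF f.cat_functor_axioms]
    by (intro fibred_natI) (auto simp: F.far_ide f.fob_obj f.proj_fob)
qed

lemma fibred_nat_vcomp: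
  assumes "cloven_fibration B F" and a: "fibred_nat B E F \<alpha>" and b: "fibred_nat B E F \<beta>"
    and eq: "NDom \<beta> = NCod \<alpha>"
  shows "fibred_nat B E F (vcomp (Tot E) (Tot F) \<beta> \<alpha>)"
proof -
  interpret F: cloven_fibration B F by fact
  interpret a: fibred_nat B E F \<alpha> by fact
  interpret b: fibred_nat B E F \<beta> by fact
  have "far (Proj F) (component \<beta> x \<cdot>\<^bsub>Tot F\<^esub> component \<alpha> x) = Ide B (fob (Proj E) x)"
    if x: "x \<in> Obj (Tot E)" for x
  proof -
    have o: "fob (Proj E) x \<in> Obj B"
      using F.fob_obj[OF a.NDom.fob_obj[OF x]] a.NDom.proj_fob[OF x] by simp
    show ?thesis
      using F.far_comp[OF a.component_hom[OF x], of "component \<beta> x"] b.component_hom[OF x] eq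
        a.vertical[OF x] b.vertical[OF x] F.D.comp_ide_left[OF F.D.ide_hom[OF o]] by simp
  qed
  then show ?thesis
    using nat_transformation_vcomp[OF a.nat_transformation_axioms b.nat_transformation_axioms eq]
      a.NDom.fibred_functor_axioms b.NCod.fibred_functor_axioms
    by (intro fibred_natI) auto
qed

lemma fibred_nat_whisker_left:
  assumes "fibred_nat B E F \<alpha>" and "fibred_functor B F G g"
  shows "fibred_nat B E G (whisker_left (Tot E) g \<alpha>)"
proof -
  interpret a: fibred_nat B E F \<alpha> by fact
  interpret g: fibred_functor B F G g by fact
  have "far (Proj G) (far g (component \<alpha> x)) = Ide B (fob (Proj E) x)"
    if x: "x \<in> Obj (Tot E)" for x
    using g.proj_far[OF homD(1)[OF a.component_hom[OF x]]] a.vertical[OF x] by simp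
  then show ?thesis
    using nat_transformation_whisker_left[OF a.nat_transformation_axioms g.cat_functor_axioms]
      fibred_functor_comp[OF a.NDom.fibred_functor_axioms assms(2)]
      fibred_functor_comp[OF a.NCod.fibred_functor_axioms assms(2)]
    by (intro fibred_natI) auto
qed

lemma fibred_nat_whisker_right:
  assumes "fibred_functor B E F f" and "fibred_nat B F G \<beta>"
  shows "fibred_nat B E G (whisker_right (Tot E) \<beta> f)"
proof -
  interpret f: fibred_functor B E F f by fact
  interpret b: fibred_nat B F G \<beta> by fact
  show ?thesis
    using nat_transformation_whisker_right[OF f.cat_functor_axioms b.nat_transformation_axioms]
      fibred_functor_comp[OF assms(1) b.NDom.fibred_functor_axioms]
      fibred_functor_comp[OF assms(1) b.NCod.fibred_functor_axioms]
    by (intro fibred_natI) (auto simp: b.vertical f.fob_obj f.proj_fob)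
qed

lemma fibred_nat_hcomp:
  assumes "cloven_fibration B G" and a: "fibred_nat B E F \<alpha>" and b: "fibred_nat B F G \<beta>"
  shows "fibred_nat B E G (hcomp (Tot E) (Tot G) \<beta> \<alpha>)"
  unfolding hcomp_eq_vcomp_whisker
  using fibred_nat_whisker_left[OF a fibred_natD(2)[OF b]]
    fibred_nat_whisker_right[OF fibred_natD(3)[OF a] b]
  by (intro fibred_nat_vcomp assms(1)) auto

lemma category_Fib_hom:
  assumes E: "cloven_fibration B E" and F: "cloven_fibration B F"
  shows "category (Fib_hom B E F)"
proof -
  interpret F: cloven_fibration B F by fact
  have lunit: "vcomp (Tot E) (Tot F) (id_nt (Tot E) (Tot F) (NCod \<tau>)) \<tau> = \<tau>"
    and runit: "vcomp (Tot E) (Tot F) \<tau> (id_nt (Tot E) (Tot F) (NDom \<tau>)) = \<tau>"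
    if "fibred_nat B E F \<tau>" for \<tau>
  proof -
    interpret t: fibred_nat B E F \<tau> by fact
    show "vcomp (Tot E) (Tot F) (id_nt (Tot E) (Tot F) (NCod \<tau>)) \<tau> = \<tau>"
      using F.C.comp_ide_left[OF t.component_hom] t.component_ext
      by (intro nt_eqI[of _ "Tot E"]) auto
    show "vcomp (Tot E) (Tot F) \<tau> (id_nt (Tot E) (Tot F) (NDom \<tau>)) = \<tau>"
      using F.C.comp_ide_right[OF t.component_hom] t.component_ext
      by (intro nt_eqI[of _ "Tot E"]) auto
  qed
  have assoc: "vcomp (Tot E) (Tot F) (vcomp (Tot E) (Tot F) \<gamma> \<beta>) \<alpha>
      = vcomp (Tot E) (Tot F) \<gamma> (vcomp (Tot E) (Tot F) \<beta> \<alpha>)"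
    if "fibred_nat B E F \<alpha>" "fibred_nat B E F \<beta>" "fibred_nat B E F \<gamma>"
      "NDom \<beta> = NCod \<alpha>" "NDom \<gamma> = NCod \<beta>" for \<alpha> \<beta> \<gamma>
  proof -
    interpret a: fibred_nat B E F \<alpha> by fact
    interpret b: fibred_nat B E F \<beta> by fact
    interpret c: fibred_nat B E F \<gamma> by fact
    show ?thesis
    proof (rule nt_eqI[of _ "Tot E"])
      fix x assume x: "x \<in> Obj (Tot E)"
      show "component (vcomp (Tot E) (Tot F) (vcomp (Tot E) (Tot F) \<gamma> \<beta>) \<alpha>) x =
        component (vcomp (Tot E) (Tot F) \<gamma> (vcomp (Tot E) (Tot F) \<beta> \<alpha>)) x"
        using F.C.comp_assoc[OF a.component_hom[OF x]] b.component_hom[OF x] c.component_hom[OF x]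
          x that(4,5) by simp
    qed auto
  qed
  show ?thesis
    using lunit runit assoc fibred_nat_vcomp[OF F] fibred_nat_id[OF F]
    by unfold_locales (auto simp: hom_def fibred_natD)
qed

text \<open>The interchange law is the naturality of the second 2-cell.\<close>

lemma interchange_Fib:
  assumes a: "fibred_nat B E F \<alpha>" and a': "fibred_nat B E F \<alpha>'" and aa: "NDom \<alpha>' = NCod \<alpha>"
    and b: "fibred_nat B F G \<beta>" and b': "fibred_nat B F G \<beta>'" and bb: "NDom \<beta>' = NCod \<beta>"
  shows "hcomp (Tot E) (Tot G) (vcomp (Tot F) (Tot G) \<beta>' \<beta>) (vcomp (Tot E) (Tot F) \<alpha>' \<alpha>)
    = vcomp (Tot E) (Tot G) (hcomp (Tot E) (Tot G) \<beta>' \<alpha>') (hcomp (Tot E) (Tot G) \<beta> \<alpha>)"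
proof (rule nt_eqI[of _ "Tot E"])
  interpret a: fibred_nat B E F \<alpha> by fact
  interpret a': fibred_nat B E F \<alpha>' by fact
  interpret b: fibred_nat B F G \<beta> by fact
  interpret b': fibred_nat B F G \<beta>' by fact
  fix x assume x: "x \<in> Obj (Tot E)"
  let ?c = "Comp (Tot G)"
  let ?y0 = "fob (NDom \<alpha>) x" and ?y1 = "fob (NCod \<alpha>) x" and ?y2 = "fob (NCod \<alpha>') x"
  have y: "?y0 \<in> Obj (Tot F)" "?y1 \<in> Obj (Tot F)" "?y2 \<in> Obj (Tot F)"
    using x a.NDom.fob_obj a.NCod.fob_obj a'.NCod.fob_obj by auto
  have h: "component \<alpha> x \<in> hom (Tot F) ?y0 ?y1" "component \<alpha>' x \<in> hom (Tot F) ?y1 ?y2"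
    using a.component_hom[OF x] a'.component_hom[OF x] aa by auto
  let ?p = "far (NDom \<beta>) (component \<alpha> x)" and ?q = "far (NDom \<beta>) (component \<alpha>' x)"
  let ?q' = "far (NCod \<beta>) (component \<alpha>' x)"
  let ?r = "component \<beta> ?y2" and ?s = "component \<beta>' ?y2" and ?r' = "component \<beta> ?y1"
  have hp: "?p \<in> hom (Tot G) (fob (NDom \<beta>) ?y0) (fob (NDom \<beta>) ?y1)"
    and hq: "?q \<in> hom (Tot G) (fob (NDom \<beta>) ?y1) (fob (NDom \<beta>) ?y2)"
    and hq': "?q' \<in> hom (Tot G) (fob (NCod \<beta>) ?y1) (fob (NCod \<beta>) ?y2)"
    and hr: "?r \<in> hom (Tot G) (fob (NDom \<beta>) ?y2) (fob (NCod \<beta>) ?y2)"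
    and hr': "?r' \<in> hom (Tot G) (fob (NDom \<beta>) ?y1) (fob (NCod \<beta>) ?y1)"
    and hs: "?s \<in> hom (Tot G) (fob (NCod \<beta>) ?y2) (fob (NCod \<beta>') ?y2)"
    using b.NDom.far_hom h b.NCod.far_hom b.component_hom b'.component_hom y bb by auto
  note assoc = b.NDom.D.comp_assoc and comp = b.NDom.D.comp_hom
  have "?c (?c ?s ?r) (?c ?q ?p) = ?c (?c ?s (?c ?r ?q)) ?p"
    using assoc[OF hp hq comp[OF hr hs]] assoc[OF hq hr hs] by simp
  also have "?c ?r ?q = ?c ?q' ?r'" using b.naturality[OF h(2)] .
  also have "?c (?c ?s (?c ?q' ?r')) ?p = ?c (?c ?s ?q') (?c ?r' ?p)"
    using assoc[OF hp hr' comp[OF hq' hs]] assoc[OF hr' hq' hs] by simp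
  finally show "component (hcomp (Tot E) (Tot G) (vcomp (Tot F) (Tot G) \<beta>' \<beta>)
        (vcomp (Tot E) (Tot F) \<alpha>' \<alpha>)) x
      = component (vcomp (Tot E) (Tot G) (hcomp (Tot E) (Tot G) \<beta>' \<alpha>')
        (hcomp (Tot E) (Tot G) \<beta> \<alpha>)) x"
    using x y b.NDom.far_comp[OF h] aa bb by simp
qed (auto simp: aa bb)

lemma hcomp_assoc:
  assumes a: "fibred_nat B E F \<alpha>" and b: "fibred_nat B F G \<beta>" and c: "fibred_nat B G H \<gamma>"
  shows "hcomp (Tot E) (Tot H) (hcomp (Tot F) (Tot H) \<gamma> \<beta>) \<alpha>
    = hcomp (Tot E) (Tot H) \<gamma> (hcomp (Tot E) (Tot G) \<beta> \<alpha>)"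
proof (rule nt_eqI[of _ "Tot E"])
  interpret a: fibred_nat B E F \<alpha> by fact
  interpret b: fibred_nat B F G \<beta> by fact
  interpret c: fibred_nat B G H \<gamma> by fact
  show "NDom (hcomp (Tot E) (Tot H) (hcomp (Tot F) (Tot H) \<gamma> \<beta>) \<alpha>)
    = NDom (hcomp (Tot E) (Tot H) \<gamma> (hcomp (Tot E) (Tot G) \<beta> \<alpha>))"
    using comp_func_assoc[OF a.NDom.cat_functor_axioms] by simp
  show "NCod (hcomp (Tot E) (Tot H) (hcomp (Tot F) (Tot H) \<gamma> \<beta>) \<alpha>)
    = NCod (hcomp (Tot E) (Tot H) \<gamma> (hcomp (Tot E) (Tot G) \<beta> \<alpha>))"
    using comp_func_assoc[OF a.NCod.cat_functor_axioms] by simp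
  fix x assume x: "x \<in> Obj (Tot E)"
  note hx = a.component_hom[OF x]
  have y: "fob (NCod \<alpha>) x \<in> Obj (Tot F)" using x a.NCod.fob_obj by auto
  note h1 = b.NDom.far_hom[OF hx] and h2 = b.component_hom[OF y]
  have y': "fob (NCod \<beta>) (fob (NCod \<alpha>) x) \<in> Obj (Tot G)" using y b.NCod.fob_obj by auto
  show "component (hcomp (Tot E) (Tot H) (hcomp (Tot F) (Tot H) \<gamma> \<beta>) \<alpha>) x
    = component (hcomp (Tot E) (Tot H) \<gamma> (hcomp (Tot E) (Tot G) \<beta> \<alpha>)) x"
    using x y homD(1)[OF hx] c.NDom.far_comp[OF h1 h2]
      c.NDom.D.comp_assoc[OF c.NDom.far_hom[OF h1] c.NDom.far_hom[OF h2] c.component_hom[OF y']]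
    by simp
qed auto

lemma hcomp_id_left:
  assumes a: "fibred_nat B E F \<alpha>"
  shows "hcomp (Tot E) (Tot F) (id_nt (Tot F) (Tot F) (id_func (Tot F))) \<alpha> = \<alpha>"
proof (rule nt_eqI[of _ "Tot E"])
  interpret a: fibred_nat B E F \<alpha> by fact
  fix x assume x: "x \<in> Obj (Tot E)"
  show "component (hcomp (Tot E) (Tot F) (id_nt (Tot F) (Tot F) (id_func (Tot F))) \<alpha>) x
    = component \<alpha> x"
    using x a.NCod.fob_obj[OF x] homD(1)[OF a.component_hom[OF x]]
      a.NDom.D.comp_ide_left[OF a.component_hom[OF x]] by simp
qed (use fibred_natD(1-3)[OF assms] in \<open>auto simp: comp_func_id_left[OF fibred_functorD]
  nat_transformation.component_ext\<close>)

lemma hcomp_id_right: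
  assumes a: "fibred_nat B E F \<alpha>"
  shows "hcomp (Tot E) (Tot F) \<alpha> (id_nt (Tot E) (Tot E) (id_func (Tot E))) = \<alpha>"
proof (rule nt_eqI[of _ "Tot E"])
  interpret a: fibred_nat B E F \<alpha> by fact
  fix x assume x: "x \<in> Obj (Tot E)"
  show "component (hcomp (Tot E) (Tot F) \<alpha> (id_nt (Tot E) (Tot E) (id_func (Tot E)))) x
    = component \<alpha> x"
    using x a.NDom.far_ide[OF x] a.NDom.D.comp_ide_right[OF a.component_hom[OF x]] by simp
qed (use fibred_natD(1-3)[OF assms] in \<open>auto simp: comp_func_id_right[OF fibred_functorD]
  nat_transformation.component_ext\<close>)

lemma hcomp_ide:
  assumes "fibred_functor B E F f" and "fibred_functor B F G g"
  shows "hcomp (Tot E) (Tot G) (id_nt (Tot F) (Tot G) g) (id_nt (Tot E) (Tot F) f)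
    = id_nt (Tot E) (Tot G) (comp_func (Tot E) g f)"
proof (rule nt_eqI[of _ "Tot E"])
  interpret f: fibred_functor B E F f by fact
  interpret g: fibred_functor B F G g by fact
  fix x assume x: "x \<in> Obj (Tot E)"
  then show "component (hcomp (Tot E) (Tot G) (id_nt (Tot F) (Tot G) g) (id_nt (Tot E) (Tot F) f)) x
    = component (id_nt (Tot E) (Tot G) (comp_func (Tot E) g f)) x"
    using f.fob_obj g.far_ide g.fob_obj g.D.comp_ide_left[OF g.D.ide_hom] by simp
qed auto

lemma Fib_simps [simp]:
  "E \<in> Cell0 (Fib B) \<longleftrightarrow> cloven_fibration B E" "HomCat (Fib B) = Fib_hom B"
  "Id1 (Fib B) E = id_func (Tot E)" "Comp1 (Fib B) E F G = comp_func (Tot E)"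
  "Comp2 (Fib B) E F G = hcomp (Tot E) (Tot G)"
  by (simp_all add: Fib_def)

lemma two_category_Fib: "two_category (Fib B)"
  by (rule two_category.intro)
    (auto simp: hom_Fib_hom category_Fib_hom fibred_functor_id fibred_functor_comp fibred_nat_hcomp
      hcomp_ide interchange_Fib comp_func_id_left[OF fibred_functorD]
      comp_func_id_right[OF fibred_functorD] hcomp_id_left hcomp_id_right
      comp_func_assoc[OF fibred_functorD] hcomp_assoc)

subsection \<open>Functors between categories of fibred functors\<close>

definition post_functor where
  "post_functor B E F k = \<lparr>
    fob = (\<lambda>g \<in> Obj (Fib_hom B E F). comp_func (Tot E) k g),
    far = (\<lambda>\<gamma> \<in> Arr (Fib_hom B E F). whisker_left (Tot E) k \<gamma>)\<rparr>"

lemma post_functor_simps [simp]: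
  "fibred_functor B E F g \<Longrightarrow> fob (post_functor B E F k) g = comp_func (Tot E) k g"
  "fibred_nat B E F \<gamma> \<Longrightarrow> far (post_functor B E F k) \<gamma> = whisker_left (Tot E) k \<gamma>"
  by (simp_all add: post_functor_def)

lemma cat_functor_post:
  assumes E: "cloven_fibration B E" and F: "cloven_fibration B F" and G: "cloven_fibration B G"
    and k: "fibred_functor B F G k"
  shows "cat_functor (Fib_hom B E F) (Fib_hom B E G) (post_functor B E F k)"
proof -
  interpret k: fibred_functor B F G k by fact
  show ?thesis
  proof (rule cat_functorI)
    fix g assume "g \<in> Obj (Fib_hom B E F)"
    then interpret g: fibred_functor B E F g by simp
    show "far (post_functor B E F k) (Ide (Fib_hom B E F) g)
      = Ide (Fib_hom B E G) (fob (post_functor B E F k) g)"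
      using k.far_ide[OF g.fob_obj]
      by (simp add: fibred_nat_id[OF F] g.fibred_functor_axioms) (rule nt_eqI[of _ "Tot E"], auto)
  next
    fix \<beta> \<gamma> f g h assume "\<beta> \<in> hom (Fib_hom B E F) f g" "\<gamma> \<in> hom (Fib_hom B E F) g h"
    then have *: "fibred_nat B E F \<beta>" "fibred_nat B E F \<gamma>" "NDom \<gamma> = NCod \<beta>"
      by (auto simp: hom_Fib_hom)
    interpret b: fibred_nat B E F \<beta> by fact
    interpret c: fibred_nat B E F \<gamma> by fact
    have "whisker_left (Tot E) k (vcomp (Tot E) (Tot F) \<gamma> \<beta>)
      = vcomp (Tot E) (Tot G) (whisker_left (Tot E) k \<gamma>) (whisker_left (Tot E) k \<beta>)"
      using k.far_comp[OF b.component_hom] c.component_hom *(3)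
      by (intro nt_eqI[of _ "Tot E"]) auto
    then show "far (post_functor B E F k) (\<gamma> \<cdot>\<^bsub>Fib_hom B E F\<^esub> \<beta>)
      = far (post_functor B E F k) \<gamma> \<cdot>\<^bsub>Fib_hom B E G\<^esub> far (post_functor B E F k) \<beta>"
      using * fibred_nat_vcomp[OF F *] by simp
  qed (use k in \<open>auto simp: category_Fib_hom E F G fibred_functor_comp hom_Fib_hom
      fibred_nat_whisker_left fibred_natD post_functor_def\<close>)
qed

definition pre_functor where
  "pre_functor B E F E' k = \<lparr>
    fob = (\<lambda>g \<in> Obj (Fib_hom B E F). comp_func (Tot E') g k),
    far = (\<lambda>\<gamma> \<in> Arr (Fib_hom B E F). whisker_right (Tot E') \<gamma> k)\<rparr>"

lemma pre_functor_simps [simp]: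
  "fibred_functor B E F g \<Longrightarrow> fob (pre_functor B E F E' k) g = comp_func (Tot E') g k"
  "fibred_nat B E F \<gamma> \<Longrightarrow> far (pre_functor B E F E' k) \<gamma> = whisker_right (Tot E') \<gamma> k"
  by (simp_all add: pre_functor_def)

lemma cat_functor_pre:
  assumes E: "cloven_fibration B E" and F: "cloven_fibration B F" and E': "cloven_fibration B E'"
    and k: "fibred_functor B E' E k"
  shows "cat_functor (Fib_hom B E F) (Fib_hom B E' F) (pre_functor B E F E' k)"
proof -
  interpret k: fibred_functor B E' E k by fact
  show ?thesis
  proof (rule cat_functorI)
    fix g assume "g \<in> Obj (Fib_hom B E F)"
    then have g: "fibred_functor B E F g" by simp
    show "far (pre_functor B E F E' k) (Ide (Fib_hom B E F) g)
      = Ide (Fib_hom B E' F) (fob (pre_functor B E F E' k) g)"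
      by (simp add: fibred_nat_id[OF F] g) (rule nt_eqI[of _ "Tot E'"], auto simp: k.fob_obj)
  next
    fix \<beta> \<gamma> f g h assume "\<beta> \<in> hom (Fib_hom B E F) f g" "\<gamma> \<in> hom (Fib_hom B E F) g h"
    then have *: "fibred_nat B E F \<beta>" "fibred_nat B E F \<gamma>" "NDom \<gamma> = NCod \<beta>"
      by (auto simp: hom_Fib_hom)
    have "whisker_right (Tot E') (vcomp (Tot E) (Tot F) \<gamma> \<beta>) k
      = vcomp (Tot E') (Tot F) (whisker_right (Tot E') \<gamma> k) (whisker_right (Tot E') \<beta> k)"
      by (rule nt_eqI[of _ "Tot E'"]) (auto simp: k.fob_obj)
    then show "far (pre_functor B E F E' k) (\<gamma> \<cdot>\<^bsub>Fib_hom B E F\<^esub> \<beta>)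
      = far (pre_functor B E F E' k) \<gamma> \<cdot>\<^bsub>Fib_hom B E' F\<^esub> far (pre_functor B E F E' k) \<beta>"
      using * fibred_nat_vcomp[OF F *] by simp
  qed (use k in \<open>auto simp: category_Fib_hom E F E' fibred_functor_comp hom_Fib_hom
      fibred_nat_whisker_right fibred_natD pre_functor_def\<close>)
qed

text \<open>Verticality of the inverses is automatic: the projection sends an inverse of a vertical arrow
  to an inverse of an identity.\<close>

lemma fibred_nat_inverse:
  assumes "cloven_fibration B F" and "fibred_nat B E F \<tau>"
    and "\<And>x. x \<in> Obj (Tot E) \<Longrightarrow> iso_arrow (Tot F) (component \<tau> x)"
  obtains \<sigma> where "fibred_nat B E F \<sigma>" and "NDom \<sigma> = NCod \<tau>" and "NCod \<sigma> = NDom \<tau>"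
    and "\<And>x. x \<in> Obj (Tot E) \<Longrightarrow> component \<sigma> x \<cdot>\<^bsub>Tot F\<^esub> component \<tau> x = Ide (Tot F) (fob (NDom \<tau>) x)"
    and "\<And>x. x \<in> Obj (Tot E) \<Longrightarrow> component \<tau> x \<cdot>\<^bsub>Tot F\<^esub> component \<sigma> x = Ide (Tot F) (fob (NCod \<tau>) x)"
proof -
  interpret F: cloven_fibration B F by fact
  interpret t: fibred_nat B E F \<tau> by fact
  have "nat_iso (Tot E) (Tot F) \<tau>"
    using assms(3) t.nat_transformation_axioms by (simp add: nat_iso_def)
  from nat_iso_inverse[OF this] obtain \<sigma> where \<sigma>: "nat_iso (Tot E) (Tot F) \<sigma>"
    "NDom \<sigma> = NCod \<tau>" "NCod \<sigma> = NDom \<tau>"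
    "\<And>x. x \<in> Obj (Tot E) \<Longrightarrow> component \<sigma> x = inv_arrow (Tot F) (component \<tau> x)" by blast
  note inv = inv_arrow[OF assms(3) t.component_hom]
  have "fibred_nat B E F \<sigma>"
  proof (rule fibred_natI)
    fix x assume x: "x \<in> Obj (Tot E)"
    let ?i = "inv_arrow (Tot F) (component \<tau> x)"
    have y: "fob (Proj F) (fob (NCod \<tau>) x) = fob (Proj E) x"
      "fob (Proj F) (fob (NDom \<tau>) x) = fob (Proj E) x" "fob (NCod \<tau>) x \<in> Obj (Tot F)"
      using t.NCod.proj_fob[OF x] t.NDom.proj_fob[OF x] t.NCod.fob_obj[OF x] by auto
    have "far (Proj F) ?i = Ide B (fob (Proj E) x) \<cdot>\<^bsub>B\<^esub> far (Proj F) ?i"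
      using F.D.comp_ide_left[OF F.far_hom[OF inv(1)[OF x x]]] y by simp
    also have "\<dots> = far (Proj F) (component \<tau> x \<cdot>\<^bsub>Tot F\<^esub> ?i)"
      using F.far_comp[OF inv(1)[OF x x] t.component_hom[OF x]] t.vertical[OF x] by simp
    also have "\<dots> = Ide B (fob (Proj E) x)"
      using inv(3)[OF x x] F.far_ide y by simp
    finally show "far (Proj F) (component \<sigma> x) = Ide B (fob (Proj E) x)"
      using \<sigma>(4)[OF x] by simp
  qed (use \<sigma> in \<open>auto simp: nat_iso_def t.NDom.fibred_functor_axioms
      t.NCod.fibred_functor_axioms\<close>)
  then show ?thesis using \<sigma>(2-4) inv(2,3) by (intro that) auto
qed

lemma fibred_nat_iso_arrow:
  assumes "cloven_fibration B F" and "fibred_nat B E F \<tau>"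
    and "\<And>x. x \<in> Obj (Tot E) \<Longrightarrow> iso_arrow (Tot F) (component \<tau> x)"
  shows "iso_arrow (Fib_hom B E F) \<tau>"
proof -
  from fibred_nat_inverse[OF assms] obtain \<sigma> where \<sigma>: "fibred_nat B E F \<sigma>"
    "NDom \<sigma> = NCod \<tau>" "NCod \<sigma> = NDom \<tau>"
    "\<And>x. x \<in> Obj (Tot E) \<Longrightarrow> component \<sigma> x \<cdot>\<^bsub>Tot F\<^esub> component \<tau> x = Ide (Tot F) (fob (NDom \<tau>) x)"
    "\<And>x. x \<in> Obj (Tot E) \<Longrightarrow> component \<tau> x \<cdot>\<^bsub>Tot F\<^esub> component \<sigma> x = Ide (Tot F) (fob (NCod \<tau>) x)"
    by blast
  have "vcomp (Tot E) (Tot F) \<sigma> \<tau> = id_nt (Tot E) (Tot F) (NDom \<tau>)"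
    "vcomp (Tot E) (Tot F) \<tau> \<sigma> = id_nt (Tot E) (Tot F) (NCod \<tau>)"
    using \<sigma> by (auto intro!: nt_eqI[of _ "Tot E"])
  then show ?thesis
    using assms(2) \<sigma>(1-3) by (intro iso_arrowI[of _ _ "NDom \<tau>" "NCod \<tau>" \<sigma>]) (auto simp: hom_Fib_hom)
qed

section \<open>Cartesian arrows\<close>

lemma cartesian_arrowI:
  assumes "f \<in> Arr (Tot E)"
    and "\<And>g w x. g \<in> hom (Tot E) x (Cod (Tot E) f) \<Longrightarrow>
        w \<in> hom B (fob (Proj E) x) (fob (Proj E) (Dom (Tot E) f)) \<Longrightarrow>
        far (Proj E) f \<cdot>\<^bsub>B\<^esub> w = far (Proj E) g \<Longrightarrow>
        \<exists>h. h \<in> hom (Tot E) x (Dom (Tot E) f) \<and> far (Proj E) h = w \<and> f \<cdot>\<^bsub>Tot E\<^esub> h = g"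
    and "\<And>h h' x. h \<in> hom (Tot E) x (Dom (Tot E) f) \<Longrightarrow> h' \<in> hom (Tot E) x (Dom (Tot E) f) \<Longrightarrow>
        far (Proj E) h = far (Proj E) h' \<Longrightarrow> f \<cdot>\<^bsub>Tot E\<^esub> h = f \<cdot>\<^bsub>Tot E\<^esub> h' \<Longrightarrow> h = h'"
  shows "cartesian_arrow B E f"
  unfolding cartesian_arrow_def
proof (intro conjI allI impI ex_ex1I)
  fix g w assume "g \<in> Arr (Tot E) \<and> Cod (Tot E) g = Cod (Tot E) f \<and>
        w \<in> hom B (fob (Proj E) (Dom (Tot E) g)) (fob (Proj E) (Dom (Tot E) f)) \<and>
        far (Proj E) f \<cdot>\<^bsub>B\<^esub> w = far (Proj E) g"
  then show "\<exists>h. h \<in> hom (Tot E) (Dom (Tot E) g) (Dom (Tot E) f) \<and>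
      far (Proj E) h = w \<and> f \<cdot>\<^bsub>Tot E\<^esub> h = g"
    by (intro assms(2)) (auto simp: hom_def)
qed (use assms(1,3) in auto)

text \<open>The arrow over \<open>w\<close> through which \<open>g\<close> factors, for a cartesian \<open>f\<close>.\<close>

definition fill :: "('o, 'm, 'bo, 'bm) fibration \<Rightarrow> 'm \<Rightarrow> 'bm \<Rightarrow> 'm \<Rightarrow> 'm" where
  "fill E f w g = (THE h. h \<in> hom (Tot E) (Dom (Tot E) g) (Dom (Tot E) f) \<and>
      far (Proj E) h = w \<and> f \<cdot>\<^bsub>Tot E\<^esub> h = g)"

lemma cartesian_ex1:
  assumes "cartesian_arrow B E f" and "f \<in> hom (Tot E) y z" and "g \<in> hom (Tot E) x z"
    and "w \<in> hom B (fob (Proj E) x) (fob (Proj E) y)"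
    and "far (Proj E) f \<cdot>\<^bsub>B\<^esub> w = far (Proj E) g"
  shows "\<exists>!h. h \<in> hom (Tot E) x y \<and> far (Proj E) h = w \<and> f \<cdot>\<^bsub>Tot E\<^esub> h = g"
proof -
  note f = homD[OF assms(2)] and g = homD[OF assms(3)]
  from assms(1) have "\<forall>g w. g \<in> Arr (Tot E) \<and> Cod (Tot E) g = Cod (Tot E) f \<and>
        w \<in> hom B (fob (Proj E) (Dom (Tot E) g)) (fob (Proj E) (Dom (Tot E) f)) \<and>
        far (Proj E) f \<cdot>\<^bsub>B\<^esub> w = far (Proj E) g
      \<longrightarrow> (\<exists>!h. h \<in> hom (Tot E) (Dom (Tot E) g) (Dom (Tot E) f) \<and>
            far (Proj E) h = w \<and> f \<cdot>\<^bsub>Tot E\<^esub> h = g)"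
    unfolding cartesian_arrow_def by (rule conjunct2)
  from spec[OF spec[OF this, of g], of w] show ?thesis using f g assms(4,5) by simp
qed

lemma fill:
  assumes "cartesian_arrow B E f" and "f \<in> hom (Tot E) y z" and "g \<in> hom (Tot E) x z"
    and "w \<in> hom B (fob (Proj E) x) (fob (Proj E) y)"
    and "far (Proj E) f \<cdot>\<^bsub>B\<^esub> w = far (Proj E) g"
  shows "fill E f w g \<in> hom (Tot E) x y" and "far (Proj E) (fill E f w g) = w"
    and "f \<cdot>\<^bsub>Tot E\<^esub> fill E f w g = g"
  using theI'[OF cartesian_ex1[OF assms]] assms(2,3) by (auto simp: fill_def hom_def)

context cloven_fibration
begin

lemma cartesian_eqI:
  assumes "cartesian_arrow B E f" and "f \<in> hom (Tot E) y z"
    and "h \<in> hom (Tot E) x y" and "h' \<in> hom (Tot E) x y"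
    and "far (Proj E) h = far (Proj E) h'" and "f \<cdot>\<^bsub>Tot E\<^esub> h = f \<cdot>\<^bsub>Tot E\<^esub> h'"
  shows "h = h'"
  using cartesian_ex1[OF assms(1,2) C.comp_hom[OF assms(3,2)] far_hom[OF assms(3)]]
    far_comp[OF assms(3,2)] assms(3-6) by auto

lemma iso_cartesian:
  assumes iso: "iso_arrow (Tot E) f"
  shows "cartesian_arrow B E f"
proof (rule cartesian_arrowI)
  show fA: "f \<in> Arr (Tot E)" using iso by (simp add: iso_arrow_def)
  note fh = in_hom[OF fA]
  note i = inv_arrow[OF iso fh]
  let ?i = "inv_arrow (Tot E) f"
  fix g w x
  assume g: "g \<in> hom (Tot E) x (Cod (Tot E) f)"
    and w: "w \<in> hom B (fob (Proj E) x) (fob (Proj E) (Dom (Tot E) f))"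
    and e: "far (Proj E) f \<cdot>\<^bsub>B\<^esub> w = far (Proj E) g"
  have "far (Proj E) (?i \<cdot>\<^bsub>Tot E\<^esub> g) = (far (Proj E) ?i \<cdot>\<^bsub>B\<^esub> far (Proj E) f) \<cdot>\<^bsub>B\<^esub> w"
    using far_comp[OF g i(1)] D.comp_assoc[OF w far_hom[OF fh] far_hom[OF i(1)]] e by simp
  also have "\<dots> = w"
    using far_comp[OF fh i(1)] i(2) far_ide[OF C.dom_obj[OF fA]] D.comp_ide_left[OF w] by simp
  finally have "far (Proj E) (?i \<cdot>\<^bsub>Tot E\<^esub> g) = w" .
  moreover have "f \<cdot>\<^bsub>Tot E\<^esub> (?i \<cdot>\<^bsub>Tot E\<^esub> g) = g"
    using C.comp_assoc[OF g i(1) fh] i(3) C.comp_ide_left[OF g] by simp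
  ultimately show "\<exists>h. h \<in> hom (Tot E) x (Dom (Tot E) f) \<and>
      far (Proj E) h = w \<and> f \<cdot>\<^bsub>Tot E\<^esub> h = g"
    using C.comp_hom[OF g i(1)] by blast
next
  have fA: "f \<in> Arr (Tot E)" using iso by (simp add: iso_arrow_def)
  note fh = in_hom[OF fA]
  note i = inv_arrow[OF iso fh]
  fix h h' x assume h: "h \<in> hom (Tot E) x (Dom (Tot E) f)" "h' \<in> hom (Tot E) x (Dom (Tot E) f)"
    and e: "f \<cdot>\<^bsub>Tot E\<^esub> h = f \<cdot>\<^bsub>Tot E\<^esub> h'"
  have "inv_arrow (Tot E) f \<cdot>\<^bsub>Tot E\<^esub> (f \<cdot>\<^bsub>Tot E\<^esub> k) = k"
    if "k \<in> hom (Tot E) x (Dom (Tot E) f)" for k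
    using C.comp_assoc[OF that fh i(1)] i(2) C.comp_ide_left[OF that] by simp
  then show "h = h'" using h e by metis
qed

lemma cartesian_comp:
  assumes f: "cartesian_arrow B E f" and g: "cartesian_arrow B E g"
    and fh: "f \<in> hom (Tot E) x y" and gh: "g \<in> hom (Tot E) y z"
  shows "cartesian_arrow B E (g \<cdot>\<^bsub>Tot E\<^esub> f)"
proof (rule cartesian_arrowI)
  let ?p = "far (Proj E)" and ?c = "Comp (Tot E)"
  note gf = C.comp_hom[OF fh gh]
  note gfD = homD[OF gf]
  show "g \<cdot>\<^bsub>Tot E\<^esub> f \<in> Arr (Tot E)" using gfD by simp
  { fix k w v
    assume "k \<in> hom (Tot E) v (Cod (Tot E) (?c g f))"
      and "w \<in> hom B (fob (Proj E) v) (fob (Proj E) (Dom (Tot E) (?c g f)))"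
      and "?p (?c g f) \<cdot>\<^bsub>B\<^esub> w = ?p k"
    then have k: "k \<in> hom (Tot E) v z" and w: "w \<in> hom B (fob (Proj E) v) (fob (Proj E) x)"
      and e: "(?p g \<cdot>\<^bsub>B\<^esub> ?p f) \<cdot>\<^bsub>B\<^esub> w = ?p k"
      using gfD far_comp[OF fh gh] by auto
    have e': "?p g \<cdot>\<^bsub>B\<^esub> (?p f \<cdot>\<^bsub>B\<^esub> w) = ?p k"
      using e D.comp_assoc[OF w far_hom[OF fh] far_hom[OF gh]] by simp
    note F1 = fill[OF g gh k D.comp_hom[OF w far_hom[OF fh]] e']
    note F2 = fill[OF f fh F1(1) w F1(2)[symmetric]]
    show "\<exists>h. h \<in> hom (Tot E) v (Dom (Tot E) (?c g f)) \<and> ?p h = w \<and> ?c (?c g f) h = k"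
      using F2 gfD C.comp_assoc[OF F2(1) fh gh] F1(3) by auto }
  { fix h h' v
    assume "h \<in> hom (Tot E) v (Dom (Tot E) (?c g f))" "h' \<in> hom (Tot E) v (Dom (Tot E) (?c g f))"
      and p: "?p h = ?p h'" and e: "?c (?c g f) h = ?c (?c g f) h'"
    then have h: "h \<in> hom (Tot E) v x" "h' \<in> hom (Tot E) v x" using gfD by auto
    have "?c g (?c f h) = ?c g (?c f h')"
      using e C.comp_assoc[OF h(1) fh gh] C.comp_assoc[OF h(2) fh gh] by simp
    then have "?c f h = ?c f h'"
      using far_comp[OF h(1) fh] far_comp[OF h(2) fh] p
      by (intro cartesian_eqI[OF g gh C.comp_hom[OF h(1) fh] C.comp_hom[OF h(2) fh]]) auto
    then show "h = h'" by (intro cartesian_eqI[OF f fh h p]) }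
qed

lemma cartesian_cancel:
  assumes g: "cartesian_arrow B E g" and gf: "cartesian_arrow B E (g \<cdot>\<^bsub>Tot E\<^esub> f)"
    and fh: "f \<in> hom (Tot E) x y" and gh: "g \<in> hom (Tot E) y z"
  shows "cartesian_arrow B E f"
proof (rule cartesian_arrowI)
  let ?p = "far (Proj E)" and ?c = "Comp (Tot E)"
  note gfh = C.comp_hom[OF fh gh] and fD = homD[OF fh]
  show "f \<in> Arr (Tot E)" using fD by simp
  { fix k w v
    assume "k \<in> hom (Tot E) v (Cod (Tot E) f)"
      and "w \<in> hom B (fob (Proj E) v) (fob (Proj E) (Dom (Tot E) f))"
      and e: "?p f \<cdot>\<^bsub>B\<^esub> w = ?p k"
    then have k: "k \<in> hom (Tot E) v y" and w: "w \<in> hom B (fob (Proj E) v) (fob (Proj E) x)"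
      using fD by auto
    have "?p (?c g f) \<cdot>\<^bsub>B\<^esub> w = ?p (?c g k)"
      using e D.comp_assoc[OF w far_hom[OF fh] far_hom[OF gh]] far_comp[OF k gh] far_comp[OF fh gh]
      by simp
    note F = fill[OF gf gfh C.comp_hom[OF k gh] w this]
    have "?c f (fill E (?c g f) w (?c g k)) = k"
      using F(2,3) C.comp_assoc[OF F(1) fh gh] far_comp[OF F(1) fh] e
      by (intro cartesian_eqI[OF g gh C.comp_hom[OF F(1) fh] k]) auto
    then show "\<exists>h. h \<in> hom (Tot E) v (Dom (Tot E) f) \<and> ?p h = w \<and> ?c f h = k"
      using F fD by auto }
  { fix h h' v
    assume "h \<in> hom (Tot E) v (Dom (Tot E) f)" "h' \<in> hom (Tot E) v (Dom (Tot E) f)"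
      and p: "?p h = ?p h'" and e: "?c f h = ?c f h'"
    then have h: "h \<in> hom (Tot E) v x" "h' \<in> hom (Tot E) v x" using fD by auto
    show "h = h'"
      using C.comp_assoc[OF h(1) fh gh] C.comp_assoc[OF h(2) fh gh] e
      by (intro cartesian_eqI[OF gf gfh h p]) simp }
qed

text \<open>The inverse is the factorisation of the identity over the identity.\<close>

lemma cartesian_vertical_iso:
  assumes f: "cartesian_arrow B E f" and fh: "f \<in> hom (Tot E) x y"
    and v: "far (Proj E) f = Ide B (fob (Proj E) x)"
  shows "iso_arrow (Tot E) f"
proof -
  let ?p = "far (Proj E)" and ?c = "Comp (Tot E)" and ?b = "fob (Proj E) x"
  have x: "x \<in> Obj (Tot E)" and y: "y \<in> Obj (Tot E)"
    using hom_objD[OF C.category_axioms fh] by auto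
  note i = D.ide_hom[OF fob_obj[OF x]]
  have py: "fob (Proj E) y = ?b"
    using homD(3)[OF far_hom[OF fh]] homD(3)[OF i] v by simp
  have 1: "?p f \<cdot>\<^bsub>B\<^esub> Ide B ?b = ?p (Ide (Tot E) y)"
    using v far_ide[OF y] py D.comp_ide_left[OF i] by simp
  have w: "Ide B ?b \<in> hom B (fob (Proj E) y) ?b" using i py by simp
  note F = fill[OF f fh C.ide_hom[OF y] w 1]
  let ?h = "fill E f (Ide B ?b) (Ide (Tot E) y)"
  have "?c ?h f = Ide (Tot E) x"
    using C.comp_assoc[OF fh F(1) fh] F(3) C.comp_ide_left[OF fh] C.comp_ide_right[OF fh]
      far_comp[OF fh F(1)] F(2) v D.comp_ide_left[OF i] far_ide[OF x]
    by (intro cartesian_eqI[OF f fh C.comp_hom[OF fh F(1)] C.ide_hom[OF x]]) auto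
  then show ?thesis using iso_arrowI[OF fh F(1)] F(3) by blast
qed

lemma lift_hom:
  assumes "u \<in> hom B b b'" and "e \<in> Obj (Tot E)" and "fob (Proj E) e = b'"
  shows "cartesian_arrow B E (Lift E u e)"
    and "Lift E u e \<in> hom (Tot E) (Dom (Tot E) (Lift E u e)) e"
    and "far (Proj E) (Lift E u e) = u"
    and "Dom (Tot E) (Lift E u e) \<in> Obj (Tot E)"
    and "fob (Proj E) (Dom (Tot E) (Lift E u e)) = b"
proof -
  have L: "cartesian_arrow B E (Lift E u e)" "Cod (Tot E) (Lift E u e) = e"
      "far (Proj E) (Lift E u e) = u"
    using lift[of u e] assms homD[OF assms(1)] by auto
  then show "cartesian_arrow B E (Lift E u e)" "far (Proj E) (Lift E u e) = u" by auto
  have A: "Lift E u e \<in> Arr (Tot E)" using L(1) by (simp add: cartesian_arrow_def)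
  then show h: "Lift E u e \<in> hom (Tot E) (Dom (Tot E) (Lift E u e)) e" 
    using in_hom[OF A] L(2) by simp
  show "Dom (Tot E) (Lift E u e) \<in> Obj (Tot E)" using A C.dom_obj by simp
  show "fob (Proj E) (Dom (Tot E) (Lift E u e)) = b"
    using homD(2)[OF far_hom[OF h]] L(3) homD(2)[OF assms(1)] by simp
qed

end

section \<open>The oplax sum\<close>

lemma sum_fib_simps [simp]:
  "Tot (sum_fib p E) = Tot E" "Proj (sum_fib p E) = comp_func (Tot E) (Proj p) (Proj E)"
  by (simp_all add: sum_fib_def)

locale sum_fibration = p: cloven_fibration B p + E: cloven_fibration "Tot p" E
  for B :: "('bo, 'bm) cat" and p :: "('ao, 'am, 'bo, 'bm) fibration"
    and E :: "('o, 'm, 'ao, 'am) fibration"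
begin

lemma sum_functor: "cat_functor (Tot E) B (comp_func (Tot E) (Proj p) (Proj E))"
  using cat_functor_comp E.cat_functor_axioms p.cat_functor_axioms by blast

text \<open>A factorisation over \<open>B\<close> is lifted along the projection to \<open>A\<close> first, and then to the total
  category.\<close>

lemma cartesian_sumI:
  assumes f: "cartesian_arrow (Tot p) E f" and a: "cartesian_arrow B p (far (Proj E) f)"
  shows "cartesian_arrow B (sum_fib p E) f"
proof (rule cartesian_arrowI)
  show fA: "f \<in> Arr (Tot (sum_fib p E))" using f by (simp add: cartesian_arrow_def)
  let ?x = "Dom (Tot E) f" and ?y = "Cod (Tot E) f"
  have fh: "f \<in> hom (Tot E) ?x ?y" using fA by (simp add: in_hom)
  have xy: "?x \<in> Obj (Tot E)" "?y \<in> Obj (Tot E)"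
    using hom_objD[OF E.C.category_axioms fh] by auto
  note ah = E.far_hom[OF fh]
  { fix g w v
    assume "g \<in> hom (Tot (sum_fib p E)) v (Cod (Tot (sum_fib p E)) f)"
      and "w \<in> hom B (fob (Proj (sum_fib p E)) v) (fob (Proj (sum_fib p E)) (Dom (Tot (sum_fib p E)) f))"
      and "far (Proj (sum_fib p E)) f \<cdot>\<^bsub>B\<^esub> w = far (Proj (sum_fib p E)) g"
    moreover from this(1) have g: "g \<in> hom (Tot E) v ?y" by simp
    ultimately have w: "w \<in> hom B (fob (Proj p) (fob (Proj E) v)) (fob (Proj p) (fob (Proj E) ?x))"
      and e: "far (Proj p) (far (Proj E) f) \<cdot>\<^bsub>B\<^esub> w = far (Proj p) (far (Proj E) g)"
      using xy hom_objD[OF E.C.category_axioms g] homD(1)[OF g] fA by auto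
    note F = fill[OF a ah E.far_hom[OF g] w e]
    note G = fill[OF f fh g F(1,3)]
    show "\<exists>h. h \<in> hom (Tot (sum_fib p E)) v (Dom (Tot (sum_fib p E)) f) \<and>
        far (Proj (sum_fib p E)) h = w \<and> f \<cdot>\<^bsub>Tot (sum_fib p E)\<^esub> h = g"
      using G F(2) homD(1)[OF G(1)]
      by (intro exI[of _ "fill E f (fill p (far (Proj E) f) w (far (Proj E) g)) g"]) simp }
  { fix h h' v
    assume "h \<in> hom (Tot (sum_fib p E)) v (Dom (Tot (sum_fib p E)) f)"
      and "h' \<in> hom (Tot (sum_fib p E)) v (Dom (Tot (sum_fib p E)) f)"
      and "far (Proj (sum_fib p E)) h = far (Proj (sum_fib p E)) h'"
      and "f \<cdot>\<^bsub>Tot (sum_fib p E)\<^esub> h = f \<cdot>\<^bsub>Tot (sum_fib p E)\<^esub> h'"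
    then have h: "h \<in> hom (Tot E) v ?x" "h' \<in> hom (Tot E) v ?x"
      and e: "far (Proj p) (far (Proj E) h) = far (Proj p) (far (Proj E) h')"
      and eq: "f \<cdot>\<^bsub>Tot E\<^esub> h = f \<cdot>\<^bsub>Tot E\<^esub> h'"
      by (auto simp: homD)
    have "far (Proj E) h = far (Proj E) h'"
      using e eq E.far_comp[OF h(1) fh] E.far_comp[OF h(2) fh]
      by (intro p.cartesian_eqI[OF a ah E.far_hom[OF h(1)] E.far_hom[OF h(2)]]) auto
    then show "h = h'" using E.cartesian_eqI[OF f fh h] eq by blast }
qed

lemma sum_cloven: "cloven_fibration B (sum_fib p E)"
proof -
  interpret S: cat_functor "Tot (sum_fib p E)" B "Proj (sum_fib p E)" using sum_functor by simp
  show ?thesis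
  proof unfold_locales
    fix u e assume u: "u \<in> Arr B" and "e \<in> Obj (Tot (sum_fib p E))"
      and "fob (Proj (sum_fib p E)) e = Cod B u"
    then have e: "e \<in> Obj (Tot E)" and c: "fob (Proj p) (fob (Proj E) e) = Cod B u" by auto
    note L = p.lift_hom[OF in_hom[OF u] E.fob_obj[OF e] c]
    note M = E.lift_hom[OF L(2) e refl]
    show "cartesian_arrow B (sum_fib p E) (Lift (sum_fib p E) u e) \<and>
       Cod (Tot (sum_fib p E)) (Lift (sum_fib p E) u e) = e \<and>
       far (Proj (sum_fib p E)) (Lift (sum_fib p E) u e) = u"
      using cartesian_sumI[OF M(1)] M(3) L(1,3) homD[OF M(2)] by (simp add: sum_fib_def)
  qed
qed

sublocale S: cloven_fibration B "sum_fib p E" by (rule sum_cloven)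

text \<open>A cartesian arrow of the sum differs from the iterated chosen lift, which has both
  properties by construction, by an isomorphism.\<close>

lemma cartesian_sumD:
  assumes f: "cartesian_arrow B (sum_fib p E) f"
  shows "cartesian_arrow (Tot p) E f" and "cartesian_arrow B p (far (Proj E) f)"
proof -
  have fA: "f \<in> Arr (Tot E)" using f by (simp add: cartesian_arrow_def)
  let ?x = "Dom (Tot E) f" and ?y = "Cod (Tot E) f"
  have fh: "f \<in> hom (Tot E) ?x ?y" using fA by (simp add: in_hom)
  have xy: "?x \<in> Obj (Tot E)" "?y \<in> Obj (Tot E)"
    using hom_objD[OF E.C.category_axioms fh] by auto
  note u = p.far_hom[OF E.far_hom[OF fh]]
  note L = p.lift_hom[OF u E.fob_obj[OF xy(2)] refl]
  let ?c = "Lift p (far (Proj p) (far (Proj E) f)) (fob (Proj E) ?y)"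
  note M = E.lift_hom[OF L(2) xy(2) refl]
  let ?l = "Lift E ?c ?y"
  have lS: "cartesian_arrow B (sum_fib p E) ?l" using cartesian_sumI[OF M(1)] M(3) L(1) by simp
  let ?b = "fob (Proj (sum_fib p E)) ?x"
  have b: "?b \<in> Obj B" using S.fob_obj xy(1) by simp
  have bl: "fob (Proj (sum_fib p E)) (Dom (Tot E) ?l) = ?b"
    using M(4,5) L(5) xy by simp
  have w: "Ide B ?b \<in> hom B ?b (fob (Proj (sum_fib p E)) (Dom (Tot E) ?l))"
    using bl p.D.ide_hom[OF b] by simp
  have pl: "far (Proj (sum_fib p E)) ?l = far (Proj (sum_fib p E)) f"
    using M(3) L(3) homD(1)[OF M(2)] fA by simp
  have fS: "f \<in> hom (Tot (sum_fib p E)) ?x ?y" and lh: "?l \<in> hom (Tot (sum_fib p E)) (Dom (Tot E) ?l) ?y"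
    using fh M(2) by auto
  have e: "far (Proj (sum_fib p E)) ?l \<cdot>\<^bsub>B\<^esub> Ide B ?b = far (Proj (sum_fib p E)) f"
    using pl p.D.comp_ide_right[OF S.far_hom[OF fS]] by simp
  let ?h = "fill (sum_fib p E) ?l (Ide B ?b) f"
  note F = fill[OF lS lh fS w e]
  have "cartesian_arrow B (sum_fib p E) ?h"
    using S.cartesian_cancel[OF lS _ F(1) lh] F(3) f by simp
  then have iso: "iso_arrow (Tot E) ?h" using S.cartesian_vertical_iso[OF _ F(1)] F(2) by simp
  have hh: "?h \<in> hom (Tot E) ?x (Dom (Tot E) ?l)" using F(1) by simp
  show "cartesian_arrow (Tot p) E f"
    using E.cartesian_comp[OF E.iso_cartesian[OF iso] M(1) hh M(2)] F(3) by simp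
  have "far (Proj E) f = far (Proj E) ?l \<cdot>\<^bsub>Tot p\<^esub> far (Proj E) ?h"
    using E.far_comp[OF hh M(2)] F(3) by simp
  moreover have "cartesian_arrow B p (far (Proj E) ?l \<cdot>\<^bsub>Tot p\<^esub> far (Proj E) ?h)"
    using p.iso_cartesian[OF E.far_iso[OF iso]] L(1) M(3)
    by (intro p.cartesian_comp[OF _ _ E.far_hom[OF hh] E.far_hom[OF M(2)]]) simp_all
  ultimately show "cartesian_arrow B p (far (Proj E) f)" by simp
qed

end

lemma sum_fibrationI:
  "cloven_fibration B p \<Longrightarrow> cloven_fibration (Tot p) E \<Longrightarrow> sum_fibration B p E"
  by (simp add: sum_fibration_def)

lemma sum_fibred_functor:
  assumes p: "cloven_fibration B p" and E: "cloven_fibration (Tot p) E"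
    and F: "cloven_fibration (Tot p) F" and f: "fibred_functor (Tot p) E F f"
  shows "fibred_functor B (sum_fib p E) (sum_fib p F) f"
proof -
  interpret E: sum_fibration B p E using p E by (rule sum_fibrationI)
  interpret F: sum_fibration B p F using p F by (rule sum_fibrationI)
  interpret f: fibred_functor "Tot p" E F f by fact
  show ?thesis
  proof (rule fibred_functorI)
    fix m assume m: "cartesian_arrow B (sum_fib p E) m"
    then have mA: "m \<in> Arr (Tot E)" by (simp add: cartesian_arrow_def)
    show "cartesian_arrow B (sum_fib p F) (far f m)"
      using F.cartesian_sumI[OF f.preserves_cartesian] E.cartesian_sumD[OF m] f.proj_far[OF mA]
      by simp
  next
    fix m assume m: "m \<in> Arr (Tot (sum_fib p E))"
    then show "far (Proj (sum_fib p F)) (far f m) = far (Proj (sum_fib p E)) m"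
      using f.proj_far homD(1)[OF f.far_hom[OF in_hom]] by simp
  qed (auto simp: f.cat_functor_axioms E.sum_functor F.sum_functor f.fob_obj f.proj_fob)
qed

lemma sum_fibred_nat:
  assumes p: "cloven_fibration B p" and E: "cloven_fibration (Tot p) E"
    and F: "cloven_fibration (Tot p) F" and t: "fibred_nat (Tot p) E F \<tau>"
  shows "fibred_nat B (sum_fib p E) (sum_fib p F) \<tau>"
proof -
  interpret E: sum_fibration B p E using p E by (rule sum_fibrationI)
  interpret t: fibred_nat "Tot p" E F \<tau> by fact
  show ?thesis
  proof (rule fibred_natI)
    fix x assume x: "x \<in> Obj (Tot (sum_fib p E))"
    then show "far (Proj (sum_fib p F)) (component \<tau> x) = Ide B (fob (Proj (sum_fib p E)) x)"
      using t.vertical homD(1)[OF t.component_hom] E.p.far_ide[OF E.E.fob_obj] by simp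
  qed (auto simp: t.nat_transformation_axioms intro: sum_fibred_functor[OF p E F]
      t.NDom.fibred_functor_axioms t.NCod.fibred_functor_axioms)
qed

text \<open>The sum is the identity on 1-cells and 2-cells, so only its values need to be checked.\<close>

lemma sum_functor_on_hom:
  assumes p: "cloven_fibration B p" and E: "cloven_fibration (Tot p) E"
    and F: "cloven_fibration (Tot p) F"
  shows "cat_functor (Fib_hom (Tot p) E F) (Fib_hom B (sum_fib p E) (sum_fib p F))
      (id_func (Fib_hom (Tot p) E F))"
proof (rule cat_functorI)
  fix x assume "x \<in> Obj (Fib_hom (Tot p) E F)"
  then show "far (id_func (Fib_hom (Tot p) E F)) (Ide (Fib_hom (Tot p) E F) x)
    = Ide (Fib_hom B (sum_fib p E) (sum_fib p F)) (fob (id_func (Fib_hom (Tot p) E F)) x)"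
    by (simp add: fibred_nat_id[OF F])
next
  fix f g x y z assume "f \<in> hom (Fib_hom (Tot p) E F) x y" "g \<in> hom (Fib_hom (Tot p) E F) y z"
  then show "far (id_func (Fib_hom (Tot p) E F)) (g \<cdot>\<^bsub>Fib_hom (Tot p) E F\<^esub> f)
    = far (id_func (Fib_hom (Tot p) E F)) g \<cdot>\<^bsub>Fib_hom B (sum_fib p E) (sum_fib p F)\<^esub>
      far (id_func (Fib_hom (Tot p) E F)) f"
    by (simp add: hom_Fib_hom fibred_nat_vcomp[OF F])
qed (use sum_fibred_functor[OF p E F] sum_fibred_nat[OF p E F] E F p in
    \<open>auto simp: category_Fib_hom hom_Fib_hom sum_fibration.sum_cloven[OF sum_fibrationI]
      fibred_natD id_func_def\<close>)

lemma two_functor_oplax_sum: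
  assumes p: "cloven_fibration B p"
  shows "two_functor (Fib (Tot p)) (Fib B) (oplax_sum p)"
  by (intro two_functor.intro two_category_Fib two_functor_axioms.intro)
    (auto simp: oplax_sum_def sum_functor_on_hom[OF p]
      sum_fibration.sum_cloven[OF sum_fibrationI[OF p]]
      fibred_functor_id fibred_functor_comp fibred_nat_hcomp)

section \<open>Representables\<close>

lemma slice_simps [simp]:
  "g \<in> Obj (slice A a) \<longleftrightarrow> g \<in> Arr A \<and> Cod A g = a"
  "(h, g) \<in> Arr (slice A a) \<longleftrightarrow> h \<in> Arr A \<and> g \<in> Arr A \<and> Cod A h = Dom A g \<and> Cod A g = a"
  "Dom (slice A a) (h, g) = g \<cdot>\<^bsub>A\<^esub> h" "Cod (slice A a) (h, g) = g"
  "Ide (slice A a) g = (Ide A (Dom A g), g)"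
  "(h', g') \<cdot>\<^bsub>slice A a\<^esub> (h, g) = (h' \<cdot>\<^bsub>A\<^esub> h, g')"
  by (auto simp: slice_def)

lemma slice_homI:
  assumes "h \<in> hom A c d" and "g \<in> hom A d a"
  shows "(h, g) \<in> hom (slice A a) (g \<cdot>\<^bsub>A\<^esub> h) g"
  using assms by (simp add: hom_def)

lemma slice_arrE:
  assumes "m \<in> Arr (slice A a)"
  obtains h g where "m = (h, g)" and "h \<in> hom A (Dom A h) (Dom A g)" and "g \<in> hom A (Dom A g) a"
  using assms by (cases m) (auto simp: hom_def)

lemma slice_homE:
  assumes "m \<in> hom (slice A a) f g"
  obtains h where "m = (h, g)" and "h \<in> hom A (Dom A h) (Dom A g)" and "g \<in> hom A (Dom A g) a"
    and "f = g \<cdot>\<^bsub>A\<^esub> h"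
  using assms by (cases m) (auto simp: hom_def)

lemma rep_simps [simp]:
  "Tot (rep A a) = slice A a"
  "f \<in> Arr A \<Longrightarrow> Cod A f = a \<Longrightarrow> fob (Proj (rep A a)) f = Dom A f"
  "(h, g) \<in> Arr (slice A a) \<Longrightarrow> far (Proj (rep A a)) (h, g) = h"
  by (auto simp: rep_def simp del: slice_simps(2))

lemma rep_map_simps [simp]:
  "f \<in> Arr A \<Longrightarrow> Cod A f = Dom A b \<Longrightarrow> fob (rep_map A b) f = b \<cdot>\<^bsub>A\<^esub> f"
  "(h, g) \<in> Arr (slice A (Dom A b)) \<Longrightarrow> far (rep_map A b) (h, g) = (h, b \<cdot>\<^bsub>A\<^esub> g)"
  by (auto simp: rep_map_def simp del: slice_simps(2))

context category
begin

lemma category_slice: "category (slice C a)"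
proof
  fix f assume "f \<in> Arr (slice C a)"
  then obtain h g where *: "f = (h, g)" "h \<in> hom C (Dom C h) (Dom C g)" "g \<in> hom C (Dom C g) a"
    by (rule slice_arrE)
  show "Dom (slice C a) f \<in> Obj (slice C a)" "Cod (slice C a) f \<in> Obj (slice C a)"
    using * homD[OF comp_hom[OF *(2,3)]] homD[OF *(3)] by auto
next
  fix x assume "x \<in> Obj (slice C a)"
  then have x: "x \<in> hom C (Dom C x) a" by (simp add: hom_def)
  show "Ide (slice C a) x \<in> hom (slice C a) x x"
    using slice_homI[OF ide_hom[OF dom_obj] x] homD(1)[OF x] comp_ide_right[OF x] by simp
next
  fix f x y g z assume f: "f \<in> hom (slice C a) x y" and g: "g \<in> hom (slice C a) y z"
  obtain h where h: "f = (h, y)" "h \<in> hom C (Dom C h) (Dom C y)" "y \<in> hom C (Dom C y) a"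
    "x = y \<cdot> h" using f by (rule slice_homE)
  obtain k where k: "g = (k, z)" "k \<in> hom C (Dom C k) (Dom C z)" "z \<in> hom C (Dom C z) a"
    "y = z \<cdot> k" using g by (rule slice_homE)
  have dy: "Dom C y = Dom C k" using homD(2)[OF comp_hom[OF k(2,3)]] k(4) by simp
  have h': "h \<in> hom C (Dom C h) (Dom C k)" using h(2) dy by simp
  show "g \<cdot>\<^bsub>slice C a\<^esub> f \<in> hom (slice C a) x z"
    using slice_homI[OF comp_hom[OF h' k(2)] k(3)] comp_assoc[OF h' k(2,3)] h k by simp
next
  fix f x y assume "f \<in> hom (slice C a) x y"
  then obtain h where h: "f = (h, y)" "h \<in> hom C (Dom C h) (Dom C y)" "y \<in> hom C (Dom C y) a"
    "x = y \<cdot> h" by (rule slice_homE)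
  have dx: "Dom C x = Dom C h" using homD(2)[OF comp_hom[OF h(2,3)]] h(4) by simp
  show "f \<cdot>\<^bsub>slice C a\<^esub> Ide (slice C a) x = f" "Ide (slice C a) y \<cdot>\<^bsub>slice C a\<^esub> f = f"
    using h comp_ide_right[OF h(2)] comp_ide_left[OF h(2)] dx by auto
next
  fix f w x g y h z
  assume f: "f \<in> hom (slice C a) w x" and g: "g \<in> hom (slice C a) x y"
    and h: "h \<in> hom (slice C a) y z"
  obtain f' where f': "f = (f', x)" "f' \<in> hom C (Dom C f') (Dom C x)" using f by (rule slice_homE)
  obtain g' where g': "g = (g', y)" "g' \<in> hom C (Dom C g') (Dom C y)" "y \<in> hom C (Dom C y) a"
    "x = y \<cdot> g'" using g by (rule slice_homE)
  obtain h' where h': "h = (h', z)" "h' \<in> hom C (Dom C h') (Dom C z)" "z \<in> hom C (Dom C z) a"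
    "y = z \<cdot> h'" using h by (rule slice_homE)
  have d: "Dom C x = Dom C g'" "Dom C y = Dom C h'"
    using homD(2)[OF comp_hom[OF g'(2,3)]] g'(4) homD(2)[OF comp_hom[OF h'(2,3)]] h'(4) by auto
  show "(h \<cdot>\<^bsub>slice C a\<^esub> g) \<cdot>\<^bsub>slice C a\<^esub> f = h \<cdot>\<^bsub>slice C a\<^esub> (g \<cdot>\<^bsub>slice C a\<^esub> f)"
    using f' g' h' comp_assoc[of f' "Dom C f'" "Dom C g'" g' "Dom C h'" h'] d by simp
qed

lemma rep_proj: "cat_functor (slice C a) C (Proj (rep C a))"
proof (rule cat_functorI)
  show "fob (Proj (rep C a)) \<in> extensional (Obj (slice C a))"
    "far (Proj (rep C a)) \<in> extensional (Arr (slice C a))"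
    by (simp_all add: rep_def)
next
  fix f x y assume f: "f \<in> hom (slice C a) x y"
  obtain h where h: "f = (h, y)" "h \<in> hom C (Dom C h) (Dom C y)" "y \<in> hom C (Dom C y) a"
    "x = y \<cdot> h" using f by (rule slice_homE)
  show "far (Proj (rep C a)) f \<in> hom C (fob (Proj (rep C a)) x) (fob (Proj (rep C a)) y)"
    using h homD[OF comp_hom[OF h(2,3)]] homD[OF h(3)] homD[OF h(2)] by simp
next
  fix f g x y z assume f: "f \<in> hom (slice C a) x y" and g: "g \<in> hom (slice C a) y z"
  obtain h k where h: "f = (h, y)" and k: "g = (k, z)" using f g by (metis slice_homE)
  show "far (Proj (rep C a)) (g \<cdot>\<^bsub>slice C a\<^esub> f) = far (Proj (rep C a)) g \<cdot> far (Proj (rep C a)) f"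
    using homD(1)[OF category.comp_hom[OF category_slice f g]] homD(1)[OF f] homD(1)[OF g]
    by (simp add: h k)
next
  fix x assume "x \<in> Obj (slice C a)"
  then show "far (Proj (rep C a)) (Ide (slice C a) x) = Ide C (fob (Proj (rep C a)) x)"
    using homD[OF ide_hom[OF dom_obj]] by simp
qed (auto simp: category_slice category_axioms dom_obj)

text \<open>An arrow of the slice is determined by its codomain and its underlying arrow, so the
  factorisation over \<open>w\<close> can only be \<open>w\<close> itself, regarded as an arrow of the slice.\<close>

lemma rep_cartesian:
  assumes "m \<in> Arr (slice C a)"
  shows "cartesian_arrow C (rep C a) m"
proof -
  interpret P: cat_functor "slice C a" C "Proj (rep C a)" by (rule rep_proj)
  obtain h g where m: "m = (h, g)" "h \<in> hom C (Dom C h) (Dom C g)" "g \<in> hom C (Dom C g) a"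
    using assms by (rule slice_arrE)
  have gh: "g \<cdot> h \<in> hom C (Dom C h) a" using comp_hom[OF m(2,3)] .
  show ?thesis
  proof (rule cartesian_arrowI)
    fix n w x
    assume n: "n \<in> hom (Tot (rep C a)) x (Cod (Tot (rep C a)) m)"
      and w: "w \<in> hom C (fob (Proj (rep C a)) x) (fob (Proj (rep C a)) (Dom (Tot (rep C a)) m))"
      and e: "far (Proj (rep C a)) m \<cdot> w = far (Proj (rep C a)) n"
    from n have n': "n \<in> hom (slice C a) x g" using m by simp
    obtain k where k: "n = (k, g)" "k \<in> hom C (Dom C k) (Dom C g)" "x = g \<cdot> k"
      using n' by (rule slice_homE)
    have w': "w \<in> hom C (Dom C k) (Dom C h)"
      using w m homD[OF gh] k homD[OF comp_hom[OF k(2) m(3)]] by simp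
    have e': "h \<cdot> w = k" using e m k assms homD(1)[OF n'] by simp
    have *: "(w, g \<cdot> h) \<in> hom (slice C a) x (g \<cdot> h)"
      using slice_homI[OF w' gh] comp_assoc[OF w' m(2,3)] e' k by simp
    moreover have "far (Proj (rep C a)) (w, g \<cdot> h) = w" using homD(1)[OF *] by simp
    ultimately show "\<exists>l. l \<in> hom (Tot (rep C a)) x (Dom (Tot (rep C a)) m) \<and>
        far (Proj (rep C a)) l = w \<and> m \<cdot>\<^bsub>Tot (rep C a)\<^esub> l = n"
      using m k e' by (intro exI[of _ "(w, g \<cdot> h)"]) simp
  next
    fix l l' x assume l: "l \<in> hom (Tot (rep C a)) x (Dom (Tot (rep C a)) m)"
      "l' \<in> hom (Tot (rep C a)) x (Dom (Tot (rep C a)) m)"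
      and e: "far (Proj (rep C a)) l = far (Proj (rep C a)) l'"
    obtain k k' where "l = (k, g \<cdot> h)" "l' = (k', g \<cdot> h)"
      using l m by (auto elim!: slice_homE)
    moreover have "l \<in> Arr (slice C a)" "l' \<in> Arr (slice C a)" using l by (auto simp: homD)
    ultimately show "l = l'" using e by simp
  qed (use assms in simp)
qed

lemma rep_cloven: "cloven_fibration C (rep C a)"
proof -
  interpret P: cat_functor "Tot (rep C a)" C "Proj (rep C a)" using rep_proj by simp
  show ?thesis
    by unfold_locales (auto simp: rep_def[of C a, THEN arg_cong[of _ _ Lift]] rep_cartesian)
qed

lemma rep_map_fibred:
  assumes b: "b \<in> hom C a0 a1"
  shows "fibred_functor C (rep C a0) (rep C a1) (rep_map C b)"
proof -
  note [simp] = homD[OF b]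
  have arr: "far (rep_map C b) (h, g) = (h, b \<cdot> g)" "(h, b \<cdot> g) \<in> Arr (slice C a1)"
    if "(h, g) \<in> Arr (slice C a0)" for h g
  proof -
    have g: "g \<in> hom C (Dom C g) a0" using that by (simp add: hom_def)
    show "far (rep_map C b) (h, g) = (h, b \<cdot> g)" "(h, b \<cdot> g) \<in> Arr (slice C a1)"
      using that homD[OF comp_hom[OF g b]] by auto
  qed
  have ob: "b \<cdot> g \<in> Arr C" "Dom C (b \<cdot> g) = Dom C g" "Cod C (b \<cdot> g) = a1"
    if "g \<in> Arr C" "Cod C g = a0" for g
  proof -
    have "g \<in> hom C (Dom C g) a0" using that by (simp add: hom_def)
    from homD[OF comp_hom[OF this b]]
    show "b \<cdot> g \<in> Arr C" "Dom C (b \<cdot> g) = Dom C g" "Cod C (b \<cdot> g) = a1" by auto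
  qed
  have map: "cat_functor (Tot (rep C a0)) (Tot (rep C a1)) (rep_map C b)"
  proof (rule cat_functorI)
    show "fob (rep_map C b) \<in> extensional (Obj (Tot (rep C a0)))"
      "far (rep_map C b) \<in> extensional (Arr (Tot (rep C a0)))"
      by (simp_all add: rep_map_def del: slice_simps)
  next
    fix m x y assume "m \<in> hom (Tot (rep C a0)) x y"
    then have m: "m \<in> hom (slice C a0) x y" by simp
    obtain h where h: "m = (h, y)" "h \<in> hom C (Dom C h) (Dom C y)" "y \<in> hom C (Dom C y) a0"
      "x = y \<cdot> h" using m by (rule slice_homE)
    have x: "x \<in> Arr C" "Cod C x = a0" using homD[OF comp_hom[OF h(2,3)]] h by auto
    show "far (rep_map C b) m \<in> hom (Tot (rep C a1)) (fob (rep_map C b) x) (fob (rep_map C b) y)"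
      using slice_homI[OF h(2) comp_hom[OF h(3) b]] arr(1)[of h y] homD(1)[OF m] h x homD[OF h(3)]
        comp_assoc[OF h(2,3) b] by simp
  next
    fix m n x y z assume "m \<in> hom (Tot (rep C a0)) x y" "n \<in> hom (Tot (rep C a0)) y z"
    then have m: "m \<in> hom (slice C a0) x y" and n: "n \<in> hom (slice C a0) y z" by auto
    obtain h k where h: "m = (h, y)" and k: "n = (k, z)" using m n by (metis slice_homE)
    show "far (rep_map C b) (n \<cdot>\<^bsub>Tot (rep C a0)\<^esub> m)
      = far (rep_map C b) n \<cdot>\<^bsub>Tot (rep C a1)\<^esub> far (rep_map C b) m"
      using arr homD(1)[OF m] homD(1)[OF n] homD(1)[OF category.comp_hom[OF category_slice m n]]
      by (simp add: h k del: slice_simps(2))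
  next
    fix x assume x: "x \<in> Obj (Tot (rep C a0))"
    show "far (rep_map C b) (Ide (Tot (rep C a0)) x) = Ide (Tot (rep C a1)) (fob (rep_map C b) x)"
      using x arr(1)[of "Ide C (Dom C x)" x] homD[OF ide_hom[OF dom_obj]] ob by simp
  qed (auto simp: category_slice ob)
  show ?thesis
  proof (rule fibred_functorI)
    show "far (Proj (rep C a1)) (far (rep_map C b) m) = far (Proj (rep C a0)) m"
      if "m \<in> Arr (Tot (rep C a0))" for m
      using that arr by (cases m) (auto simp del: slice_simps)
    show "cartesian_arrow C (rep C a1) (far (rep_map C b) m)" if "cartesian_arrow C (rep C a0) m" for m
      using that arr by (cases m) (auto simp: cartesian_arrow_def[of C "rep C a0"] rep_cartesian
          simp del: slice_simps)
  qed (use map ob in \<open>auto simp: rep_proj\<close>)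
qed

lemma rep_map_ide:
  assumes "a \<in> Obj C"
  shows "rep_map C (Ide C a) = id_func (slice C a)"
proof (rule funct_eqI)
  note i = homD[OF ide_hom[OF assms]]
  show "cat_functor (slice C a) (slice C a) (rep_map C (Ide C a))"
    using fibred_functorD[OF rep_map_fibred[OF ide_hom[OF assms]]] by simp
  show "cat_functor (slice C a) (slice C a) (id_func (slice C a))"
    by (rule cat_functor_id[OF category_slice])
  have id: "Ide C a \<cdot> g = g" if "g \<in> Arr C" "Cod C g = a" for g
    using comp_ide_left[of g "Dom C g" a] that by (simp add: hom_def)
  fix g assume "g \<in> Obj (slice C a)"
  then show "fob (rep_map C (Ide C a)) g = fob (id_func (slice C a)) g" using i id by simp
next
  note i = homD[OF ide_hom[OF assms]]
  have id: "Ide C a \<cdot> g = g" if "g \<in> Arr C" "Cod C g = a" for g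
    using comp_ide_left[of g "Dom C g" a] that by (simp add: hom_def)
  fix m assume "m \<in> Arr (slice C a)"
  then show "far (rep_map C (Ide C a)) m = far (id_func (slice C a)) m"
    using i id by (cases m) auto
qed

lemma rep_map_comp:
  assumes b: "b \<in> hom C a0 a1" and c: "c \<in> hom C a1 a2"
  shows "rep_map C (c \<cdot> b) = comp_func (slice C a0) (rep_map C c) (rep_map C b)"
proof (rule funct_eqI)
  note cb = comp_hom[OF b c]
  show "cat_functor (slice C a0) (slice C a2) (rep_map C (c \<cdot> b))"
    using fibred_functorD[OF rep_map_fibred[OF cb]] by simp
  show "cat_functor (slice C a0) (slice C a2) (comp_func (slice C a0) (rep_map C c) (rep_map C b))"
    using cat_functor_comp fibred_functorD[OF rep_map_fibred[OF b]]
      fibred_functorD[OF rep_map_fibred[OF c]] by fastforce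
  have fs: "(c \<cdot> b) \<cdot> g = c \<cdot> (b \<cdot> g)" "b \<cdot> g \<in> Arr C" "Cod C (b \<cdot> g) = a1"
    "Dom C (b \<cdot> g) = Dom C g"
    if "g \<in> Arr C" "Cod C g = a0" for g
  proof -
    have g: "g \<in> hom C (Dom C g) a0" using that by (simp add: hom_def)
    show "(c \<cdot> b) \<cdot> g = c \<cdot> (b \<cdot> g)" using comp_assoc[OF g b c] .
    show "b \<cdot> g \<in> Arr C" "Cod C (b \<cdot> g) = a1" "Dom C (b \<cdot> g) = Dom C g"
      using homD[OF comp_hom[OF g b]] by auto
  qed
  show "fob (rep_map C (c \<cdot> b)) g = fob (comp_func (slice C a0) (rep_map C c) (rep_map C b)) g"
    if "g \<in> Obj (slice C a0)" for g
    using that homD[OF b] homD[OF c] homD[OF cb] fs by simp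
  fix m assume m: "m \<in> Arr (slice C a0)"
  then show "far (rep_map C (c \<cdot> b)) m = far (comp_func (slice C a0) (rep_map C c) (rep_map C b)) m"
    using homD[OF b] homD[OF c] homD[OF cb] fs by (cases m) simp
qed

end

section \<open>The oplax base change\<close>

lemma slice_id_obj:
  assumes "category A" and "a \<in> Obj A"
  shows "Ide A a \<in> Obj (slice A a)" and "Ide A a \<in> hom A a a"
  using category.ide_hom[OF assms] by (auto simp: hom_def)

locale base_change = p: cloven_fibration B p
  for B :: "('bo, 'bm) cat" and p :: "('ao, 'am, 'bo, 'bm) fibration"
begin

abbreviation A where "A \<equiv> Tot p"
abbreviation Y where "Y a \<equiv> sum_fib p (rep (Tot p) a)"

lemma rep_map_Y: "b \<in> hom A a0 a1 \<Longrightarrow> fibred_functor B (Y a0) (Y a1) (rep_map A b)"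
  by (intro sum_fibred_functor p.cloven_fibration_axioms p.C.rep_cloven p.C.rep_map_fibred)

lemma precomp_rep_map:
  assumes "b \<in> hom A a0 a1" and "fibred_functor B (Y a1) F e"
  shows "fibred_functor B (Y a0) F (comp_func (slice A a0) e (rep_map A b))"
  using fibred_functor_comp[OF rep_map_Y[OF assms(1)] assms(2)] by simp

lemma whisker_rep_map:
  assumes "b \<in> hom A a0 a1" and "fibred_nat B (Y a1) F t"
  shows "fibred_nat B (Y a0) F (whisker_right (slice A a0) t (rep_map A b))"
  using fibred_nat_whisker_right[OF rep_map_Y[OF assms(1)] assms(2)] by simp

lemma precomp_ide:
  assumes "a \<in> Obj A" and "fibred_functor B (Y a) F e"
  shows "comp_func (slice A a) e (rep_map A (Ide A a)) = e"
  using p.C.rep_map_ide[OF assms(1)] comp_func_id_right[OF fibred_functorD[OF assms(2)]] by simp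

lemma precomp_comp:
  assumes "b \<in> hom A a0 a1" and "c \<in> hom A a1 a2"
  shows "comp_func (slice A a0) (comp_func (slice A a1) e (rep_map A c)) (rep_map A b)
    = comp_func (slice A a0) e (rep_map A (c \<cdot>\<^bsub>A\<^esub> b))"
  using p.C.rep_map_comp[OF assms]
    comp_func_assoc[of "slice A a0" "slice A a1" "rep_map A b"] fibred_functorD[OF rep_map_Y[OF assms(1)]]
  by simp

lemma slice_objD: "f \<in> Obj (slice A a) \<Longrightarrow> f \<in> hom A (Dom A f) a"
  by (simp add: hom_def)

lemma slice_obj_comp:
  assumes "b \<in> hom A a0 a1" and "f \<in> Obj (slice A a0)"
  shows "b \<cdot>\<^bsub>A\<^esub> f \<in> Obj (slice A a1)"
  using homD[OF p.C.comp_hom[OF slice_objD[OF assms(2)] assms(1)]] by simp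

lemma rep_map_fob:
  assumes "b \<in> hom A a0 a1" and "f \<in> Obj (slice A a0)"
  shows "fob (rep_map A b) f = b \<cdot>\<^bsub>A\<^esub> f"
  using assms homD[OF assms(1)] by simp

subsection \<open>The category of the base change\<close>

text \<open>This is the Grothendieck construction of the functor that sends \<open>a\<close> to the category of fibred
  functors out of the sum of the representable at \<open>a\<close>, and an arrow of \<open>A\<close> to restriction along it.\<close>

lemma bc_obj [simp]:
  "(a, e) \<in> Obj (bc_cat B p F) \<longleftrightarrow> a \<in> Obj A \<and> fibred_functor B (Y a) F e"
  by (simp add: bc_cat_def)

lemma bc_hom:
  "m \<in> hom (bc_cat B p F) (a0, e0) (a1, e1) \<longleftrightarrow> (\<exists>b t. m = (b, t, e1) \<and> b \<in> hom A a0 a1 \<and>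
    fibred_functor B (Y a1) F e1 \<and> fibred_nat B (Y a0) F t \<and> NDom t = e0 \<and>
    NCod t = comp_func (slice A a0) e1 (rep_map A b))"
  by (cases m) (auto simp: bc_cat_def hom_def)

lemma bc_homI:
  assumes "b \<in> hom A a0 a1" and "fibred_functor B (Y a1) F e1" and "fibred_nat B (Y a0) F t"
    and "NDom t = e0" and "NCod t = comp_func (slice A a0) e1 (rep_map A b)"
  shows "(b, t, e1) \<in> hom (bc_cat B p F) (a0, e0) (a1, e1)"
  using assms by (simp add: bc_hom)

lemma bc_homD:
  assumes "(b, t, e) \<in> hom (bc_cat B p F) (a0, e0) (a1, e1)"
  shows "e = e1" and "b \<in> hom A a0 a1" and "fibred_functor B (Y a1) F e1"
    and "fibred_nat B (Y a0) F t" and "NDom t = e0"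
    and "NCod t = comp_func (slice A a0) e1 (rep_map A b)" and "fibred_functor B (Y a0) F e0"
  using assms by (auto simp: bc_hom dest: fibred_natD(2))

lemma bc_homE:
  assumes "m \<in> hom (bc_cat B p F) x y"
  obtains b t a0 e0 a1 e1 where "x = (a0, e0)" and "y = (a1, e1)" and "m = (b, t, e1)"
    and "(b, t, e1) \<in> hom (bc_cat B p F) (a0, e0) (a1, e1)"
proof -
  obtain a0 e0 a1 e1 where xy: "x = (a0, e0)" "y = (a1, e1)" by (cases x; cases y)
  with assms that show thesis by (auto simp: bc_hom)
qed

lemma bc_homE':
  assumes "m \<in> hom (bc_cat B p F) (a0, e0) y"
  obtains b t a1 e1 where "y = (a1, e1)" and "m = (b, t, e1)"
    and "(b, t, e1) \<in> hom (bc_cat B p F) (a0, e0) (a1, e1)"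
  using assms that by (cases y) (auto simp: bc_hom)

lemma bc_sel [simp]:
  "Dom (bc_cat B p F) (b, t, e) = (Dom A b, NDom t)"
  "Cod (bc_cat B p F) (b, t, e) = (Cod A b, e)"
  "Ide (bc_cat B p F) (a, e) = (Ide A a, id_nt (slice A a) (Tot F) e, e)"
  "(c, s, e2) \<cdot>\<^bsub>bc_cat B p F\<^esub> (b, t, e) = (c \<cdot>\<^bsub>A\<^esub> b,
    vcomp (slice A (Dom A b)) (Tot F) (whisker_right (slice A (Dom A b)) s (rep_map A b)) t, e2)"
  by (simp_all add: bc_cat_def)

lemma bc_component_hom:
  assumes "(b, t, e) \<in> hom (bc_cat B p F) (a0, e0) (a1, e1)" and f: "f \<in> Obj (slice A a0)"
  shows "component t f \<in> hom (Tot F) (fob e0 f) (fob e1 (b \<cdot>\<^bsub>A\<^esub> f))"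
proof -
  note D = bc_homD[OF assms(1)]
  interpret t: fibred_nat B "Y a0" F t by (rule D(4))
  show ?thesis using t.component_hom[of f] f D(5,6) rep_map_fob[OF D(2) f] by simp
qed

lemma bc_comp_component:
  assumes "b \<in> hom A a0 a1" and "f \<in> Obj (slice A a0)"
  shows "component (vcomp (slice A a0) (Tot F) (whisker_right (slice A a0) s (rep_map A b)) t) f
    = component s (b \<cdot>\<^bsub>A\<^esub> f) \<cdot>\<^bsub>Tot F\<^esub> component t f"
  using assms(2) rep_map_fob[OF assms] by simp

lemma bc_arr_eqI:
  assumes "(b, t, e) \<in> hom (bc_cat B p F) (a0, e0) (a1, e1)"
    and "(b', t', e') \<in> hom (bc_cat B p F) (a0, e0) (a1, e1)" and "b = b'"
    and "\<And>f. f \<in> Obj (slice A a0) \<Longrightarrow> component t f = component t' f"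
  shows "(b, t, e) = (b', t', e')"
proof -
  note D = bc_homD[OF assms(1)] and D' = bc_homD[OF assms(2)]
  have "t = t'" using D D' assms(3,4) by (intro fibred_nat_eqI[of B "Y a0" F _ "Y a0" F]) auto
  then show ?thesis using D(1) D'(1) assms(3) by simp
qed

lemma bc_comp_hom:
  assumes F: "cloven_fibration B F"
    and m: "(b, t, e1) \<in> hom (bc_cat B p F) (a0, e0) (a1, e1)"
    and n: "(c, s, e2) \<in> hom (bc_cat B p F) (a1, e1) (a2, e2)"
  shows "(c, s, e2) \<cdot>\<^bsub>bc_cat B p F\<^esub> (b, t, e1) \<in> hom (bc_cat B p F) (a0, e0) (a2, e2)"
proof -
  note D = bc_homD[OF m] and D' = bc_homD[OF n]
  have "fibred_nat B (Y a0) F (vcomp (Tot (Y a0)) (Tot F) (whisker_right (slice A a0) s (rep_map A b)) t)"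
    using D D' by (intro fibred_nat_vcomp[OF F] whisker_rep_map) auto
  then show ?thesis
    using homD[OF D(2)] p.C.comp_hom[OF D(2) D'(2)] D D' precomp_comp[OF D(2) D'(2)]
    by (auto intro!: bc_homI)
qed

lemma bc_ide_hom:
  assumes "cloven_fibration B F" and "a \<in> Obj A" and "fibred_functor B (Y a) F e"
  shows "Ide (bc_cat B p F) (a, e) \<in> hom (bc_cat B p F) (a, e) (a, e)"
  using assms p.C.ide_hom[OF assms(2)] fibred_nat_id[OF assms(1,3)] precomp_ide[OF assms(2,3)]
  by (auto intro!: bc_homI)

lemma category_bc:
  assumes F: "cloven_fibration B F"
  shows "category (bc_cat B p F)"
proof
  interpret F: cloven_fibration B F by fact
  let ?K = "bc_cat B p F"
  { fix m assume "m \<in> Arr ?K"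
    then have "m \<in> hom ?K (Dom ?K m) (Cod ?K m)" by (rule in_hom)
    then obtain b t a0 e0 a1 e1 where *: "Dom ?K m = (a0, e0)" "Cod ?K m = (a1, e1)" "m = (b, t, e1)"
        "(b, t, e1) \<in> hom ?K (a0, e0) (a1, e1)" by (rule bc_homE)
    then show "Dom ?K m \<in> Obj ?K" "Cod ?K m \<in> Obj ?K"
      using bc_homD[OF *(4)] hom_objD[OF p.C.category_axioms bc_homD(2)[OF *(4)]] by auto }
  show "Ide ?K x \<in> hom ?K x x" if "x \<in> Obj ?K" for x
    using that bc_ide_hom[OF F] by (cases x) simp
  { fix m n x y z assume m: "m \<in> hom ?K x y" and n: "n \<in> hom ?K y z"
    obtain b t a0 e0 a1 e1 where m': "x = (a0, e0)" "y = (a1, e1)" "m = (b, t, e1)"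
      "(b, t, e1) \<in> hom ?K (a0, e0) (a1, e1)" using m by (rule bc_homE)
    obtain c s a2 e2 where n': "z = (a2, e2)" "n = (c, s, e2)"
      "(c, s, e2) \<in> hom ?K (a1, e1) (a2, e2)" using n[unfolded m'(2)] by (rule bc_homE')
    show "n \<cdot>\<^bsub>?K\<^esub> m \<in> hom ?K x z" using bc_comp_hom[OF F m'(4) n'(3)] m' n' by simp }
  note comp = this
  { fix m x y assume m: "m \<in> hom ?K x y"
    obtain b t a0 e0 a1 e1 where m': "x = (a0, e0)" "y = (a1, e1)" "m = (b, t, e1)"
      "(b, t, e1) \<in> hom ?K (a0, e0) (a1, e1)" using m by (rule bc_homE)
    note D = bc_homD[OF m'(4)]
    have a: "a0 \<in> Obj A" "a1 \<in> Obj A" using hom_objD[OF p.C.category_axioms D(2)] by auto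
    note ids = bc_ide_hom[OF F a(1) D(7)] bc_ide_hom[OF F a(2) D(3)]
    have "(b, t, e1) \<cdot>\<^bsub>?K\<^esub> Ide ?K (a0, e0) = (b, t, e1)"
      unfolding bc_sel
    proof (rule bc_arr_eqI[where F = F])
      show "(b \<cdot>\<^bsub>A\<^esub> Ide A a0, vcomp (slice A (Dom A (Ide A a0))) (Tot F)
          (whisker_right (slice A (Dom A (Ide A a0))) t (rep_map A (Ide A a0)))
          (id_nt (slice A a0) (Tot F) e0), e1) \<in> hom ?K (a0, e0) (a1, e1)"
        using bc_comp_hom[OF F ids(1)[unfolded bc_sel] m'(4)] by simp
      show "b \<cdot>\<^bsub>A\<^esub> Ide A a0 = b" using p.C.comp_ide_right[OF D(2)] .
      fix f assume f: "f \<in> Obj (slice A a0)"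
      have "Ide A a0 \<cdot>\<^bsub>A\<^esub> f = f" using p.C.comp_ide_left[OF slice_objD[OF f]] .
      then show "component (vcomp (slice A (Dom A (Ide A a0))) (Tot F)
          (whisker_right (slice A (Dom A (Ide A a0))) t (rep_map A (Ide A a0)))
          (id_nt (slice A a0) (Tot F) e0)) f = component t f"
        unfolding homD(2)[OF p.C.ide_hom[OF a(1)]] bc_comp_component[OF p.C.ide_hom[OF a(1)] f]
        using F.C.comp_ide_right[OF bc_component_hom[OF m'(4) f]] f by simp
    qed (rule m'(4))
    then show "m \<cdot>\<^bsub>?K\<^esub> Ide ?K x = m" using m' by simp
    have "Ide ?K (a1, e1) \<cdot>\<^bsub>?K\<^esub> (b, t, e1) = (b, t, e1)"
      unfolding bc_sel
    proof (rule bc_arr_eqI[where F = F])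
      show "(Ide A a1 \<cdot>\<^bsub>A\<^esub> b, vcomp (slice A (Dom A b)) (Tot F)
          (whisker_right (slice A (Dom A b)) (id_nt (slice A a1) (Tot F) e1) (rep_map A b)) t, e1)
          \<in> hom ?K (a0, e0) (a1, e1)"
        using bc_comp_hom[OF F m'(4) ids(2)[unfolded bc_sel]] by simp
      show "Ide A a1 \<cdot>\<^bsub>A\<^esub> b = b" using p.C.comp_ide_left[OF D(2)] .
      fix f assume f: "f \<in> Obj (slice A a0)"
      show "component (vcomp (slice A (Dom A b)) (Tot F)
          (whisker_right (slice A (Dom A b)) (id_nt (slice A a1) (Tot F) e1) (rep_map A b)) t) f
        = component t f"
        unfolding homD(2)[OF D(2)] bc_comp_component[OF D(2) f]
        using F.C.comp_ide_left[OF bc_component_hom[OF m'(4) f]] slice_obj_comp[OF D(2) f] by simp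
    qed (rule m'(4))
    then show "Ide ?K y \<cdot>\<^bsub>?K\<^esub> m = m" using m' by simp }
  { fix m n l w x y z assume m: "m \<in> hom ?K w x" and n: "n \<in> hom ?K x y" and l: "l \<in> hom ?K y z"
    obtain b t a0 e0 a1 e1 where m': "w = (a0, e0)" "x = (a1, e1)" "m = (b, t, e1)"
      "(b, t, e1) \<in> hom ?K (a0, e0) (a1, e1)" using m by (rule bc_homE)
    obtain c s a2 e2 where n': "y = (a2, e2)" "n = (c, s, e2)"
      "(c, s, e2) \<in> hom ?K (a1, e1) (a2, e2)" using n[unfolded m'(2)] by (rule bc_homE')
    obtain d r a3 e3 where l': "z = (a3, e3)" "l = (d, r, e3)"
      "(d, r, e3) \<in> hom ?K (a2, e2) (a3, e3)" using l[unfolded n'(1)] by (rule bc_homE')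
    note bD = bc_homD[OF m'(4)] and cD = bc_homD[OF n'(3)] and dD = bc_homD[OF l'(3)]
    have b: "b \<in> hom A a0 a1" and c: "c \<in> hom A a1 a2" and d: "d \<in> hom A a2 a3"
      using bD cD dD by auto
    note cb = p.C.comp_hom[OF b c]
    have 2: "(component r (c \<cdot>\<^bsub>A\<^esub> (b \<cdot>\<^bsub>A\<^esub> f)) \<cdot>\<^bsub>Tot F\<^esub> component s (b \<cdot>\<^bsub>A\<^esub> f)) \<cdot>\<^bsub>Tot F\<^esub> component t f
      = component r ((c \<cdot>\<^bsub>A\<^esub> b) \<cdot>\<^bsub>A\<^esub> f) \<cdot>\<^bsub>Tot F\<^esub> (component s (b \<cdot>\<^bsub>A\<^esub> f) \<cdot>\<^bsub>Tot F\<^esub> component t f)"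
      if f: "f \<in> Obj (slice A a0)" for f
    proof -
      note bf = slice_obj_comp[OF b f]
      note cbf = slice_obj_comp[OF c bf]
      show ?thesis
        using F.C.comp_assoc[OF bc_component_hom[OF m'(4) f] bc_component_hom[OF n'(3) bf]
          bc_component_hom[OF l'(3) cbf]] p.C.comp_assoc[OF slice_objD[OF f] b c] by simp
    qed
    have 3: "(d \<cdot>\<^bsub>A\<^esub> c) \<cdot>\<^bsub>A\<^esub> b = d \<cdot>\<^bsub>A\<^esub> (c \<cdot>\<^bsub>A\<^esub> b)" using p.C.comp_assoc[OF b c d] .
    have "((d, r, e3) \<cdot>\<^bsub>?K\<^esub> (c, s, e2)) \<cdot>\<^bsub>?K\<^esub> (b, t, e1)
        = (d, r, e3) \<cdot>\<^bsub>?K\<^esub> ((c, s, e2) \<cdot>\<^bsub>?K\<^esub> (b, t, e1))"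
      unfolding bc_sel homD(2)[OF b] homD(2)[OF c] homD(2)[OF cb]
    proof (rule bc_arr_eqI[where F = F])
      note hm = comp[OF m'(4) n'(3)] and hn = comp[OF n'(3) l'(3)]
      show "((d \<cdot>\<^bsub>A\<^esub> c) \<cdot>\<^bsub>A\<^esub> b, vcomp (slice A a0) (Tot F)
          (whisker_right (slice A a0) (vcomp (slice A a1) (Tot F)
            (whisker_right (slice A a1) r (rep_map A c)) s) (rep_map A b)) t, e3)
          \<in> hom ?K (a0, e0) (a3, e3)"
        using comp[OF m'(4) hn] by (simp add: homD(2)[OF b] homD(2)[OF c])
      show "(d \<cdot>\<^bsub>A\<^esub> (c \<cdot>\<^bsub>A\<^esub> b), vcomp (slice A a0) (Tot F)
          (whisker_right (slice A a0) r (rep_map A (c \<cdot>\<^bsub>A\<^esub> b)))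
          (vcomp (slice A a0) (Tot F) (whisker_right (slice A a0) s (rep_map A b)) t), e3)
          \<in> hom ?K (a0, e0) (a3, e3)"
        using comp[OF hm l'(3)] by (simp add: homD(2)[OF b] homD(2)[OF cb])
      fix f assume f: "f \<in> Obj (slice A a0)"
      note bf = slice_obj_comp[OF b f]
      show "component (vcomp (slice A a0) (Tot F)
          (whisker_right (slice A a0) (vcomp (slice A a1) (Tot F)
            (whisker_right (slice A a1) r (rep_map A c)) s) (rep_map A b)) t) f
        = component (vcomp (slice A a0) (Tot F)
          (whisker_right (slice A a0) r (rep_map A (c \<cdot>\<^bsub>A\<^esub> b)))
          (vcomp (slice A a0) (Tot F) (whisker_right (slice A a0) s (rep_map A b)) t)) f"
        unfolding bc_comp_component[OF b f] bc_comp_component[OF cb f] bc_comp_component[OF c bf]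
        by (rule 2[OF f])
    qed (rule 3)
    then show "(l \<cdot>\<^bsub>?K\<^esub> n) \<cdot>\<^bsub>?K\<^esub> m = l \<cdot>\<^bsub>?K\<^esub> (n \<cdot>\<^bsub>?K\<^esub> m)" using m' n' l' by simp }
qed

lemma bc_fib_simps [simp]:
  "Tot (bc_fib B p F) = bc_cat B p F"
  "x \<in> Obj (bc_cat B p F) \<Longrightarrow> fob (Proj (bc_fib B p F)) x = fst x"
  "m \<in> Arr (bc_cat B p F) \<Longrightarrow> far (Proj (bc_fib B p F)) m = fst m"
  by (auto simp: bc_fib_def split_beta)

lemma bc_proj:
  assumes F: "cloven_fibration B F"
  shows "cat_functor (bc_cat B p F) A (Proj (bc_fib B p F))"
proof (rule cat_functorI)
  note K = category_bc[OF F]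
  show "fob (Proj (bc_fib B p F)) \<in> extensional (Obj (bc_cat B p F))"
    "far (Proj (bc_fib B p F)) \<in> extensional (Arr (bc_cat B p F))"
    by (simp_all add: bc_fib_def)
  show "fob (Proj (bc_fib B p F)) x \<in> Obj A" if "x \<in> Obj (bc_cat B p F)" for x
    using that by (cases x) simp
  show "far (Proj (bc_fib B p F)) m \<in> hom A (fob (Proj (bc_fib B p F)) x) (fob (Proj (bc_fib B p F)) y)"
    if "m \<in> hom (bc_cat B p F) x y" for m x y
    using that hom_objD[OF K that] homD[OF that] by (cases x; cases y) (auto simp: bc_hom)
  show "far (Proj (bc_fib B p F)) (Ide (bc_cat B p F) x) = Ide A (fob (Proj (bc_fib B p F)) x)"
    if "x \<in> Obj (bc_cat B p F)" for x
    using that homD(1)[OF category.ide_hom[OF K that]] by (cases x) simp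
  show "far (Proj (bc_fib B p F)) (n \<cdot>\<^bsub>bc_cat B p F\<^esub> m)
      = far (Proj (bc_fib B p F)) n \<cdot>\<^bsub>A\<^esub> far (Proj (bc_fib B p F)) m"
    if "m \<in> hom (bc_cat B p F) x y" "n \<in> hom (bc_cat B p F) y z" for m n x y z
    using homD(1)[OF that(1)] homD(1)[OF that(2)] homD(1)[OF category.comp_hom[OF K that]]
    by (cases m; cases n) simp
qed (auto simp: category_bc[OF F] p.C.category_axioms)

text \<open>If the 2-cell of an arrow is invertible, then factorisations through this arrow are obtained,
  and are unique, by composing with the restriction of the inverse along \<open>w\<close>.\<close>

lemma bc_cartesianI:
  assumes F: "cloven_fibration B F"
    and m: "(b, t, e1) \<in> hom (bc_cat B p F) (a0, e0) (a1, e1)"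
    and iso: "\<And>f. f \<in> Obj (slice A a0) \<Longrightarrow> iso_arrow (Tot F) (component t f)"
  shows "cartesian_arrow A (bc_fib B p F) (b, t, e1)"
proof (rule cartesian_arrowI)
  interpret F: cloven_fibration B F by fact
  interpret K: category "bc_cat B p F" by (rule category_bc[OF F])
  interpret P: cat_functor "bc_cat B p F" A "Proj (bc_fib B p F)" by (rule bc_proj[OF F])
  let ?K = "bc_cat B p F"
  note D = bc_homD[OF m] and mD = homD[OF m]
  show "(b, t, e1) \<in> Arr (Tot (bc_fib B p F))" using mD by simp
  have "iso_arrow (Tot F) (component t f)" if "f \<in> Obj (Tot (Y a0))" for f using iso that by simp
  from fibred_nat_inverse[OF F D(4) this] obtain s where s: "fibred_nat B (Y a0) F s"
    "NDom s = NCod t" "NCod s = NDom t"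
    "\<And>f. f \<in> Obj (slice A a0) \<Longrightarrow> component s f \<cdot>\<^bsub>Tot F\<^esub> component t f = Ide (Tot F) (fob (NDom t) f)"
    "\<And>f. f \<in> Obj (slice A a0) \<Longrightarrow> component t f \<cdot>\<^bsub>Tot F\<^esub> component s f = Ide (Tot F) (fob (NCod t) f)"
    by auto
  have sh: "component s f \<in> hom (Tot F) (fob e1 (b \<cdot>\<^bsub>A\<^esub> f)) (fob e0 f)"
    if f: "f \<in> Obj (slice A a0)" for f
  proof -
    interpret s: fibred_nat B "Y a0" F s by (rule s)
    show ?thesis using s.component_hom[of f] f s(2,3) D(5,6) rep_map_fob[OF D(2) f] by simp
  qed
  { fix n w x
    assume n: "n \<in> hom (Tot (bc_fib B p F)) x (Cod (Tot (bc_fib B p F)) (b, t, e1))"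
      and w: "w \<in> hom A (fob (Proj (bc_fib B p F)) x)
        (fob (Proj (bc_fib B p F)) (Dom (Tot (bc_fib B p F)) (b, t, e1)))"
      and e: "far (Proj (bc_fib B p F)) (b, t, e1) \<cdot>\<^bsub>A\<^esub> w = far (Proj (bc_fib B p F)) n"
    obtain a e' where x: "x = (a, e')" by (cases x)
    have n': "n \<in> hom ?K (a, e') (a1, e1)" using n x mD by simp
    then obtain c r where n: "n = (c, r, e1)" "(c, r, e1) \<in> hom ?K (a, e') (a1, e1)"
      by (auto simp: bc_hom)
    have w: "w \<in> hom A a a0"
      using w x mD hom_objD[OF K.category_axioms n'] hom_objD[OF K.category_axioms m] by simp
    have bw: "b \<cdot>\<^bsub>A\<^esub> w = c" using e n n' mD homD(1)[OF n'] by simp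
    note E = bc_homD[OF n(2)]
    let ?k = "vcomp (slice A a) (Tot F) (whisker_right (slice A a) s (rep_map A w)) r"
    have k: "(w, ?k, e0) \<in> hom ?K (a, e') (a0, e0)"
    proof (rule bc_homI[OF w D(7)])
      have "fibred_nat B (Y a) F (vcomp (Tot (Y a)) (Tot F) (whisker_right (slice A a) s (rep_map A w)) r)"
        using precomp_comp[OF w D(2)] bw E(4,6) s D(6)
        by (intro fibred_nat_vcomp[OF F] whisker_rep_map[OF w]) auto
      then show "fibred_nat B (Y a) F ?k" by simp
    qed (use E s D in simp_all)
    have "(b, t, e1) \<cdot>\<^bsub>?K\<^esub> (w, ?k, e0) = (c, r, e1)"
      unfolding bc_sel homD(2)[OF w]
    proof (rule bc_arr_eqI[OF _ n(2) bw])
      show "(b \<cdot>\<^bsub>A\<^esub> w, vcomp (slice A a) (Tot F) (whisker_right (slice A a) t (rep_map A w)) ?k, e1)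
        \<in> hom ?K (a, e') (a1, e1)"
        using K.comp_hom[OF k m] by (simp add: homD(2)[OF w])
      fix f assume f: "f \<in> Obj (slice A a)"
      note wf = slice_obj_comp[OF w f]
      have "b \<cdot>\<^bsub>A\<^esub> (w \<cdot>\<^bsub>A\<^esub> f) = c \<cdot>\<^bsub>A\<^esub> f" using p.C.comp_assoc[OF slice_objD[OF f] w D(2)] bw by simp
      with bc_component_hom[OF n(2) f]
      have r: "component r f \<in> hom (Tot F) (fob e' f) (fob e1 (b \<cdot>\<^bsub>A\<^esub> (w \<cdot>\<^bsub>A\<^esub> f)))" by simp
      show "component (vcomp (slice A a) (Tot F) (whisker_right (slice A a) t (rep_map A w)) ?k) f
        = component r f"
        unfolding bc_comp_component[OF w f]
        using F.C.comp_assoc[OF r sh[OF wf] bc_component_hom[OF m wf]] s(5)[OF wf] D(6)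
          F.C.comp_ide_left[OF r] rep_map_fob[OF D(2) wf] wf by simp
    qed
    then show "\<exists>h. h \<in> hom (Tot (bc_fib B p F)) x (Dom (Tot (bc_fib B p F)) (b, t, e1)) \<and>
        far (Proj (bc_fib B p F)) h = w \<and> (b, t, e1) \<cdot>\<^bsub>Tot (bc_fib B p F)\<^esub> h = n"
      using k n x mD homD(1)[OF k] by (intro exI[of _ "(w, ?k, e0)"]) simp }
  { fix h h' x
    assume "h \<in> hom (Tot (bc_fib B p F)) x (Dom (Tot (bc_fib B p F)) (b, t, e1))"
      and "h' \<in> hom (Tot (bc_fib B p F)) x (Dom (Tot (bc_fib B p F)) (b, t, e1))"
      and e: "far (Proj (bc_fib B p F)) h = far (Proj (bc_fib B p F)) h'"
      and eq: "(b, t, e1) \<cdot>\<^bsub>Tot (bc_fib B p F)\<^esub> h = (b, t, e1) \<cdot>\<^bsub>Tot (bc_fib B p F)\<^esub> h'"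
    moreover obtain a e' where x: "x = (a, e')" by (cases x)
    ultimately have hh: "h \<in> hom ?K (a, e') (a0, e0)" "h' \<in> hom ?K (a, e') (a0, e0)"
      using mD by auto
    then obtain w k w' k' where h: "h = (w, k, e0)" "h' = (w', k', e0)" by (auto simp: bc_hom)
    note kh = hh(1)[unfolded h] and kh' = hh(2)[unfolded h]
    have ww: "w = w'" using e h homD(1)[OF hh(1)] homD(1)[OF hh(2)] by simp
    note w = bc_homD(2)[OF kh] and w' = bc_homD(2)[OF kh']
    have "component k f = component k' f" if f: "f \<in> Obj (slice A a)" for f
    proof -
      note wf = slice_obj_comp[OF w f]
      note c = bc_component_hom[OF kh f] and c' = bc_component_hom[OF kh' f, folded ww]
      have "vcomp (slice A a) (Tot F) (whisker_right (slice A a) t (rep_map A w)) k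
        = vcomp (slice A a) (Tot F) (whisker_right (slice A a) t (rep_map A w)) k'"
        using eq homD(2)[OF w] homD(2)[OF w'] by (simp add: h ww)
      from arg_cong[OF this, of "\<lambda>s. component s f"]
      have "component t (w \<cdot>\<^bsub>A\<^esub> f) \<cdot>\<^bsub>Tot F\<^esub> component k f = component t (w \<cdot>\<^bsub>A\<^esub> f) \<cdot>\<^bsub>Tot F\<^esub> component k' f"
        unfolding bc_comp_component[OF w f] .
      then show ?thesis
        using F.C.comp_assoc[OF c bc_component_hom[OF m wf] sh[OF wf]]
          F.C.comp_assoc[OF c' bc_component_hom[OF m wf] sh[OF wf]] s(4)[OF wf] D(5)
          F.C.comp_ide_left[OF c] F.C.comp_ide_left[OF c'] by simp
    qed
    then show "h = h'" unfolding h using ww by (intro bc_arr_eqI[OF kh kh']) auto }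
qed

lemma bc_lift:
  assumes F: "cloven_fibration B F" and b: "b \<in> hom A a0 a1" and e: "fibred_functor B (Y a1) F e1"
  shows "Lift (bc_fib B p F) b (a1, e1) \<in> hom (bc_cat B p F)
      (a0, comp_func (slice A a0) e1 (rep_map A b)) (a1, e1)"
    and "cartesian_arrow A (bc_fib B p F) (Lift (bc_fib B p F) b (a1, e1))"
    and "Lift (bc_fib B p F) b (a1, e1)
      = (b, id_nt (slice A a0) (Tot F) (comp_func (slice A a0) e1 (rep_map A b)), e1)"
proof -
  interpret F: cloven_fibration B F by fact
  let ?e = "comp_func (slice A a0) e1 (rep_map A b)"
  note e0 = precomp_rep_map[OF b e]
  interpret e0: fibred_functor B "Y a0" F ?e by (rule e0)
  show eq: "Lift (bc_fib B p F) b (a1, e1) = (b, id_nt (slice A a0) (Tot F) ?e, e1)"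
    using homD[OF b] by (simp add: bc_fib_def)
  show h: "Lift (bc_fib B p F) b (a1, e1) \<in> hom (bc_cat B p F) (a0, ?e) (a1, e1)"
    unfolding eq using fibred_nat_id[OF F e0] by (intro bc_homI[OF b e]) auto
  show "cartesian_arrow A (bc_fib B p F) (Lift (bc_fib B p F) b (a1, e1))"
    unfolding eq
  proof (rule bc_cartesianI[OF F h[unfolded eq]])
    show "iso_arrow (Tot F) (component (id_nt (slice A a0) (Tot F) ?e) f)"
      if "f \<in> Obj (slice A a0)" for f
      using that F.C.iso_ide e0.fob_obj[of f] by simp
  qed
qed

lemma bc_cloven:
  assumes F: "cloven_fibration B F"
  shows "cloven_fibration A (bc_fib B p F)"
proof -
  interpret P: cat_functor "Tot (bc_fib B p F)" A "Proj (bc_fib B p F)"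
    using bc_proj[OF F] by simp
  show ?thesis
  proof unfold_locales
    fix b x assume b: "b \<in> Arr A" and x: "x \<in> Obj (Tot (bc_fib B p F))"
      and e: "fob (Proj (bc_fib B p F)) x = Cod A b"
    from x e obtain e where x': "x = (Cod A b, e)" "fibred_functor B (Y (Cod A b)) F e"
      by (cases x) auto
    note L = bc_lift[OF F in_hom[OF b] x'(2)]
    show "cartesian_arrow A (bc_fib B p F) (Lift (bc_fib B p F) b x) \<and>
        Cod (Tot (bc_fib B p F)) (Lift (bc_fib B p F) b x) = x \<and>
        far (Proj (bc_fib B p F)) (Lift (bc_fib B p F) b x) = b"
      using L(2) homD[OF L(1)] x' by (simp add: L(3))
  qed
qed

text \<open>The 2-cell is itself a vertical arrow, into the domain of the chosen lift, and the given arrow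
  is its composite with this lift.  Hence it is cartesian and vertical, and so invertible.\<close>

lemma bc_cartesianD:
  assumes F: "cloven_fibration B F"
    and m: "(b, t, e1) \<in> hom (bc_cat B p F) (a0, e0) (a1, e1)"
    and cart: "cartesian_arrow A (bc_fib B p F) (b, t, e1)" and f: "f \<in> Obj (slice A a0)"
  shows "iso_arrow (Tot F) (component t f)"
proof -
  interpret F: cloven_fibration B F by fact
  interpret K: cloven_fibration A "bc_fib B p F" by (rule bc_cloven[OF F])
  let ?K = "bc_cat B p F" and ?e = "comp_func (slice A a0) e1 (rep_map A b)"
  note D = bc_homD[OF m]
  have a0: "a0 \<in> Obj A" using hom_objD[OF p.C.category_axioms D(2)] by simp
  note i = p.C.ide_hom[OF a0]
  have if': "Ide A a0 \<cdot>\<^bsub>A\<^esub> f = f" using p.C.comp_ide_left[OF slice_objD[OF f]] .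
  note L = bc_lift[OF F D(2) D(3)]
  have th: "(Ide A a0, t, ?e) \<in> hom ?K (a0, e0) (a0, ?e)"
    using D precomp_ide[OF a0 precomp_rep_map[OF D(2,3)]]
    by (intro bc_homI[OF i precomp_rep_map[OF D(2,3)]]) auto
  have comp: "Lift (bc_fib B p F) b (a1, e1) \<cdot>\<^bsub>?K\<^esub> (Ide A a0, t, ?e) = (b, t, e1)"
    unfolding L(3) bc_sel homD(2)[OF i]
  proof (rule bc_arr_eqI[OF _ m])
    show "(b \<cdot>\<^bsub>A\<^esub> Ide A a0, vcomp (slice A a0) (Tot F) (whisker_right (slice A a0)
        (id_nt (slice A a0) (Tot F) ?e) (rep_map A (Ide A a0))) t, e1) \<in> hom ?K (a0, e0) (a1, e1)"
      using K.C.comp_hom[of "(Ide A a0, t, ?e)" _ _ "Lift (bc_fib B p F) b (a1, e1)"] th L(1)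
      by (simp add: L(3) homD(2)[OF i])
    show "b \<cdot>\<^bsub>A\<^esub> Ide A a0 = b" using p.C.comp_ide_right[OF D(2)] .
    fix g assume g: "g \<in> Obj (slice A a0)"
    have ig: "Ide A a0 \<cdot>\<^bsub>A\<^esub> g = g" using p.C.comp_ide_left[OF slice_objD[OF g]] .
    show "component (vcomp (slice A a0) (Tot F) (whisker_right (slice A a0)
        (id_nt (slice A a0) (Tot F) ?e) (rep_map A (Ide A a0))) t) g = component t g"
      unfolding bc_comp_component[OF i g] ig
      using F.C.comp_ide_left[OF bc_component_hom[OF m g]] g rep_map_fob[OF D(2) g] by simp
  qed
  have cart': "cartesian_arrow A (bc_fib B p F) (Ide A a0, t, ?e)"
    using K.cartesian_cancel[OF L(2), of "(Ide A a0, t, ?e)"] comp cart th L(1) by simp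
  have th': "(Ide A a0, t, ?e) \<in> hom (Tot (bc_fib B p F)) (a0, e0) (a0, ?e)" using th by simp
  have "iso_arrow ?K (Ide A a0, t, ?e)"
    using K.cartesian_vertical_iso[OF cart' th'] homD(1)[OF th] a0 D by simp
  note I = inv_arrow[OF this th]
  obtain c s where cs: "inv_arrow ?K (Ide A a0, t, ?e) = (c, s, e0)"
    using I(1) by (auto simp: bc_hom)
  note sh = I(1)[unfolded cs]
  have c: "c = Ide A a0"
    using arg_cong[OF I(3)[unfolded cs], of fst] p.C.comp_ide_left[OF bc_homD(2)[OF sh]] by simp
  note sh = sh[unfolded c]
  have "component t f \<cdot>\<^bsub>Tot F\<^esub> component s f = Ide (Tot F) (fob ?e f)"
    using arg_cong[OF I(3)[unfolded cs], of "\<lambda>m. component (fst (snd m)) f"]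
    by (simp add: c homD(2)[OF i] bc_comp_component[OF i f] if' id_nt_simps(3)[OF f]
        del: vcomp_simps(3) slice_simps(1))
  moreover have "component s f \<cdot>\<^bsub>Tot F\<^esub> component t f = Ide (Tot F) (fob e0 f)"
    using arg_cong[OF I(2)[unfolded cs], of "\<lambda>m. component (fst (snd m)) f"]
    by (simp add: c homD(2)[OF i] bc_comp_component[OF i f] if' id_nt_simps(3)[OF f]
        del: vcomp_simps(3) slice_simps(1))
  ultimately show ?thesis
    using bc_component_hom[OF th f] bc_component_hom[OF sh f] unfolding if' by (intro iso_arrowI)
qed

subsection \<open>The base change as a 2-functor\<close>

lemma whisker_right_ide:
  assumes "a \<in> Obj A" and "fibred_nat B (Y a) F t"
  shows "whisker_right (slice A a) t (rep_map A (Ide A a)) = t"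
proof -
  interpret t: fibred_nat B "Y a" F t by fact
  show ?thesis
    using precomp_ide[OF assms(1) t.NDom.fibred_functor_axioms]
      precomp_ide[OF assms(1) t.NCod.fibred_functor_axioms] p.C.rep_map_ide[OF assms(1)]
      t.component_ext
    by (intro nt_eqI[of _ "slice A a"]) (auto simp del: slice_simps(1))
qed

lemma bc_vertical_comp:
  assumes "a \<in> Obj A" and "fibred_nat B (Y a) F s"
  shows "(Ide A a, s, e2) \<cdot>\<^bsub>bc_cat B p F\<^esub> (Ide A a, t, e1)
    = (Ide A a, vcomp (slice A a) (Tot F) s t, e2)"
  using whisker_right_ide[OF assms] homD[OF p.C.ide_hom[OF assms(1)]]
    p.C.comp_ide_left[OF p.C.ide_hom[OF assms(1)]] by simp

lemma bc_vertical_hom: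
  assumes "a \<in> Obj A" and "fibred_nat B (Y a) F t"
  shows "(Ide A a, t, NCod t) \<in> hom (bc_cat B p F) (a, NDom t) (a, NCod t)"
  using assms p.C.ide_hom[OF assms(1)] fibred_natD(3)[OF assms(2)]
    precomp_ide[OF assms(1) fibred_natD(3)[OF assms(2)]]
  by (intro bc_homI) auto

lemma bc_map1_simps [simp]:
  "(a, e) \<in> Obj (bc_cat B p E) \<Longrightarrow> fob (bc_map1 B p E f) (a, e) = (a, comp_func (slice A a) f e)"
  "(b, t, e) \<in> Arr (bc_cat B p E) \<Longrightarrow> far (bc_map1 B p E f) (b, t, e)
    = (b, whisker_left (slice A (Dom A b)) f t, comp_func (slice A (Cod A b)) f e)"
  by (simp_all add: bc_map1_def del: bc_obj)

lemma bc_map1_hom: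
  assumes f: "fibred_functor B E F f" and m: "(b, t, e1) \<in> hom (bc_cat B p E) (a0, e0) (a1, e1)"
  shows "far (bc_map1 B p E f) (b, t, e1)
      = (b, whisker_left (slice A a0) f t, comp_func (slice A a1) f e1)"
    and "(b, whisker_left (slice A a0) f t, comp_func (slice A a1) f e1)
      \<in> hom (bc_cat B p F) (a0, comp_func (slice A a0) f e0) (a1, comp_func (slice A a1) f e1)"
proof -
  note D = bc_homD[OF m]
  show "far (bc_map1 B p E f) (b, t, e1)
      = (b, whisker_left (slice A a0) f t, comp_func (slice A a1) f e1)"
    using homD(1)[OF m] homD[OF D(2)] by simp
  have "fibred_nat B (Y a0) F (whisker_left (slice A a0) f t)"
    using fibred_nat_whisker_left[OF D(4) f] by simp
  moreover have "fibred_functor B (Y a1) F (comp_func (slice A a1) f e1)"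
    using fibred_functor_comp[OF D(3) f] by simp
  ultimately show "(b, whisker_left (slice A a0) f t, comp_func (slice A a1) f e1)
      \<in> hom (bc_cat B p F) (a0, comp_func (slice A a0) f e0) (a1, comp_func (slice A a1) f e1)"
    using D fibred_functorD[OF rep_map_Y[OF D(2)]]
      comp_func_assoc[of "slice A a0" "slice A a1" "rep_map A b" f e1]
    by (intro bc_homI) auto
qed

lemma bc_map1_functor:
  assumes E: "cloven_fibration B E" and F: "cloven_fibration B F" and f: "fibred_functor B E F f"
  shows "cat_functor (bc_cat B p E) (bc_cat B p F) (bc_map1 B p E f)"
proof (rule cat_functorI)
  interpret f: fibred_functor B E F f by fact
  note KE = category_bc[OF E] and KF = category_bc[OF F]
  interpret KE: category "bc_cat B p E" by (rule KE)
  show "category (bc_cat B p E)" "category (bc_cat B p F)" by (rule KE, rule KF)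
  show "fob (bc_map1 B p E f) \<in> extensional (Obj (bc_cat B p E))"
    "far (bc_map1 B p E f) \<in> extensional (Arr (bc_cat B p E))"
    by (simp_all add: bc_map1_def)
  show "fob (bc_map1 B p E f) x \<in> Obj (bc_cat B p F)" if "x \<in> Obj (bc_cat B p E)" for x
    using that fibred_functor_comp[OF _ f, of "Y (fst x)" "snd x"] by (cases x) simp
  { fix m x y assume m: "m \<in> hom (bc_cat B p E) x y"
    obtain b t a0 e0 a1 e1 where *: "x = (a0, e0)" "y = (a1, e1)" "m = (b, t, e1)"
      "(b, t, e1) \<in> hom (bc_cat B p E) (a0, e0) (a1, e1)" using m by (rule bc_homE)
    have "x \<in> Obj (bc_cat B p E)" "y \<in> Obj (bc_cat B p E)" using hom_objD[OF KE m] by auto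
    then show "far (bc_map1 B p E f) m
      \<in> hom (bc_cat B p F) (fob (bc_map1 B p E f) x) (fob (bc_map1 B p E f) y)"
      using bc_map1_hom[OF f *(4)] *(1-3) by simp }
  { fix x assume x: "x \<in> Obj (bc_cat B p E)"
    obtain a e where xe: "x = (a, e)" by (cases x)
    with x have ae: "a \<in> Obj A" "fibred_functor B (Y a) E e" by auto
    interpret e: fibred_functor B "Y a" E e by (rule ae)
    have "whisker_left (slice A a) f (id_nt (slice A a) (Tot E) e)
      = id_nt (slice A a) (Tot F) (comp_func (slice A a) f e)"
      using f.far_ide[OF e.fob_obj]
      by (intro nt_eqI[of _ "slice A a"]) (auto simp del: slice_simps(1) simp: rep_simps(1))
    then show "far (bc_map1 B p E f) (Ide (bc_cat B p E) x)
      = Ide (bc_cat B p F) (fob (bc_map1 B p E f) x)"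
      using bc_map1_hom(1)[OF f bc_ide_hom[OF E ae, unfolded bc_sel]] x xe by simp }
  { fix m n x y z assume m: "m \<in> hom (bc_cat B p E) x y" and n: "n \<in> hom (bc_cat B p E) y z"
    obtain b t a0 e0 a1 e1 where m': "x = (a0, e0)" "y = (a1, e1)" "m = (b, t, e1)"
      "(b, t, e1) \<in> hom (bc_cat B p E) (a0, e0) (a1, e1)" using m by (rule bc_homE)
    obtain c s a2 e2 where n': "z = (a2, e2)" "n = (c, s, e2)"
      "(c, s, e2) \<in> hom (bc_cat B p E) (a1, e1) (a2, e2)" using n[unfolded m'(2)] by (rule bc_homE')
    note b = bc_homD(2)[OF m'(4)] and nm = KE.comp_hom[OF m'(4) n'(3)]
    have "whisker_left (slice A a0) f
        (vcomp (slice A a0) (Tot E) (whisker_right (slice A a0) s (rep_map A b)) t)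
      = vcomp (slice A a0) (Tot F) (whisker_right (slice A a0) (whisker_left (slice A a1) f s)
          (rep_map A b)) (whisker_left (slice A a0) f t)"
      (is "?l = ?r")
    proof (rule nt_eqI[of _ "slice A a0"])
      interpret r: cat_functor "slice A a0" "slice A a1" "rep_map A b"
        using fibred_functorD[OF rep_map_Y[OF b]] by simp
      show "NCod ?l = NCod ?r" by (simp add: comp_func_assoc[OF r.cat_functor_axioms])
      fix g assume g: "g \<in> Obj (slice A a0)"
      show "component ?l g = component ?r g"
        using f.far_comp[OF bc_component_hom[OF m'(4) g]
            bc_component_hom[OF n'(3) slice_obj_comp[OF b g]]] g r.fob_obj[OF g] rep_map_fob[OF b g]
        by (simp del: slice_simps(1))
    qed auto
    then show "far (bc_map1 B p E f) (n \<cdot>\<^bsub>bc_cat B p E\<^esub> m)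
      = far (bc_map1 B p E f) n \<cdot>\<^bsub>bc_cat B p F\<^esub> far (bc_map1 B p E f) m"
      using bc_map1_hom(1)[OF f m'(4)] bc_map1_hom(1)[OF f n'(3)]
        bc_map1_hom(1)[OF f nm[unfolded bc_sel homD(2)[OF b]]] homD(2)[OF b] m'(3) n'(2) by simp }
qed

lemma bc_map1_fibred:
  assumes E: "cloven_fibration B E" and F: "cloven_fibration B F" and f: "fibred_functor B E F f"
  shows "fibred_functor A (bc_fib B p E) (bc_fib B p F) (bc_map1 B p E f)"
proof (rule fibred_functorI)
  interpret f: fibred_functor B E F f by fact
  interpret K: cat_functor "bc_cat B p E" "bc_cat B p F" "bc_map1 B p E f"
    by (rule bc_map1_functor[OF assms])
  show "cat_functor (Tot (bc_fib B p E)) (Tot (bc_fib B p F)) (bc_map1 B p E f)"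
    using K.cat_functor_axioms by simp
  show "fob (Proj (bc_fib B p F)) (fob (bc_map1 B p E f) x) = fob (Proj (bc_fib B p E)) x"
    if "x \<in> Obj (Tot (bc_fib B p E))" for x
    using that K.fob_obj[of x] by (cases x) simp
  show "far (Proj (bc_fib B p F)) (far (bc_map1 B p E f) m) = far (Proj (bc_fib B p E)) m"
    if "m \<in> Arr (Tot (bc_fib B p E))" for m
    using that homD(1)[OF K.far_hom[OF in_hom[of m]]] by (cases m) simp
  show "cartesian_arrow A (bc_fib B p F) (far (bc_map1 B p E f) m)"
    if "cartesian_arrow A (bc_fib B p E) m" for m
  proof -
    let ?K = "bc_cat B p E"
    have "m \<in> hom ?K (Dom ?K m) (Cod ?K m)"
      using that by (simp add: cartesian_arrow_def in_hom)
    then obtain b t a0 e0 a1 e1 where m: "m = (b, t, e1)"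
      "(b, t, e1) \<in> hom ?K (a0, e0) (a1, e1)" by (rule bc_homE)
    note h = bc_map1_hom[OF f m(2)]
    have "iso_arrow (Tot F) (component (whisker_left (slice A a0) f t) g)"
      if g: "g \<in> Obj (slice A a0)" for g
      using f.far_iso[OF bc_cartesianD[OF E m(2) _ g]] m \<open>cartesian_arrow A (bc_fib B p E) m\<close> g
      by simp
    then show ?thesis unfolding m h(1) by (rule bc_cartesianI[OF F h(2)])
  qed
qed (use bc_proj[OF E] bc_proj[OF F] in auto)

lemma bc_map2_simps [simp]:
  "NDom (bc_map2 B p E \<phi>) = bc_map1 B p E (NDom \<phi>)" "NCod (bc_map2 B p E \<phi>) = bc_map1 B p E (NCod \<phi>)"
  "(a, e) \<in> Obj (bc_cat B p E) \<Longrightarrow> component (bc_map2 B p E \<phi>) (a, e)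
    = (Ide A a, whisker_right (slice A a) \<phi> e, comp_func (slice A a) (NCod \<phi>) e)"
  "component (bc_map2 B p E \<phi>) \<in> extensional (Obj (bc_cat B p E))"
  by (simp_all add: bc_map2_def del: bc_obj)

lemma whisker_Y:
  assumes "fibred_functor B (Y a) E e" and "fibred_nat B E F \<phi>"
  shows "fibred_nat B (Y a) F (whisker_right (slice A a) \<phi> e)"
  using fibred_nat_whisker_right[OF assms] by simp

lemma bc_map2_fibred:
  assumes E: "cloven_fibration B E" and F: "cloven_fibration B F" and \<phi>: "fibred_nat B E F \<phi>"
  shows "fibred_nat A (bc_fib B p E) (bc_fib B p F) (bc_map2 B p E \<phi>)"
proof (rule fibred_natI)
  interpret \<phi>: fibred_nat B E F \<phi> by fact
  note f0 = \<phi>.NDom.fibred_functor_axioms and f1 = \<phi>.NCod.fibred_functor_axioms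
  interpret KE: category "bc_cat B p E" by (rule category_bc[OF E])
  interpret KF: category "bc_cat B p F" by (rule category_bc[OF F])
  show "fibred_functor A (bc_fib B p E) (bc_fib B p F) (NDom (bc_map2 B p E \<phi>))"
    "fibred_functor A (bc_fib B p E) (bc_fib B p F) (NCod (bc_map2 B p E \<phi>))"
    using bc_map1_fibred[OF E F f0] bc_map1_fibred[OF E F f1] by auto
  have hom: "component (bc_map2 B p E \<phi>) x \<in> hom (bc_cat B p F)
      (fob (NDom (bc_map2 B p E \<phi>)) x) (fob (NCod (bc_map2 B p E \<phi>)) x)"
    if x: "x \<in> Obj (bc_cat B p E)" for x
  proof (cases x)
    case (Pair a e)
    with x have "a \<in> Obj A" "fibred_functor B (Y a) E e" by auto
    with x Pair show ?thesis using bc_vertical_hom[OF _ whisker_Y[OF _ \<phi>]] by simp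
  qed
  show "nat_transformation (Tot (bc_fib B p E)) (Tot (bc_fib B p F)) (bc_map2 B p E \<phi>)"
  proof (rule nat_transformationI)
    fix m x y assume m: "m \<in> hom (Tot (bc_fib B p E)) x y"
    then have mK: "m \<in> hom (bc_cat B p E) x y" by simp
    obtain b t a0 e0 a1 e1 where m': "x = (a0, e0)" "y = (a1, e1)" "m = (b, t, e1)"
      "(b, t, e1) \<in> hom (bc_cat B p E) (a0, e0) (a1, e1)" using mK by (rule bc_homE)
    note D = bc_homD[OF m'(4)]
    have o: "(a0, e0) \<in> Obj (bc_cat B p E)" "(a1, e1) \<in> Obj (bc_cat B p E)"
      using hom_objD[OF KE.category_axioms m'(4)] by auto
    then have a0: "a0 \<in> Obj A" by simp
    note i = p.C.ide_hom[OF a0]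
    note h0 = bc_map1_hom[OF f0 m'(4)] and h1 = bc_map1_hom[OF f1 m'(4)]
    note c0 = hom[OF o(1), unfolded bc_map2_simps(1,2) bc_map2_simps(3)[OF o(1)]
        bc_map1_simps(1)[OF o(1)]]
    note c1 = hom[OF o(2), unfolded bc_map2_simps(1,2) bc_map2_simps(3)[OF o(2)]
        bc_map1_simps(1)[OF o(2)]]
    note l = KF.comp_hom[OF h0(2) c1, unfolded bc_sel homD(2)[OF D(2)]]
    note r = KF.comp_hom[OF c0 h1(2), unfolded bc_sel homD(2)[OF i]]
    interpret e0: fibred_functor B "Y a0" E e0 using o(1) by simp
    interpret e1: fibred_functor B "Y a1" E e1 using o(2) by simp
    have "component (bc_map2 B p E \<phi>) (a1, e1)
          \<cdot>\<^bsub>bc_cat B p F\<^esub> far (bc_map1 B p E (NDom \<phi>)) (b, t, e1)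
        = far (bc_map1 B p E (NCod \<phi>)) (b, t, e1)
          \<cdot>\<^bsub>bc_cat B p F\<^esub> component (bc_map2 B p E \<phi>) (a0, e0)"
      unfolding h0(1) h1(1) bc_map2_simps(3)[OF o(1)] bc_map2_simps(3)[OF o(2)] bc_sel
        homD(2)[OF D(2)] homD(2)[OF i]
    proof (rule bc_arr_eqI[OF l r])
      show "Ide A a1 \<cdot>\<^bsub>A\<^esub> b = b \<cdot>\<^bsub>A\<^esub> Ide A a0"
        using p.C.comp_ide_left[OF D(2)] p.C.comp_ide_right[OF D(2)] by simp
      fix f assume f: "f \<in> Obj (slice A a0)"
      note bf = slice_obj_comp[OF D(2) f]
      show "component (vcomp (slice A a0) (Tot F) (whisker_right (slice A a0)
            (whisker_right (slice A a1) \<phi> e1) (rep_map A b)) (whisker_left (slice A a0) (NDom \<phi>) t)) f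
          = component (vcomp (slice A a0) (Tot F) (whisker_right (slice A a0)
            (whisker_left (slice A a0) (NCod \<phi>) t) (rep_map A (Ide A a0)))
            (whisker_right (slice A a0) \<phi> e0)) f"
        unfolding bc_comp_component[OF D(2) f] bc_comp_component[OF i f]
          p.C.comp_ide_left[OF slice_objD[OF f]]
        using \<phi>.naturality[OF bc_component_hom[OF m'(4) f]] f bf by (simp del: slice_simps(1))
    qed
    then show "component (bc_map2 B p E \<phi>) y \<cdot>\<^bsub>Tot (bc_fib B p F)\<^esub> far (NDom (bc_map2 B p E \<phi>)) m
      = far (NCod (bc_map2 B p E \<phi>)) m \<cdot>\<^bsub>Tot (bc_fib B p F)\<^esub> component (bc_map2 B p E \<phi>) x"
      using m' by simp
  qed (use bc_map1_functor[OF E F f0] bc_map1_functor[OF E F f1] hom in auto)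
  fix x assume x: "x \<in> Obj (Tot (bc_fib B p E))"
  then have "component (bc_map2 B p E \<phi>) x \<in> Arr (bc_cat B p F)" using homD(1)[OF hom] by simp
  then show "far (Proj (bc_fib B p F)) (component (bc_map2 B p E \<phi>) x)
    = Ide A (fob (Proj (bc_fib B p E)) x)"
    using x by (cases x) simp
qed

lemma bc_map1_id:
  assumes E: "cloven_fibration B E"
  shows "bc_map1 B p E (id_func (Tot E)) = id_func (bc_cat B p E)"
proof (rule funct_eqI)
  interpret K: category "bc_cat B p E" by (rule category_bc[OF E])
  note i = fibred_functor_id[OF E]
  show "cat_functor (bc_cat B p E) (bc_cat B p E) (bc_map1 B p E (id_func (Tot E)))"
    by (rule bc_map1_functor[OF E E i])
  show "cat_functor (bc_cat B p E) (bc_cat B p E) (id_func (bc_cat B p E))"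
    by (rule cat_functor_id[OF K.category_axioms])
  show "fob (bc_map1 B p E (id_func (Tot E))) x = fob (id_func (bc_cat B p E)) x"
    if "x \<in> Obj (bc_cat B p E)" for x
    using that comp_func_id_left[OF fibred_functorD, of B "Y (fst x)" E "snd x"] by (cases x) simp
  fix m assume mA: "m \<in> Arr (bc_cat B p E)"
  obtain b t a0 e0 a1 e1 where m: "m = (b, t, e1)"
      "(b, t, e1) \<in> hom (bc_cat B p E) (a0, e0) (a1, e1)" using in_hom[OF mA] by (rule bc_homE)
  note D = bc_homD[OF m(2)]
  interpret t: fibred_nat B "Y a0" E t by (rule D)
  have "whisker_left (slice A a0) (id_func (Tot E)) t = t"
    using comp_func_id_left[OF t.NDom.cat_functor_axioms]
      comp_func_id_left[OF t.NCod.cat_functor_axioms] homD(1)[OF t.component_hom] t.component_ext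
    by (intro nt_eqI[of _ "slice A a0"]) (auto simp del: slice_simps)
  moreover have "comp_func (slice A a1) (id_func (Tot E)) e1 = e1"
    using comp_func_id_left[OF fibred_functorD[OF D(3)]] by simp
  ultimately show "far (bc_map1 B p E (id_func (Tot E))) m = far (id_func (bc_cat B p E)) m"
    using bc_map1_hom(1)[OF i m(2)] mA m(1) by simp
qed

lemma bc_map1_comp:
  assumes E: "cloven_fibration B E" and F: "cloven_fibration B F" and G: "cloven_fibration B G"
    and f: "fibred_functor B E F f" and g: "fibred_functor B F G g"
  shows "bc_map1 B p E (comp_func (Tot E) g f)
    = comp_func (bc_cat B p E) (bc_map1 B p F g) (bc_map1 B p E f)"
proof (rule funct_eqI)
  note gf = fibred_functor_comp[OF f g]
  interpret f: cat_functor "bc_cat B p E" "bc_cat B p F" "bc_map1 B p E f"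
    by (rule bc_map1_functor[OF E F f])
  show "cat_functor (bc_cat B p E) (bc_cat B p G) (bc_map1 B p E (comp_func (Tot E) g f))"
    by (rule bc_map1_functor[OF E G gf])
  show "cat_functor (bc_cat B p E) (bc_cat B p G)
      (comp_func (bc_cat B p E) (bc_map1 B p F g) (bc_map1 B p E f))"
    by (rule cat_functor_comp[OF f.cat_functor_axioms bc_map1_functor[OF F G g]])
  have assoc: "comp_func (slice A a) (comp_func (Tot E) g f) e
      = comp_func (slice A a) g (comp_func (slice A a) f e)" if "fibred_functor B (Y a) E e" for a e
    using comp_func_assoc[OF fibred_functorD[OF that]] by simp
  show "fob (bc_map1 B p E (comp_func (Tot E) g f)) x
    = fob (comp_func (bc_cat B p E) (bc_map1 B p F g) (bc_map1 B p E f)) x"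
    if x: "x \<in> Obj (bc_cat B p E)" for x
    using x f.fob_obj[OF x] assoc by (cases x) simp
  fix m assume mA: "m \<in> Arr (bc_cat B p E)"
  obtain b t a0 e0 a1 e1 where m: "m = (b, t, e1)"
      "(b, t, e1) \<in> hom (bc_cat B p E) (a0, e0) (a1, e1)" using in_hom[OF mA] by (rule bc_homE)
  note D = bc_homD[OF m(2)]
  interpret t: fibred_nat B "Y a0" E t by (rule D)
  have "whisker_left (slice A a0) (comp_func (Tot E) g f) t
    = whisker_left (slice A a0) g (whisker_left (slice A a0) f t)"
    using assoc[OF t.NDom.fibred_functor_axioms] assoc[OF t.NCod.fibred_functor_axioms]
      homD(1)[OF t.component_hom]
    by (intro nt_eqI[of _ "slice A a0"]) (auto simp del: slice_simps)
  then show "far (bc_map1 B p E (comp_func (Tot E) g f)) m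
    = far (comp_func (bc_cat B p E) (bc_map1 B p F g) (bc_map1 B p E f)) m"
    using bc_map1_hom(1)[OF gf m(2)] bc_map1_hom[OF f m(2)] assoc[OF D(3)]
      bc_map1_hom(1)[OF g bc_map1_hom(2)[OF f m(2)]] mA m(1) by simp
qed

lemma bc_map2_id:
  "bc_map2 B p E (id_nt (Tot E) (Tot F) f) = id_nt (bc_cat B p E) (bc_cat B p F) (bc_map1 B p E f)"
proof (rule nt_eqI[of _ "bc_cat B p E"])
  fix x assume x: "x \<in> Obj (bc_cat B p E)"
  obtain a e where xe: "x = (a, e)" by (cases x)
  with x interpret e: fibred_functor B "Y a" E e by simp
  have "whisker_right (slice A a) (id_nt (Tot E) (Tot F) f) e
    = id_nt (slice A a) (Tot F) (comp_func (slice A a) f e)"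
    using e.fob_obj by (intro nt_eqI[of _ "slice A a"]) (auto simp del: slice_simps(1))
  then show "component (bc_map2 B p E (id_nt (Tot E) (Tot F) f)) x
    = component (id_nt (bc_cat B p E) (bc_cat B p F) (bc_map1 B p E f)) x"
    using x xe by simp
qed auto

lemma bc_map2_vcomp:
  assumes b: "fibred_nat B E F \<beta>"
  shows "bc_map2 B p E (vcomp (Tot E) (Tot F) \<beta> \<alpha>)
    = vcomp (bc_cat B p E) (bc_cat B p F) (bc_map2 B p E \<beta>) (bc_map2 B p E \<alpha>)"
proof (rule nt_eqI[of _ "bc_cat B p E"])
  fix x assume x: "x \<in> Obj (bc_cat B p E)"
  obtain c e where xe: "x = (c, e)" by (cases x)
  with x have c: "c \<in> Obj A" and e: "fibred_functor B (Y c) E e" by auto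
  interpret e: fibred_functor B "Y c" E e by (rule e)
  have "whisker_right (slice A c) (vcomp (Tot E) (Tot F) \<beta> \<alpha>) e
    = vcomp (slice A c) (Tot F) (whisker_right (slice A c) \<beta> e) (whisker_right (slice A c) \<alpha> e)"
    using e.fob_obj by (intro nt_eqI[of _ "slice A c"]) (auto simp del: slice_simps(1))
  then show "component (bc_map2 B p E (vcomp (Tot E) (Tot F) \<beta> \<alpha>)) x
    = component (vcomp (bc_cat B p E) (bc_cat B p F) (bc_map2 B p E \<beta>) (bc_map2 B p E \<alpha>)) x"
    using x xe bc_vertical_comp[OF c whisker_Y[OF e b]] by (simp del: bc_sel)
qed auto

lemma bc_map2_hcomp:
  assumes E: "cloven_fibration B E" and F: "cloven_fibration B F" and G: "cloven_fibration B G"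
    and a: "fibred_nat B E F \<alpha>" and b: "fibred_nat B F G \<beta>"
  shows "bc_map2 B p E (hcomp (Tot E) (Tot G) \<beta> \<alpha>)
    = hcomp (bc_cat B p E) (bc_cat B p G) (bc_map2 B p F \<beta>) (bc_map2 B p E \<alpha>)"
proof (rule nt_eqI[of _ "bc_cat B p E"])
  interpret a: fibred_nat B E F \<alpha> by fact
  interpret b: fibred_nat B F G \<beta> by fact
  show "NDom (bc_map2 B p E (hcomp (Tot E) (Tot G) \<beta> \<alpha>))
    = NDom (hcomp (bc_cat B p E) (bc_cat B p G) (bc_map2 B p F \<beta>) (bc_map2 B p E \<alpha>))"
    using bc_map1_comp[OF E F G a.NDom.fibred_functor_axioms b.NDom.fibred_functor_axioms] by simp
  show "NCod (bc_map2 B p E (hcomp (Tot E) (Tot G) \<beta> \<alpha>))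
    = NCod (hcomp (bc_cat B p E) (bc_cat B p G) (bc_map2 B p F \<beta>) (bc_map2 B p E \<alpha>))"
    using bc_map1_comp[OF E F G a.NCod.fibred_functor_axioms b.NCod.fibred_functor_axioms] by simp
  fix x assume x: "x \<in> Obj (bc_cat B p E)"
  obtain c e where xe: "x = (c, e)" by (cases x)
  with x have c: "c \<in> Obj A" and e: "fibred_functor B (Y c) E e" by auto
  interpret e: fibred_functor B "Y c" E e by (rule e)
  let ?S = "slice A c"
  have f'e: "fibred_functor B (Y c) F (comp_func ?S (NCod \<alpha>) e)"
    using fibred_functor_comp[OF e a.NCod.fibred_functor_axioms] by simp
  have v: "(Ide A c, whisker_right ?S \<alpha> e, comp_func ?S (NCod \<alpha>) e)
    \<in> hom (bc_cat B p F) (c, comp_func ?S (NDom \<alpha>) e) (c, comp_func ?S (NCod \<alpha>) e)"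
    using bc_vertical_hom[OF c whisker_Y[OF e a]] by simp
  have "whisker_right ?S (hcomp (Tot E) (Tot G) \<beta> \<alpha>) e
    = vcomp ?S (Tot G) (whisker_right ?S \<beta> (comp_func ?S (NCod \<alpha>) e))
        (whisker_left ?S (NDom \<beta>) (whisker_right ?S \<alpha> e))"
    using e.fob_obj comp_func_assoc[OF e.cat_functor_axioms]
    by (intro nt_eqI[of _ ?S]) (auto simp del: slice_simps(1))
  moreover have "comp_func ?S (comp_func (Tot E) (NCod \<beta>) (NCod \<alpha>)) e
    = comp_func ?S (NCod \<beta>) (comp_func ?S (NCod \<alpha>) e)"
    using comp_func_assoc[OF e.cat_functor_axioms] by simp
  ultimately show "component (bc_map2 B p E (hcomp (Tot E) (Tot G) \<beta> \<alpha>)) x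
    = component (hcomp (bc_cat B p E) (bc_cat B p G) (bc_map2 B p F \<beta>) (bc_map2 B p E \<alpha>)) x"
    using x xe bc_vertical_comp[OF c whisker_Y[OF f'e b]] bc_map1_hom(1)[OF b.NDom.fibred_functor_axioms v]
      f'e c by (simp del: bc_sel)
qed auto

lemma bc_functor_on_hom:
  assumes E: "cloven_fibration B E" and F: "cloven_fibration B F"
  shows "cat_functor (Fib_hom B E F) (Fib_hom A (bc_fib B p E) (bc_fib B p F))
    \<lparr>fob = (\<lambda>f \<in> Obj (Fib_hom B E F). bc_map1 B p E f),
     far = (\<lambda>\<phi> \<in> Arr (Fib_hom B E F). bc_map2 B p E \<phi>)\<rparr>"
  by (rule cat_functorI)
    (auto simp: category_Fib_hom E F bc_cloven bc_map1_fibred hom_Fib_hom bc_map2_fibred fibred_natD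
      fibred_nat_id bc_map2_id fibred_nat_vcomp bc_map2_vcomp)

lemma two_functor_oplax_base_change: "two_functor (Fib B) (Fib A) (oplax_base_change B p)"
  by (intro two_functor.intro two_category_Fib two_functor_axioms.intro)
    (auto simp: oplax_base_change_def bc_functor_on_hom bc_cloven fibred_functor_id bc_map1_id
      fibred_functor_comp bc_map1_comp fibred_nat_hcomp bc_map2_hcomp)

section \<open>The counit\<close>

text \<open>The counit evaluates at the identity.  An arrow \<open>(b, t, e1)\<close> gives the component of \<open>t\<close> at the
  identity, which ends at the value of \<open>e1\<close> at \<open>b\<close>; the arrow from \<open>b\<close> to the identity in the slice
  brings it to the value of \<open>e1\<close> at the identity.\<close>

definition bc_counit where
  "bc_counit F = \<lparr>fob = (\<lambda>(a, e) \<in> Obj (bc_cat B p F). fob e (Ide A a)),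
    far = (\<lambda>(b, t, e) \<in> Arr (bc_cat B p F).
      far e (b, Ide A (Cod A b)) \<cdot>\<^bsub>Tot F\<^esub> component t (Ide A (Dom A b)))\<rparr>"

lemma bc_counit_fob [simp]:
  "(a, e) \<in> Obj (bc_cat B p F) \<Longrightarrow> fob (bc_counit F) (a, e) = fob e (Ide A a)"
  by (simp add: bc_counit_def del: bc_obj)

lemma bc_counit_far:
  assumes m: "(b, t, e1) \<in> hom (bc_cat B p F) (a0, e0) (a1, e1)"
  shows "far (bc_counit F) (b, t, e1) = far e1 (b, Ide A a1) \<cdot>\<^bsub>Tot F\<^esub> component t (Ide A a0)"
    and "component t (Ide A a0) \<in> hom (Tot F) (fob e0 (Ide A a0)) (fob e1 b)"
    and "(b, Ide A a1) \<in> hom (slice A a1) b (Ide A a1)"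
    and "far e1 (b, Ide A a1) \<in> hom (Tot F) (fob e1 b) (fob e1 (Ide A a1))"
proof -
  note D = bc_homD[OF m]
  interpret e1: fibred_functor B "Y a1" F e1 by (rule D(3))
  have a: "a0 \<in> Obj A" "a1 \<in> Obj A" using hom_objD[OF p.C.category_axioms D(2)] by auto
  note j = p.C.ide_hom[OF a(2)]
  show "far (bc_counit F) (b, t, e1) = far e1 (b, Ide A a1) \<cdot>\<^bsub>Tot F\<^esub> component t (Ide A a0)"
    using homD(1)[OF m] homD[OF D(2)] by (simp add: bc_counit_def)
  show "component t (Ide A a0) \<in> hom (Tot F) (fob e0 (Ide A a0)) (fob e1 b)"
    using bc_component_hom[OF m slice_id_obj(1)[OF p.C.category_axioms a(1)]]
      p.C.comp_ide_right[OF D(2)] by simp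
  show *: "(b, Ide A a1) \<in> hom (slice A a1) b (Ide A a1)"
    using slice_homI[OF D(2) j] p.C.comp_ide_left[OF D(2)] by simp
  show "far e1 (b, Ide A a1) \<in> hom (Tot F) (fob e1 b) (fob e1 (Ide A a1))"
    using e1.far_hom[of "(b, Ide A a1)"] * by simp
qed

lemma bc_counit_vertical:
  assumes F: "cloven_fibration B F" and a: "a \<in> Obj A" and t: "fibred_nat B (Y a) F t"
  shows "far (bc_counit F) (Ide A a, t, NCod t) = component t (Ide A a)"
proof -
  interpret F: cloven_fibration B F by fact
  interpret t: fibred_nat B "Y a" F t by (rule t)
  note h = bc_counit_far[OF bc_vertical_hom[OF a t]]
  have i: "Ide A a \<in> Obj (slice A a)" using slice_id_obj(1)[OF p.C.category_axioms a] .
  have "(Ide A a, Ide A a) = Ide (slice A a) (Ide A a)"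
    using homD(2)[OF p.C.ide_hom[OF a]] by simp
  then have "far (NCod t) (Ide A a, Ide A a) = Ide (Tot F) (fob (NCod t) (Ide A a))"
    using t.NCod.far_ide[of "Ide A a"] i by simp
  then show ?thesis using h(1) F.C.comp_ide_left[OF h(2)] by simp
qed

lemma bc_counit_functor:
  assumes F: "cloven_fibration B F"
  shows "cat_functor (bc_cat B p F) (Tot F) (bc_counit F)"
proof (rule cat_functorI)
  interpret F: cloven_fibration B F by fact
  interpret K: category "bc_cat B p F" by (rule category_bc[OF F])
  let ?K = "bc_cat B p F"
  show "category ?K" "category (Tot F)" by (rule K.category_axioms, rule F.C.category_axioms)
  show "fob (bc_counit F) \<in> extensional (Obj ?K)" "far (bc_counit F) \<in> extensional (Arr ?K)"
    by (simp_all add: bc_counit_def)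
  show "fob (bc_counit F) x \<in> Obj (Tot F)" if x: "x \<in> Obj ?K" for x
  proof (cases x)
    case (Pair a e)
    with x have a: "a \<in> Obj A" and "fibred_functor B (Y a) F e" by auto
    then interpret e: fibred_functor B "Y a" F e by simp
    show ?thesis
      using x Pair e.fob_obj slice_id_obj(1)[OF p.C.category_axioms a] by (simp del: bc_obj slice_simps(1))
  qed
  { fix m x y assume m: "m \<in> hom ?K x y"
    obtain b t a0 e0 a1 e1 where *: "x = (a0, e0)" "y = (a1, e1)" "m = (b, t, e1)"
      "(b, t, e1) \<in> hom ?K (a0, e0) (a1, e1)" using m by (rule bc_homE)
    have o: "(a0, e0) \<in> Obj ?K" "(a1, e1) \<in> Obj ?K"
      using hom_objD[OF K.category_axioms *(4)] by auto
    note h = bc_counit_far[OF *(4)]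
    show "far (bc_counit F) m \<in> hom (Tot F) (fob (bc_counit F) x) (fob (bc_counit F) y)"
      unfolding *(1-3) h(1) bc_counit_fob[OF o(1)] bc_counit_fob[OF o(2)]
      by (rule F.C.comp_hom[OF h(2,4)]) }
  { fix x assume x: "x \<in> Obj ?K"
    obtain a e where xe: "x = (a, e)" by (cases x)
    with x have a: "a \<in> Obj A" and e: "fibred_functor B (Y a) F e" by auto
    have "fibred_nat B (Y a) F (id_nt (slice A a) (Tot F) e)" using fibred_nat_id[OF F e] by simp
    from bc_counit_vertical[OF F a this]
    show "far (bc_counit F) (Ide ?K x) = Ide (Tot F) (fob (bc_counit F) x)"
      using xe x slice_id_obj(1)[OF p.C.category_axioms a]
      by (simp del: slice_simps(1)) }
  { fix m n x y z assume m: "m \<in> hom ?K x y" and n: "n \<in> hom ?K y z"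
    obtain b t a0 e0 a1 e1 where m': "x = (a0, e0)" "y = (a1, e1)" "m = (b, t, e1)"
      "(b, t, e1) \<in> hom ?K (a0, e0) (a1, e1)" using m by (rule bc_homE)
    obtain c s a2 e2 where n': "z = (a2, e2)" "n = (c, s, e2)"
      "(c, s, e2) \<in> hom ?K (a1, e1) (a2, e2)" using n[unfolded m'(2)] by (rule bc_homE')
    note D = bc_homD[OF m'(4)] and D' = bc_homD[OF n'(3)]
    interpret s: fibred_nat B "Y a1" F s by (rule D')
    interpret e2: fibred_functor B "Y a2" F e2 by (rule D')
    have a: "a0 \<in> Obj A" "a1 \<in> Obj A" "a2 \<in> Obj A"
      using hom_objD[OF p.C.category_axioms D(2)] hom_objD[OF p.C.category_axioms D'(2)] by auto
    note i0 = slice_id_obj[OF p.C.category_axioms a(1)]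
    note h = bc_counit_far[OF m'(4)] and k = bc_counit_far[OF n'(3)]
    have bO: "b \<in> Obj (slice A a1)" using homD[OF D(2)] by simp
    have c1: "c \<cdot>\<^bsub>A\<^esub> Ide A a1 = c" using p.C.comp_ide_right[OF D'(2)] .
    have r: "far (rep_map A c) (b, Ide A a1) = (b, c)"
      using homD[OF D'(2)] homD[OF h(3)] homD(1)[OF h(3)] c1 by simp
    \<comment> \<open>Naturality of \<open>s\<close> along \<open>b\<close>, seen as an arrow of the slice from \<open>b\<close> to the identity.\<close>
    have nat: "component s (Ide A a1) \<cdot>\<^bsub>Tot F\<^esub> far e1 (b, Ide A a1)
      = far e2 (b, c) \<cdot>\<^bsub>Tot F\<^esub> component s b"
      using s.naturality[of "(b, Ide A a1)"] h(3) homD(1)[OF h(3)] D'(5,6) r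
      by (simp del: slice_simps(2))
    have bc: "(b, c) \<in> hom (slice A a2) (c \<cdot>\<^bsub>A\<^esub> b) c" using slice_homI[OF D(2) D'(2)] .
    have sb: "component s b \<in> hom (Tot F) (fob e1 b) (fob e2 (c \<cdot>\<^bsub>A\<^esub> b))"
      using bc_component_hom[OF n'(3) bO] .
    have fbc: "far e2 (b, c) \<in> hom (Tot F) (fob e2 (c \<cdot>\<^bsub>A\<^esub> b)) (fob e2 c)"
      using e2.far_hom[of "(b, c)"] bc by simp
    let ?o = "Comp (Tot F)"
    let ?u = "far e2 (c, Ide A a2)" and ?v = "component s (Ide A a1)" and ?w = "far e1 (b, Ide A a1)"
      and ?x = "component t (Ide A a0)"
    have "far (bc_counit F) (n \<cdot>\<^bsub>?K\<^esub> m) = ?o (far e2 (c \<cdot>\<^bsub>A\<^esub> b, Ide A a2)) (?o (component s b) ?x)"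
      using bc_counit_far(1)[OF bc_comp_hom[OF F m'(4) n'(3), unfolded bc_sel homD(2)[OF D(2)]]]
        p.C.comp_ide_right[OF D(2)] m'(3) n'(2) homD(2)[OF D(2)]
      by (simp add: bc_comp_component[OF D(2) i0(1)] del: slice_simps(1) vcomp_simps(3))
    also have "far e2 (c \<cdot>\<^bsub>A\<^esub> b, Ide A a2) = ?o ?u (far e2 (b, c))"
      using e2.far_comp[of "(b, c)" "c \<cdot>\<^bsub>A\<^esub> b" c "(c, Ide A a2)" "Ide A a2"] bc k(3) by simp
    also have "?o (?o ?u (far e2 (b, c))) (?o (component s b) ?x)
        = ?o ?u (?o (?o (far e2 (b, c)) (component s b)) ?x)"
      using F.C.comp_assoc[OF F.C.comp_hom[OF h(2) sb] fbc k(4)] F.C.comp_assoc[OF h(2) sb fbc] by simp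
    also have "\<dots> = ?o ?u (?o (?o ?v ?w) ?x)" using nat by simp
    also have "\<dots> = ?o (?o ?u ?v) (?o ?w ?x)"
      using F.C.comp_assoc[OF F.C.comp_hom[OF h(2,4)] k(2,4)] F.C.comp_assoc[OF h(2,4) k(2)] by simp
    also have "\<dots> = ?o (far (bc_counit F) n) (far (bc_counit F) m)"
      using h(1) k(1) m'(3) n'(2) by simp
    finally show "far (bc_counit F) (n \<cdot>\<^bsub>?K\<^esub> m) = ?o (far (bc_counit F) n) (far (bc_counit F) m)" . }
qed

lemma sum_bc:
  assumes "cloven_fibration B F"
  shows "sum_fibration B p (bc_fib B p F)"
  using sum_fibrationI[OF p.cloven_fibration_axioms bc_cloven[OF assms]] .

text \<open>A cartesian arrow of the sum has a cartesian base arrow \<open>b\<close> and an invertible 2-cell; the first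
  makes the image of the slice arrow cartesian, as \<open>e1\<close> is fibred over \<open>B\<close>, and the second makes the
  remaining factor an isomorphism.\<close>

lemma bc_counit_fibred:
  assumes F: "cloven_fibration B F"
  shows "fibred_functor B (sum_fib p (bc_fib B p F)) F (bc_counit F)"
proof (rule fibred_functorI)
  interpret F: cloven_fibration B F by fact
  interpret S: sum_fibration B p "bc_fib B p F" by (rule sum_bc[OF F])
  let ?K = "bc_cat B p F"
  show "cat_functor (Tot (sum_fib p (bc_fib B p F))) (Tot F) (bc_counit F)"
    using bc_counit_functor[OF F] by simp
  show "cat_functor (Tot (sum_fib p (bc_fib B p F))) B (Proj (sum_fib p (bc_fib B p F)))"
    using S.sum_functor by simp
  show "cat_functor (Tot F) B (Proj F)" by (rule F.cat_functor_axioms)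
  show "fob (Proj F) (fob (bc_counit F) x) = fob (Proj (sum_fib p (bc_fib B p F))) x"
    if "x \<in> Obj (Tot (sum_fib p (bc_fib B p F)))" for x
  proof (cases x)
    case (Pair a e)
    with that have a: "a \<in> Obj A" and e: "fibred_functor B (Y a) F e" by auto
    note i = slice_id_obj[OF p.C.category_axioms a]
    show ?thesis
      using that Pair fibred_functor.proj_fob[OF e, of "Ide A a"] i homD[OF i(2)] by simp
  qed
  have far: "far (bc_counit F) m = far e1 (b, Ide A a1) \<cdot>\<^bsub>Tot F\<^esub> component t (Ide A a0)"
    "far (Proj F) (far e1 (b, Ide A a1)) = far (Proj p) b"
    "far (Proj F) (component t (Ide A a0)) = Ide B (fob (Proj p) a0)"
    if m: "m = (b, t, e1)" "(b, t, e1) \<in> hom ?K (a0, e0) (a1, e1)" for m b t e0 e1 a0 a1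
  proof -
    note D = bc_homD[OF m(2)] and h = bc_counit_far[OF m(2)]
    show "far (bc_counit F) m = far e1 (b, Ide A a1) \<cdot>\<^bsub>Tot F\<^esub> component t (Ide A a0)"
      using h(1) m(1) by simp
    show "far (Proj F) (far e1 (b, Ide A a1)) = far (Proj p) b"
      using fibred_functor.proj_far[OF D(3), of "(b, Ide A a1)"] homD(1)[OF h(3)] by simp
    have a0: "a0 \<in> Obj A" using hom_objD[OF p.C.category_axioms D(2)] by simp
    note i = slice_id_obj[OF p.C.category_axioms a0]
    show "far (Proj F) (component t (Ide A a0)) = Ide B (fob (Proj p) a0)"
      using fibred_natD(4)[OF D(4), of "Ide A a0"] i homD[OF i(2)] by simp
  qed
  show "far (Proj F) (far (bc_counit F) m) = far (Proj (sum_fib p (bc_fib B p F))) m"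
    if "m \<in> Arr (Tot (sum_fib p (bc_fib B p F)))" for m
  proof -
    have mA: "m \<in> Arr ?K" using that by simp
    obtain b t a0 e0 a1 e1 where m: "m = (b, t, e1)"
      "(b, t, e1) \<in> hom ?K (a0, e0) (a1, e1)" using in_hom[OF mA] by (rule bc_homE)
    note h = bc_counit_far[OF m(2)] and D = bc_homD[OF m(2)]
    show ?thesis
      using F.far_comp[OF h(2,4)] far[OF m] p.D.comp_ide_right[OF p.far_hom[OF D(2)]] mA m(1) by simp
  qed
  show "cartesian_arrow B F (far (bc_counit F) m)"
    if c: "cartesian_arrow B (sum_fib p (bc_fib B p F)) m" for m
  proof -
    note S = S.cartesian_sumD[OF c]
    then have mA: "m \<in> Arr ?K" by (simp add: cartesian_arrow_def)
    obtain b t a0 e0 a1 e1 where m: "m = (b, t, e1)"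
      "(b, t, e1) \<in> hom ?K (a0, e0) (a1, e1)" using in_hom[OF mA] by (rule bc_homE)
    note h = bc_counit_far[OF m(2)] and D = bc_homD[OF m(2)]
    have a0: "a0 \<in> Obj A" using hom_objD[OF p.C.category_axioms D(2)] by simp
    note i = slice_id_obj[OF p.C.category_axioms a0]
    have "iso_arrow (Tot F) (component t (Ide A a0))"
      using bc_cartesianD[OF F m(2) _ i(1)] S(1) m(1) by simp
    note c1 = F.iso_cartesian[OF this]
    have "cartesian_arrow B p b" using S(2) mA m(1) by simp
    then have "cartesian_arrow B (Y a1) (b, Ide A a1)"
      using sum_fibration.cartesian_sumI[OF sum_fibrationI[OF p.cloven_fibration_axioms p.C.rep_cloven]
        p.C.rep_cartesian[OF homD(1)[OF h(3)]]] homD(1)[OF h(3)] by simp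
    from fibred_functor.preserves_cartesian[OF D(3) this]
    show ?thesis using F.cartesian_comp[OF c1 _ h(2,4)] far(1)[OF m] by simp
  qed
qed

text \<open>Evaluation at an identity commutes with postcomposition, and no chosen lift occurs in it.\<close>

lemma bc_counit_natural:
  assumes E: "cloven_fibration B E" and F: "cloven_fibration B F" and f: "fibred_functor B E F f"
  shows "comp_func (bc_cat B p E) (bc_counit F) (bc_map1 B p E f)
    = comp_func (bc_cat B p E) f (bc_counit E)"
proof (rule funct_eqI)
  interpret f: fibred_functor B E F f by fact
  interpret M: cat_functor "bc_cat B p E" "bc_cat B p F" "bc_map1 B p E f"
    by (rule bc_map1_functor[OF E F f])
  show "cat_functor (bc_cat B p E) (Tot F) (comp_func (bc_cat B p E) (bc_counit F) (bc_map1 B p E f))"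
    by (rule cat_functor_comp[OF M.cat_functor_axioms bc_counit_functor[OF F]])
  show "cat_functor (bc_cat B p E) (Tot F) (comp_func (bc_cat B p E) f (bc_counit E))"
    by (rule cat_functor_comp[OF bc_counit_functor[OF E] f.cat_functor_axioms])
  show "fob (comp_func (bc_cat B p E) (bc_counit F) (bc_map1 B p E f)) x
    = fob (comp_func (bc_cat B p E) f (bc_counit E)) x" if x: "x \<in> Obj (bc_cat B p E)" for x
  proof (cases x)
    case (Pair a e)
    with x have "a \<in> Obj A" by auto
    from slice_id_obj(1)[OF p.C.category_axioms this]
    show ?thesis using x Pair M.fob_obj[OF x] by (simp del: slice_simps(1) bc_obj)
  qed
  fix m assume mA: "m \<in> Arr (bc_cat B p E)"
  obtain b t a0 e0 a1 e1 where m: "m = (b, t, e1)"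
      "(b, t, e1) \<in> hom (bc_cat B p E) (a0, e0) (a1, e1)" using in_hom[OF mA] by (rule bc_homE)
  note h = bc_counit_far[OF m(2)] and D = bc_homD[OF m(2)] and k = bc_map1_hom[OF f m(2)]
  have a0: "a0 \<in> Obj A" using hom_objD[OF p.C.category_axioms D(2)] by simp
  note i = slice_id_obj(1)[OF p.C.category_axioms a0]
  have "far (bc_counit F) (far (bc_map1 B p E f) m) = far f (far (bc_counit E) m)"
    using bc_counit_far(1)[OF k(2)] k(1) h(1) f.far_comp[OF h(2,4)] m(1) i homD(1)[OF h(3)]
    by (simp del: slice_simps(1,2))
  then show "far (comp_func (bc_cat B p E) (bc_counit F) (bc_map1 B p E f)) m
    = far (comp_func (bc_cat B p E) f (bc_counit E)) m" using mA by simp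
qed

lemma bc_counit_natural2:
  assumes F: "cloven_fibration B F" and \<phi>: "fibred_nat B E F \<phi>" and x: "x \<in> Obj (bc_cat B p E)"
  shows "far (bc_counit F) (component (bc_map2 B p E \<phi>) x) = component \<phi> (fob (bc_counit E) x)"
proof (cases x)
  case (Pair a e)
  with x have a: "a \<in> Obj A" and e: "fibred_functor B (Y a) E e" by auto
  show ?thesis
    using bc_counit_vertical[OF F a whisker_Y[OF e \<phi>]] Pair x
      slice_id_obj(1)[OF p.C.category_axioms a] by (simp del: slice_simps(1) bc_obj)
qed

end

section \<open>Functors of chosen lifts\<close>

text \<open>The choice of lifts turns an object \<open>x\<close> of a fibration into a fibred functor out of the
  representable at its projection, as in the fibred Yoneda lemma.\<close>

definition lift_functor ::
  "('bo, 'bm) cat \<Rightarrow> ('o, 'm, 'bo, 'bm) fibration \<Rightarrow> 'o \<Rightarrow> ('bm, 'bm \<times> 'bm, 'o, 'm) funct" where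
  "lift_functor B E x = \<lparr>
    fob = (\<lambda>f \<in> Obj (slice B (fob (Proj E) x)). Dom (Tot E) (Lift E f x)),
    far = (\<lambda>(k, f) \<in> Arr (slice B (fob (Proj E) x)). fill E (Lift E f x) k (Lift E (f \<cdot>\<^bsub>B\<^esub> k) x))\<rparr>"

text \<open>An arrow \<open>m : x \<rightarrow> y\<close> over \<open>u\<close> induces a vertical arrow between the domains of the chosen lifts of
  \<open>f\<close> at \<open>x\<close> and of \<open>u \<cdot> f\<close> at \<open>y\<close>.\<close>

definition lift_nat ::
  "('bo, 'bm) cat \<Rightarrow> ('o, 'm, 'bo, 'bm) fibration \<Rightarrow> 'm \<Rightarrow> ('bm, 'bm \<times> 'bm, 'o, 'm) nt" where
  "lift_nat B E m = (let x = Dom (Tot E) m; y = Cod (Tot E) m; u = far (Proj E) m;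
      S = slice B (fob (Proj E) x) in
    \<lparr>NDom = lift_functor B E x, NCod = comp_func S (lift_functor B E y) (rep_map B u),
     component = (\<lambda>f \<in> Obj S. fill E (Lift E (u \<cdot>\<^bsub>B\<^esub> f) y) (Ide B (Dom B f)) (m \<cdot>\<^bsub>Tot E\<^esub> Lift E f x))\<rparr>)"

context cloven_fibration
begin

lemma lift_at:
  assumes "x \<in> Obj (Tot E)" and "f \<in> hom B c (fob (Proj E) x)"
  shows "cartesian_arrow B E (Lift E f x)"
    and "Lift E f x \<in> hom (Tot E) (fob (lift_functor B E x) f) x"
    and "far (Proj E) (Lift E f x) = f"
    and "fob (lift_functor B E x) f \<in> Obj (Tot E)"
    and "fob (Proj E) (fob (lift_functor B E x) f) = c"
  using lift_hom[OF assms(2,1) refl] homD[OF assms(2)] by (auto simp: lift_functor_def)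

lemma lift_functor_far:
  assumes x: "x \<in> Obj (Tot E)" and k: "k \<in> hom B c d" and f: "f \<in> hom B d (fob (Proj E) x)"
  shows "far (lift_functor B E x) (k, f)
      \<in> hom (Tot E) (fob (lift_functor B E x) (f \<cdot>\<^bsub>B\<^esub> k)) (fob (lift_functor B E x) f)"
    and "far (Proj E) (far (lift_functor B E x) (k, f)) = k"
    and "Lift E f x \<cdot>\<^bsub>Tot E\<^esub> far (lift_functor B E x) (k, f) = Lift E (f \<cdot>\<^bsub>B\<^esub> k) x"
proof -
  note fk = D.comp_hom[OF k f]
  note L = lift_at[OF x f] and M = lift_at[OF x fk]
  have eq: "far (lift_functor B E x) (k, f) = fill E (Lift E f x) k (Lift E (f \<cdot>\<^bsub>B\<^esub> k) x)"
    using homD[OF k] homD[OF f] by (simp add: lift_functor_def)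
  have "k \<in> hom B (fob (Proj E) (fob (lift_functor B E x) (f \<cdot>\<^bsub>B\<^esub> k)))
      (fob (Proj E) (fob (lift_functor B E x) f))" using k L(5) M(5) by simp
  note F = fill[OF L(1,2) M(2) this]
  show "far (lift_functor B E x) (k, f)
      \<in> hom (Tot E) (fob (lift_functor B E x) (f \<cdot>\<^bsub>B\<^esub> k)) (fob (lift_functor B E x) f)"
    "far (Proj E) (far (lift_functor B E x) (k, f)) = k"
    "Lift E f x \<cdot>\<^bsub>Tot E\<^esub> far (lift_functor B E x) (k, f) = Lift E (f \<cdot>\<^bsub>B\<^esub> k) x"
    unfolding eq using F L(3) M(3) by auto
qed

lemma lift_functor_eqI:
  assumes x: "x \<in> Obj (Tot E)" and f: "f \<in> hom B d (fob (Proj E) x)"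
    and "h \<in> hom (Tot E) v (fob (lift_functor B E x) f)"
    and "h' \<in> hom (Tot E) v (fob (lift_functor B E x) f)"
    and "far (Proj E) h = far (Proj E) h'"
    and "Lift E f x \<cdot>\<^bsub>Tot E\<^esub> h = Lift E f x \<cdot>\<^bsub>Tot E\<^esub> h'"
  shows "h = h'"
  using cartesian_eqI[OF lift_at(1,2)[OF x f] assms(3-6)] .

lemma lift_functor_fibred:
  assumes x: "x \<in> Obj (Tot E)"
  shows "fibred_functor B (rep B (fob (Proj E) x)) E (lift_functor B E x)"
proof (rule fibred_functorI)
  let ?R = "lift_functor B E x" and ?b = "fob (Proj E) x" and ?c = "Comp (Tot E)"
  show "cat_functor (Tot (rep B ?b)) (Tot E) ?R"
  proof (rule cat_functorI)
    show "category (Tot (rep B ?b))" using D.category_slice by simp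
    show "category (Tot E)" by (rule C.category_axioms)
    show "fob ?R \<in> extensional (Obj (Tot (rep B ?b)))" "far ?R \<in> extensional (Arr (Tot (rep B ?b)))"
      by (simp_all add: lift_functor_def del: slice_simps)
    show "fob ?R f \<in> Obj (Tot E)" if "f \<in> Obj (Tot (rep B ?b))" for f
      using lift_at(4)[OF x, of f "Dom B f"] that by (simp add: hom_def)
    { fix m f g assume "m \<in> hom (Tot (rep B ?b)) f g"
      then have m: "m \<in> hom (slice B ?b) f g" by simp
      then obtain k where k: "m = (k, g)" "k \<in> hom B (Dom B k) (Dom B g)"
        "g \<in> hom B (Dom B g) ?b" "f = g \<cdot>\<^bsub>B\<^esub> k" by (rule slice_homE)
      show "far ?R m \<in> hom (Tot E) (fob ?R f) (fob ?R g)"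
        using lift_functor_far(1)[OF x k(2,3)] k(1,4) by simp }
    { fix f assume "f \<in> Obj (Tot (rep B ?b))"
      then have f: "f \<in> hom B (Dom B f) ?b" by (simp add: hom_def)
      have i: "Ide B (Dom B f) \<in> hom B (Dom B f) (Dom B f)"
        using D.ide_hom hom_objD(1)[OF D.category_axioms f] .
      note h = lift_functor_far[OF x i f, unfolded D.comp_ide_right[OF f]] and L = lift_at[OF x f]
      have "far ?R (Ide B (Dom B f), f) = Ide (Tot E) (fob ?R f)"
        using h far_ide[OF L(4)] L(5) C.comp_ide_right[OF L(2)]
        by (intro lift_functor_eqI[OF x f h(1) C.ide_hom[OF L(4)]]) auto
      then show "far ?R (Ide (Tot (rep B ?b)) f) = Ide (Tot E) (fob ?R f)" by simp }
    { fix m n f g h assume "m \<in> hom (Tot (rep B ?b)) f g" "n \<in> hom (Tot (rep B ?b)) g h"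
      then have m: "m \<in> hom (slice B ?b) f g" and n: "n \<in> hom (slice B ?b) g h" by auto
      obtain l where l: "n = (l, h)" "l \<in> hom B (Dom B l) (Dom B h)"
        "h \<in> hom B (Dom B h) ?b" "g = h \<cdot>\<^bsub>B\<^esub> l" using n by (rule slice_homE)
      obtain k where k: "m = (k, g)" "k \<in> hom B (Dom B k) (Dom B g)"
        "g \<in> hom B (Dom B g) ?b" using m by (rule slice_homE)
      have dg: "Dom B g = Dom B l" using homD(2)[OF D.comp_hom[OF l(2,3)]] l(4) by simp
      note k' = k(2)[unfolded dg] and g' = k(3)[unfolded dg]
      note lk = D.comp_hom[OF k' l(2)]
      have e: "h \<cdot>\<^bsub>B\<^esub> (l \<cdot>\<^bsub>B\<^esub> k) = g \<cdot>\<^bsub>B\<^esub> k" using D.comp_assoc[OF k' l(2,3)] l(4) by simp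
      note hm = lift_functor_far[OF x k' g'] and hn = lift_functor_far[OF x l(2,3), folded l(4)]
        and hnm = lift_functor_far[OF x lk l(3), unfolded e]
      have "far ?R (l \<cdot>\<^bsub>B\<^esub> k, h) = ?c (far ?R (l, h)) (far ?R (k, g))"
        using hnm(2,3) far_comp[OF hm(1) hn(1)] hm(2,3) hn(2,3)
          C.comp_assoc[OF hm(1) hn(1) lift_at(2)[OF x l(3)]]
        by (intro lift_functor_eqI[OF x l(3) hnm(1) C.comp_hom[OF hm(1) hn(1)]]) auto
      then show "far ?R (n \<cdot>\<^bsub>Tot (rep B ?b)\<^esub> m) = ?c (far ?R n) (far ?R m)" using k(1) l(1) by simp }
  qed
  show "cat_functor (Tot (rep B ?b)) B (Proj (rep B ?b))" using D.rep_proj by simp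
  show "cat_functor (Tot E) B (Proj E)" by (rule cat_functor_axioms)
  show "fob (Proj E) (fob ?R f) = fob (Proj (rep B ?b)) f" if "f \<in> Obj (Tot (rep B ?b))" for f
    using lift_at(5)[OF x, of f "Dom B f"] that by (simp add: hom_def)
  show "far (Proj E) (far ?R m) = far (Proj (rep B ?b)) m" if "m \<in> Arr (Tot (rep B ?b))" for m
  proof -
    have mA: "m \<in> Arr (slice B ?b)" using that by simp
    then obtain k g where k: "m = (k, g)" "k \<in> hom B (Dom B k) (Dom B g)"
        "g \<in> hom B (Dom B g) ?b" by (rule slice_arrE)
    then show ?thesis using lift_functor_far(2)[OF x k(2,3)] mA by (simp del: slice_simps)
  qed
  show "cartesian_arrow B E (far ?R m)" if "cartesian_arrow B (rep B ?b) m" for m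
  proof -
    have mA: "m \<in> Arr (slice B ?b)" using that by (simp add: cartesian_arrow_def)
    then obtain k g where k: "m = (k, g)" "k \<in> hom B (Dom B k) (Dom B g)"
        "g \<in> hom B (Dom B g) ?b" by (rule slice_arrE)
    note h = lift_functor_far[OF x k(2,3)] and L = lift_at[OF x k(3)]
      and M = lift_at[OF x D.comp_hom[OF k(2,3)]]
    show ?thesis using cartesian_cancel[OF L(1) _ h(1) L(2)] h(3) M(1) k(1) by simp
  qed
qed

lemma lift_nat_sel:
  assumes "m \<in> hom (Tot E) x y"
  shows "NDom (lift_nat B E m) = lift_functor B E x"
    and "NCod (lift_nat B E m)
      = comp_func (slice B (fob (Proj E) x)) (lift_functor B E y) (rep_map B (far (Proj E) m))"
    and "component (lift_nat B E m) \<in> extensional (Obj (slice B (fob (Proj E) x)))"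
  using homD[OF assms] by (simp_all add: lift_nat_def Let_def)

lemma lift_nat_component:
  assumes m: "m \<in> hom (Tot E) x y" and f: "f \<in> hom B c (fob (Proj E) x)"
  shows "component (lift_nat B E m) f \<in> hom (Tot E) (fob (lift_functor B E x) f)
      (fob (lift_functor B E y) (far (Proj E) m \<cdot>\<^bsub>B\<^esub> f))"
    and "far (Proj E) (component (lift_nat B E m) f) = Ide B c"
    and "Lift E (far (Proj E) m \<cdot>\<^bsub>B\<^esub> f) y \<cdot>\<^bsub>Tot E\<^esub> component (lift_nat B E m) f
      = m \<cdot>\<^bsub>Tot E\<^esub> Lift E f x"
proof -
  have x: "x \<in> Obj (Tot E)" and y: "y \<in> Obj (Tot E)"
    using hom_objD[OF C.category_axioms m] by auto
  note u = far_hom[OF m]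
  note uf = D.comp_hom[OF f u]
  note L = lift_at[OF x f] and M = lift_at[OF y uf]
  have c: "c \<in> Obj B" using hom_objD(1)[OF D.category_axioms f] .
  have eq: "component (lift_nat B E m) f = fill E (Lift E (far (Proj E) m \<cdot>\<^bsub>B\<^esub> f) y) (Ide B c)
      (m \<cdot>\<^bsub>Tot E\<^esub> Lift E f x)"
    using homD[OF m] homD[OF f] by (simp add: lift_nat_def Let_def)
  have w: "Ide B c \<in> hom B (fob (Proj E) (fob (lift_functor B E x) f))
      (fob (Proj E) (fob (lift_functor B E y) (far (Proj E) m \<cdot>\<^bsub>B\<^esub> f)))"
    using D.ide_hom[OF c] L(5) M(5) by simp
  have "far (Proj E) (Lift E (far (Proj E) m \<cdot>\<^bsub>B\<^esub> f) y) \<cdot>\<^bsub>B\<^esub> Ide B c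
    = far (Proj E) (m \<cdot>\<^bsub>Tot E\<^esub> Lift E f x)"
    using M(3) L(3) far_comp[OF L(2) m] D.comp_ide_right[OF uf] by simp
  note F = fill[OF M(1,2) C.comp_hom[OF L(2) m] w this]
  show "component (lift_nat B E m) f \<in> hom (Tot E) (fob (lift_functor B E x) f)
      (fob (lift_functor B E y) (far (Proj E) m \<cdot>\<^bsub>B\<^esub> f))"
    "far (Proj E) (component (lift_nat B E m) f) = Ide B c"
    "Lift E (far (Proj E) m \<cdot>\<^bsub>B\<^esub> f) y \<cdot>\<^bsub>Tot E\<^esub> component (lift_nat B E m) f
      = m \<cdot>\<^bsub>Tot E\<^esub> Lift E f x"
    unfolding eq by (rule F)+
qed

lemma lift_nat_fibred:
  assumes m: "m \<in> hom (Tot E) x y"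
  shows "fibred_nat B (rep B (fob (Proj E) x)) E (lift_nat B E m)"
proof (rule fibred_natI)
  let ?b = "fob (Proj E) x" and ?u = "far (Proj E) m"
  have x: "x \<in> Obj (Tot E)" and y: "y \<in> Obj (Tot E)"
    using hom_objD[OF C.category_axioms m] by auto
  note u = far_hom[OF m] and sel = lift_nat_sel[OF m]
  show R0: "fibred_functor B (rep B ?b) E (NDom (lift_nat B E m))"
    unfolding sel by (rule lift_functor_fibred[OF x])
  show R1: "fibred_functor B (rep B ?b) E (NCod (lift_nat B E m))"
    unfolding sel using fibred_functor_comp[OF D.rep_map_fibred[OF u] lift_functor_fibred[OF y]] by simp
  have slice: "f \<in> hom B (Dom B f) ?b" if "f \<in> Obj (Tot (rep B ?b))" for f
    using that by (simp add: hom_def)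
  show "far (Proj E) (component (lift_nat B E m) f) = Ide B (fob (Proj (rep B ?b)) f)"
    if "f \<in> Obj (Tot (rep B ?b))" for f
    using lift_nat_component(2)[OF m slice[OF that]] that by simp
  show "nat_transformation (Tot (rep B ?b)) (Tot E) (lift_nat B E m)"
  proof (rule nat_transformationI)
    show "component (lift_nat B E m) f
      \<in> hom (Tot E) (fob (NDom (lift_nat B E m)) f) (fob (NCod (lift_nat B E m)) f)"
      if "f \<in> Obj (Tot (rep B ?b))" for f
      using lift_nat_component(1)[OF m slice[OF that]] that sel homD[OF u] by simp
    fix n f g assume "n \<in> hom (Tot (rep B ?b)) f g"
    then have n: "n \<in> hom (slice B ?b) f g" by simp
    then obtain k where k: "n = (k, g)" "k \<in> hom B (Dom B k) (Dom B g)"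
        "g \<in> hom B (Dom B g) ?b" "f = g \<cdot>\<^bsub>B\<^esub> k" by (rule slice_homE)
    note f = D.comp_hom[OF k(2,3), folded k(4)]
    note ug = D.comp_hom[OF k(3) u]
    have ugk: "(?u \<cdot>\<^bsub>B\<^esub> g) \<cdot>\<^bsub>B\<^esub> k = ?u \<cdot>\<^bsub>B\<^esub> f" using D.comp_assoc[OF k(2,3) u] k(4) by simp
    note cf = lift_nat_component[OF m f] and cg = lift_nat_component[OF m k(3)]
    note rx = lift_functor_far[OF x k(2,3), folded k(4)]
      and ry = lift_functor_far[OF y k(2) ug, unfolded ugk]
    have kk: "Ide B (Dom B g) \<cdot>\<^bsub>B\<^esub> k = k \<cdot>\<^bsub>B\<^esub> Ide B (Dom B k)"
      using D.comp_ide_left[OF k(2)] D.comp_ide_right[OF k(2)] by simp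
    have "component (lift_nat B E m) g \<cdot>\<^bsub>Tot E\<^esub> far (lift_functor B E x) (k, g)
      = far (lift_functor B E y) (k, ?u \<cdot>\<^bsub>B\<^esub> g) \<cdot>\<^bsub>Tot E\<^esub> component (lift_nat B E m) f"
    proof (rule lift_functor_eqI[OF y ug])
      show "far (Proj E) (component (lift_nat B E m) g \<cdot>\<^bsub>Tot E\<^esub> far (lift_functor B E x) (k, g))
        = far (Proj E) (far (lift_functor B E y) (k, ?u \<cdot>\<^bsub>B\<^esub> g) \<cdot>\<^bsub>Tot E\<^esub> component (lift_nat B E m) f)"
        using far_comp[OF rx(1) cg(1)] far_comp[OF cf(1) ry(1)] rx(2) ry(2) cf(2) cg(2) kk by simp
      show "Lift E (?u \<cdot>\<^bsub>B\<^esub> g) y \<cdot>\<^bsub>Tot E\<^esub>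
          (component (lift_nat B E m) g \<cdot>\<^bsub>Tot E\<^esub> far (lift_functor B E x) (k, g))
        = Lift E (?u \<cdot>\<^bsub>B\<^esub> g) y \<cdot>\<^bsub>Tot E\<^esub>
          (far (lift_functor B E y) (k, ?u \<cdot>\<^bsub>B\<^esub> g) \<cdot>\<^bsub>Tot E\<^esub> component (lift_nat B E m) f)"
        using C.comp_assoc[OF rx(1) cg(1) lift_at(2)[OF y ug]]
          C.comp_assoc[OF cf(1) ry(1) lift_at(2)[OF y ug]] cg(3) cf(3) ry(3)
          C.comp_assoc[OF rx(1) lift_at(2)[OF x k(3)] m] rx(3) by simp
    qed (use C.comp_hom[OF rx(1) cg(1)] C.comp_hom[OF cf(1) ry(1)] in auto)
    then show "component (lift_nat B E m) g \<cdot>\<^bsub>Tot E\<^esub> far (NDom (lift_nat B E m)) n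
      = far (NCod (lift_nat B E m)) n \<cdot>\<^bsub>Tot E\<^esub> component (lift_nat B E m) f"
      using k(1) sel homD(1)[OF n] homD[OF u] by simp
  qed (use sel fibred_functorD[OF R0] fibred_functorD[OF R1] in auto)
qed

lemma lift_nat_ide:
  assumes x: "x \<in> Obj (Tot E)" and f: "f \<in> hom B c (fob (Proj E) x)"
  shows "component (lift_nat B E (Ide (Tot E) x)) f = Ide (Tot E) (fob (lift_functor B E x) f)"
proof -
  note i = C.ide_hom[OF x] and L = lift_at[OF x f]
  have e: "far (Proj E) (Ide (Tot E) x) \<cdot>\<^bsub>B\<^esub> f = f" using far_ide[OF x] D.comp_ide_left[OF f] by simp
  note c = lift_nat_component[OF i f, unfolded e]
  show ?thesis
    using c far_ide[OF L(4)] L(5) C.comp_ide_right[OF L(2)] C.comp_ide_left[OF L(2)]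
    by (intro lift_functor_eqI[OF x f c(1) C.ide_hom[OF L(4)]]) auto
qed

lemma lift_nat_comp:
  assumes m: "m \<in> hom (Tot E) x y" and n: "n \<in> hom (Tot E) y z" and f: "f \<in> hom B c (fob (Proj E) x)"
  shows "component (lift_nat B E (n \<cdot>\<^bsub>Tot E\<^esub> m)) f
    = component (lift_nat B E n) (far (Proj E) m \<cdot>\<^bsub>B\<^esub> f) \<cdot>\<^bsub>Tot E\<^esub> component (lift_nat B E m) f"
proof -
  have z: "z \<in> Obj (Tot E)" and x: "x \<in> Obj (Tot E)" and y: "y \<in> Obj (Tot E)"
    using hom_objD[OF C.category_axioms n] hom_objD[OF C.category_axioms m] by auto
  note nm = C.comp_hom[OF m n] and um = far_hom[OF m] and un = far_hom[OF n]
  note uf = D.comp_hom[OF f um]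
  note unf = D.comp_hom[OF uf un]
  have e: "far (Proj E) (n \<cdot>\<^bsub>Tot E\<^esub> m) \<cdot>\<^bsub>B\<^esub> f = far (Proj E) n \<cdot>\<^bsub>B\<^esub> (far (Proj E) m \<cdot>\<^bsub>B\<^esub> f)"
    using far_comp[OF m n] D.comp_assoc[OF f um un] by simp
  note cnm = lift_nat_component[OF nm f, unfolded e] and cm = lift_nat_component[OF m f]
    and cn = lift_nat_component[OF n uf]
  have i: "Ide B c \<in> hom B c c" using D.ide_hom hom_objD(1)[OF D.category_axioms f] .
  show ?thesis
    using far_comp[OF cm(1) cn(1)] cnm(2,3) cm(2,3) cn(2,3) D.comp_ide_left[OF i]
      C.comp_assoc[OF cm(1) cn(1) lift_at(2)[OF z unf]]
      C.comp_assoc[OF cm(1) lift_at(2)[OF y uf] n] C.comp_assoc[OF lift_at(2)[OF x f] m n]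
    by (intro lift_functor_eqI[OF z unf cnm(1) C.comp_hom[OF cm(1) cn(1)]]) auto
qed

text \<open>If \<open>m\<close> is cartesian, then the induced arrow compares two cartesian arrows over the same arrow.\<close>

lemma lift_nat_iso:
  assumes m: "m \<in> hom (Tot E) x y" and c: "cartesian_arrow B E m" and f: "f \<in> hom B c (fob (Proj E) x)"
  shows "iso_arrow (Tot E) (component (lift_nat B E m) f)"
proof -
  have x: "x \<in> Obj (Tot E)" and y: "y \<in> Obj (Tot E)"
    using hom_objD[OF C.category_axioms m] by auto
  note L = lift_at[OF x f] and M = lift_at[OF y D.comp_hom[OF f far_hom[OF m]]]
  note k = lift_nat_component[OF m f]
  have "cartesian_arrow B E (m \<cdot>\<^bsub>Tot E\<^esub> Lift E f x)" by (rule cartesian_comp[OF L(1) c L(2) m])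
  then have "cartesian_arrow B E (component (lift_nat B E m) f)"
    using cartesian_cancel[OF M(1) _ k(1) M(2)] k(3) by simp
  then show ?thesis using cartesian_vertical_iso[OF _ k(1)] k(2) L(5) by simp
qed

end

section \<open>Transposition\<close>

locale base_change_pair = base_change B p + E: cloven_fibration "Tot p" E + F: cloven_fibration B F
  for B :: "('bo, 'bm) cat" and p :: "('ao, 'am, 'bo, 'bm) fibration"
    and E :: "('eo, 'em, 'ao, 'am) fibration" and F :: "('fo, 'fm, 'bo, 'bm) fibration"
begin

sublocale S: sum_fibration B p E by unfold_locales

abbreviation SE where "SE \<equiv> sum_fib p E"

abbreviation R where "R x \<equiv> lift_functor A E x"

abbreviation q where "q x \<equiv> fob (Proj E) x"

lemma lift_functor_Y: "x \<in> Obj (Tot E) \<Longrightarrow> fibred_functor B (Y (q x)) SE (R x)"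
  by (intro sum_fibred_functor p.cloven_fibration_axioms p.C.rep_cloven E.cloven_fibration_axioms
      E.lift_functor_fibred)

subsection \<open>The unit\<close>

definition bc_unit where
  "bc_unit = \<lparr>fob = (\<lambda>x \<in> Obj (Tot E). (q x, R x)),
    far = (\<lambda>m \<in> Arr (Tot E). (far (Proj E) m, lift_nat A E m, R (Cod (Tot E) m)))\<rparr>"

lemma bc_unit_fob [simp]: "x \<in> Obj (Tot E) \<Longrightarrow> fob bc_unit x = (q x, R x)"
  by (simp add: bc_unit_def)

lemma bc_unit_far:
  assumes m: "m \<in> hom (Tot E) x y"
  shows "far bc_unit m = (far (Proj E) m, lift_nat A E m, R y)"
    and "(far (Proj E) m, lift_nat A E m, R y) \<in> hom (bc_cat B p SE) (q x, R x) (q y, R y)"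
proof -
  show "far bc_unit m = (far (Proj E) m, lift_nat A E m, R y)"
    using homD[OF m] by (simp add: bc_unit_def)
  have y: "y \<in> Obj (Tot E)" using hom_objD[OF E.C.category_axioms m] by simp
  have "fibred_nat B (Y (q x)) SE (lift_nat A E m)"
    by (intro sum_fibred_nat p.cloven_fibration_axioms p.C.rep_cloven E.cloven_fibration_axioms
        E.lift_nat_fibred[OF m])
  then show "(far (Proj E) m, lift_nat A E m, R y) \<in> hom (bc_cat B p SE) (q x, R x) (q y, R y)"
    using E.lift_nat_sel[OF m] by (intro bc_homI E.far_hom[OF m] lift_functor_Y[OF y]) auto
qed

lemma bc_unit_functor: "cat_functor (Tot E) (bc_cat B p SE) bc_unit"
proof (rule cat_functorI)
  interpret K: category "bc_cat B p SE" by (rule category_bc[OF S.sum_cloven])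
  show "category (Tot E)" "category (bc_cat B p SE)"
    by (rule E.C.category_axioms, rule K.category_axioms)
  show "fob bc_unit \<in> extensional (Obj (Tot E))" "far bc_unit \<in> extensional (Arr (Tot E))"
    by (simp_all add: bc_unit_def)
  show "fob bc_unit x \<in> Obj (bc_cat B p SE)" if "x \<in> Obj (Tot E)" for x
    using that lift_functor_Y[OF that] E.fob_obj[OF that] by simp
  show "far bc_unit m \<in> hom (bc_cat B p SE) (fob bc_unit x) (fob bc_unit y)"
    if m: "m \<in> hom (Tot E) x y" for m x y
    using bc_unit_far[OF m] hom_objD[OF E.C.category_axioms m] by simp
  { fix x assume x: "x \<in> Obj (Tot E)"
    note i = E.C.ide_hom[OF x] and a = E.fob_obj[OF x]
    note h = bc_unit_far[OF i] and k = bc_ide_hom[OF S.sum_cloven a lift_functor_Y[OF x]]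
    have "far bc_unit (Ide (Tot E) x) = Ide (bc_cat B p SE) (q x, R x)"
      unfolding h(1) bc_sel
    proof (rule bc_arr_eqI[OF h(2) k[unfolded bc_sel]])
      show "far (Proj E) (Ide (Tot E) x) = Ide A (q x)" by (rule E.far_ide[OF x])
      fix f assume f: "f \<in> Obj (slice A (q x))"
      show "component (lift_nat A E (Ide (Tot E) x)) f
        = component (id_nt (slice A (q x)) (Tot SE) (R x)) f"
        using E.lift_nat_ide[OF x slice_objD[OF f]] f by simp
    qed
    then show "far bc_unit (Ide (Tot E) x) = Ide (bc_cat B p SE) (fob bc_unit x)" using x by simp }
  { fix m n x y z assume m: "m \<in> hom (Tot E) x y" and n: "n \<in> hom (Tot E) y z"
    note nm = E.C.comp_hom[OF m n] and u = E.far_hom[OF m]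
    note hm = bc_unit_far[OF m] and hn = bc_unit_far[OF n] and hnm = bc_unit_far[OF nm]
    show "far bc_unit (n \<cdot>\<^bsub>Tot E\<^esub> m) = far bc_unit n \<cdot>\<^bsub>bc_cat B p SE\<^esub> far bc_unit m"
      unfolding hm(1) hn(1) hnm(1) bc_sel homD(2)[OF u]
    proof (rule bc_arr_eqI[OF hnm(2)])
      show "(far (Proj E) n \<cdot>\<^bsub>A\<^esub> far (Proj E) m, vcomp (slice A (q x)) (Tot SE)
          (whisker_right (slice A (q x)) (lift_nat A E n) (rep_map A (far (Proj E) m)))
          (lift_nat A E m), R z) \<in> hom (bc_cat B p SE) (q x, R x) (q z, R z)"
        using K.comp_hom[OF hm(2) hn(2)] by (simp add: homD(2)[OF u])
      show "far (Proj E) (n \<cdot>\<^bsub>Tot E\<^esub> m) = far (Proj E) n \<cdot>\<^bsub>A\<^esub> far (Proj E) m"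
        by (rule E.far_comp[OF m n])
      fix f assume f: "f \<in> Obj (slice A (q x))"
      show "component (lift_nat A E (n \<cdot>\<^bsub>Tot E\<^esub> m)) f
        = component (vcomp (slice A (q x)) (Tot SE)
          (whisker_right (slice A (q x)) (lift_nat A E n) (rep_map A (far (Proj E) m)))
          (lift_nat A E m)) f"
        unfolding bc_comp_component[OF u f] using E.lift_nat_comp[OF m n slice_objD[OF f]] by simp
    qed }
qed

lemma bc_unit_fibred: "fibred_functor A E (bc_fib B p SE) bc_unit"
proof (rule fibred_functorI)
  interpret U: cat_functor "Tot E" "bc_cat B p SE" bc_unit by (rule bc_unit_functor)
  show "cat_functor (Tot E) (Tot (bc_fib B p SE)) bc_unit" using U.cat_functor_axioms by simp
  show "cat_functor (Tot E) A (Proj E)" by (rule E.cat_functor_axioms)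
  show "cat_functor (Tot (bc_fib B p SE)) A (Proj (bc_fib B p SE))"
    using bc_proj[OF S.sum_cloven] by simp
  show "fob (Proj (bc_fib B p SE)) (fob bc_unit x) = fob (Proj E) x" if "x \<in> Obj (Tot E)" for x
    using U.fob_obj[OF that] that by simp
  show "far (Proj (bc_fib B p SE)) (far bc_unit m) = far (Proj E) m" if "m \<in> Arr (Tot E)" for m
    using bc_unit_far[OF in_hom[OF that]] homD(1)[OF bc_unit_far(2)[OF in_hom[OF that]]] by simp
  show "cartesian_arrow A (bc_fib B p SE) (far bc_unit m)" if c: "cartesian_arrow A E m" for m
  proof -
    have m: "m \<in> hom (Tot E) (Dom (Tot E) m) (Cod (Tot E) m)"
      using c by (simp add: cartesian_arrow_def in_hom)
    note h = bc_unit_far[OF m]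
    show ?thesis unfolding h(1)
    proof (rule bc_cartesianI[OF S.sum_cloven h(2)])
      show "iso_arrow (Tot SE) (component (lift_nat A E m) f)"
        if "f \<in> Obj (slice A (q (Dom (Tot E) m)))" for f
        using E.lift_nat_iso[OF m c slice_objD[OF that]] by simp
    qed
  qed
qed

text \<open>One triangle identity holds up to the isomorphism given by the chosen lifts of identities.\<close>

definition lift_identities where
  "lift_identities = \<lparr>NDom = comp_func (Tot E) (bc_counit SE) bc_unit, NCod = id_func (Tot E),
    component = (\<lambda>x \<in> Obj (Tot E). Lift E (Ide A (q x)) x)\<rparr>"

lemma lift_identities_sel [simp]:
  "NDom lift_identities = comp_func (Tot E) (bc_counit SE) bc_unit"
  "NCod lift_identities = id_func (Tot E)"
  "x \<in> Obj (Tot E) \<Longrightarrow> component lift_identities x = Lift E (Ide A (q x)) x"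
  by (simp_all add: lift_identities_def)

lemma counit_unit_fibred: "fibred_functor B SE SE (comp_func (Tot E) (bc_counit SE) bc_unit)"
  using fibred_functor_comp[OF sum_fibred_functor[OF p.cloven_fibration_axioms
      E.cloven_fibration_axioms bc_cloven[OF S.sum_cloven] bc_unit_fibred]
      bc_counit_fibred[OF S.sum_cloven]] by simp

lemma counit_unit_fob:
  assumes x: "x \<in> Obj (Tot E)"
  shows "fob (bc_counit SE) (q x, R x) = fob (R x) (Ide A (q x))"
  using bc_counit_fob[of "q x" "R x" SE] lift_functor_Y[OF x] E.fob_obj[OF x] by simp

lemma lift_identities_fibred: "fibred_nat B SE SE lift_identities"
proof (rule fibred_natI)
  show "fibred_functor B SE SE (NDom lift_identities)" using counit_unit_fibred by simp
  show "fibred_functor B SE SE (NCod lift_identities)"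
    using fibred_functor_id[OF S.sum_cloven] by simp
  note L = E.lift_at[OF _ p.C.ide_hom[OF E.fob_obj]]
  show "far (Proj SE) (component lift_identities x) = Ide B (fob (Proj SE) x)"
    if "x \<in> Obj (Tot SE)" for x
    using that L(3)[of x] homD(1)[OF L(2)[of x]] p.far_ide[OF E.fob_obj] by simp
  show "nat_transformation (Tot SE) (Tot SE) lift_identities"
  proof (rule nat_transformationI)
    show "cat_functor (Tot SE) (Tot SE) (NDom lift_identities)"
      "cat_functor (Tot SE) (Tot SE) (NCod lift_identities)"
      using fibred_functorD[OF counit_unit_fibred] cat_functor_id[OF E.C.category_axioms] by auto
    show "component lift_identities \<in> extensional (Obj (Tot SE))" by (simp add: lift_identities_def)
    show "component lift_identities x
      \<in> hom (Tot SE) (fob (NDom lift_identities) x) (fob (NCod lift_identities) x)"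
      if "x \<in> Obj (Tot SE)" for x
      using that L(2)[of x] counit_unit_fob[of x] by simp
    fix m x y assume "m \<in> hom (Tot SE) x y"
    then have m: "m \<in> hom (Tot E) x y" by simp
    have x: "x \<in> Obj (Tot E)" and y: "y \<in> Obj (Tot E)"
      using hom_objD[OF E.C.category_axioms m] by auto
    note u = E.far_hom[OF m] and U = bc_unit_far[OF m]
    note i = p.C.ide_hom[OF E.fob_obj[OF x]] and j = p.C.ide_hom[OF E.fob_obj[OF y]]
    have ui: "far (Proj E) m \<cdot>\<^bsub>A\<^esub> Ide A (q x) = far (Proj E) m" using p.C.comp_ide_right[OF u] .
    have ju: "Ide A (q y) \<cdot>\<^bsub>A\<^esub> far (Proj E) m = far (Proj E) m" using p.C.comp_ide_left[OF u] .
    note c = E.lift_nat_component[OF m i, unfolded ui]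
    note r = E.lift_functor_far[OF y u j, unfolded ju]
    have "Lift E (Ide A (q y)) y \<cdot>\<^bsub>Tot E\<^esub> far (bc_counit SE) (far bc_unit m)
      = m \<cdot>\<^bsub>Tot E\<^esub> Lift E (Ide A (q x)) x"
      unfolding U(1) bc_counit_far(1)[OF U(2)]
      using E.C.comp_assoc[OF c(1) r(1) L(2)[OF y y]] r(3) c(3) by simp
    then show "component lift_identities y \<cdot>\<^bsub>Tot SE\<^esub> far (NDom lift_identities) m
      = far (NCod lift_identities) m \<cdot>\<^bsub>Tot SE\<^esub> component lift_identities x"
      using x y homD(1)[OF m] by simp
  qed
qed

lemma lift_identities_iso:
  assumes x: "x \<in> Obj (Tot E)"
  shows "iso_arrow (Tot E) (component lift_identities x)"
proof -
  note L = E.lift_at[OF x p.C.ide_hom[OF E.fob_obj[OF x]]]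
  show ?thesis using E.cartesian_vertical_iso[OF L(1,2)] L(3,5) x by simp
qed

subsection \<open>The two transposition functors\<close>

text \<open>The functor \<open>g \<mapsto> \<epsilon> \<circ> \<Sigma> g\<close>.\<close>

definition left_transpose where
  "left_transpose = comp_func (Fib_hom A E (bc_fib B p F))
    (post_functor B SE (sum_fib p (bc_fib B p F)) (bc_counit F)) (id_func (Fib_hom A E (bc_fib B p F)))"

lemma left_transpose_fob [simp]:
  "fibred_functor A E (bc_fib B p F) g \<Longrightarrow> fob left_transpose g = comp_func (Tot E) (bc_counit F) g"
  using sum_fibred_functor[OF p.cloven_fibration_axioms E.cloven_fibration_axioms
      bc_cloven[OF F.cloven_fibration_axioms]]
  by (simp add: left_transpose_def)

lemma left_transpose_far [simp]:
  "fibred_nat A E (bc_fib B p F) \<gamma> \<Longrightarrow> far left_transpose \<gamma> = whisker_left (Tot E) (bc_counit F) \<gamma>"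
  using sum_fibred_nat[OF p.cloven_fibration_axioms E.cloven_fibration_axioms
      bc_cloven[OF F.cloven_fibration_axioms]]
  by (simp add: left_transpose_def)

lemma left_transpose_functor: "cat_functor (Fib_hom A E (bc_fib B p F)) (Fib_hom B SE F) left_transpose"
  unfolding left_transpose_def
  by (rule cat_functor_comp[OF sum_functor_on_hom cat_functor_post])
    (auto simp: p.cloven_fibration_axioms E.cloven_fibration_axioms F.cloven_fibration_axioms
      bc_cloven S.sum_cloven sum_fibration.sum_cloven[OF sum_bc] bc_counit_fibred)

text \<open>The functor \<open>h \<mapsto> \<Delta> h \<circ> \<eta>\<close>.\<close>

definition right_transpose where
  "right_transpose = comp_func (Fib_hom B SE F)
    (pre_functor A (bc_fib B p SE) (bc_fib B p F) E bc_unit)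
    \<lparr>fob = (\<lambda>f \<in> Obj (Fib_hom B SE F). bc_map1 B p SE f),
     far = (\<lambda>\<phi> \<in> Arr (Fib_hom B SE F). bc_map2 B p SE \<phi>)\<rparr>"

lemma right_transpose_fob [simp]:
  "fibred_functor B SE F h \<Longrightarrow> fob right_transpose h = comp_func (Tot E) (bc_map1 B p SE h) bc_unit"
  by (simp add: right_transpose_def bc_map1_fibred[OF S.sum_cloven F.cloven_fibration_axioms])

lemma right_transpose_far [simp]:
  "fibred_nat B SE F \<phi> \<Longrightarrow> far right_transpose \<phi> = whisker_right (Tot E) (bc_map2 B p SE \<phi>) bc_unit"
  by (simp add: right_transpose_def bc_map2_fibred[OF S.sum_cloven F.cloven_fibration_axioms])

lemma right_transpose_functor: "cat_functor (Fib_hom B SE F) (Fib_hom A E (bc_fib B p F)) right_transpose"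
  unfolding right_transpose_def
  by (rule cat_functor_comp[OF bc_functor_on_hom cat_functor_pre])
    (auto simp: E.cloven_fibration_axioms F.cloven_fibration_axioms
      bc_cloven S.sum_cloven bc_unit_fibred)

text \<open>By naturality of the counit, transposing \<open>h\<close> twice gives \<open>\<epsilon> \<circ> \<Delta> h \<circ> \<eta> = h \<circ> \<epsilon> \<circ> \<eta>\<close>, which is
  compared with \<open>h\<close> by whiskering the triangle isomorphism.\<close>

definition transpose_counit where
  "transpose_counit = \<lparr>NDom = comp_func (Fib_hom B SE F) left_transpose right_transpose,
    NCod = id_func (Fib_hom B SE F),
    component = (\<lambda>h \<in> Obj (Fib_hom B SE F). whisker_left (Tot E) h lift_identities)\<rparr>"

lemma left_right_transpose:
  assumes h: "fibred_functor B SE F h"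
  shows "comp_func (Tot E) (bc_counit F) (comp_func (Tot E) (bc_map1 B p SE h) bc_unit)
      = comp_func (Tot E) h (comp_func (Tot E) (bc_counit SE) bc_unit)"
    and "fob left_transpose (fob right_transpose h)
      = comp_func (Tot E) h (comp_func (Tot E) (bc_counit SE) bc_unit)"
proof -
  show eq: "comp_func (Tot E) (bc_counit F) (comp_func (Tot E) (bc_map1 B p SE h) bc_unit)
      = comp_func (Tot E) h (comp_func (Tot E) (bc_counit SE) bc_unit)"
    using bc_counit_natural[OF S.sum_cloven F.cloven_fibration_axioms h]
    by (simp add: comp_func_assoc[OF bc_unit_functor, symmetric])
  have "fibred_functor A E (bc_fib B p F) (fob right_transpose h)"
    using cat_functor.fob_obj[OF right_transpose_functor, of h] h by simp
  then show "fob left_transpose (fob right_transpose h)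
      = comp_func (Tot E) h (comp_func (Tot E) (bc_counit SE) bc_unit)"
    using h eq by simp
qed

lemma transpose_counit_iso: "nat_iso (Fib_hom B SE F) (Fib_hom B SE F) transpose_counit"
proof -
  note Fc = F.cloven_fibration_axioms
  interpret D: category "Fib_hom B SE F" by (rule category_Fib_hom[OF S.sum_cloven Fc])
  have w: "whisker_left (Tot E) h lift_identities
      \<in> hom (Fib_hom B SE F) (fob left_transpose (fob right_transpose h)) h"
    if h: "fibred_functor B SE F h" for h
    using fibred_nat_whisker_left[OF lift_identities_fibred h] left_right_transpose(2)[OF h]
      comp_func_id_right[OF fibred_functorD[OF h]] by (simp add: hom_Fib_hom)
  have "nat_transformation (Fib_hom B SE F) (Fib_hom B SE F) transpose_counit"
  proof (rule nat_transformationI)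
    show "cat_functor (Fib_hom B SE F) (Fib_hom B SE F) (NDom transpose_counit)"
      "cat_functor (Fib_hom B SE F) (Fib_hom B SE F) (NCod transpose_counit)"
      by (simp_all add: transpose_counit_def cat_functor_comp[OF right_transpose_functor left_transpose_functor]
          cat_functor_id[OF D.category_axioms])
    show "component transpose_counit \<in> extensional (Obj (Fib_hom B SE F))"
      by (simp add: transpose_counit_def)
    show "component transpose_counit h \<in> hom (Fib_hom B SE F)
      (fob (NDom transpose_counit) h) (fob (NCod transpose_counit) h)"
      if "h \<in> Obj (Fib_hom B SE F)" for h
      using w[of h] that by (simp add: transpose_counit_def)
    fix \<tau> h k assume "\<tau> \<in> hom (Fib_hom B SE F) h k"
    then have \<tau>: "fibred_nat B SE F \<tau>" and hk: "NDom \<tau> = h" "NCod \<tau> = k"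
      by (auto simp: hom_Fib_hom)
    interpret \<tau>: fibred_nat B SE F \<tau> by fact
    interpret l: fibred_nat B SE SE lift_identities by (rule lift_identities_fibred)
    have fh: "fibred_functor B SE F h" and fk: "fibred_functor B SE F k"
      using \<tau>.NDom.fibred_functor_axioms \<tau>.NCod.fibred_functor_axioms hk by auto
    have ut: "fibred_nat A E (bc_fib B p F) (far right_transpose \<tau>)"
      using cat_functor.far_hom[OF right_transpose_functor, of \<tau> h k] \<tau> hk by (simp add: hom_Fib_hom)
    have eq: "vcomp (Tot E) (Tot F) (whisker_left (Tot E) k lift_identities) (far left_transpose (far right_transpose \<tau>))
        = vcomp (Tot E) (Tot F) \<tau> (whisker_left (Tot E) h lift_identities)" (is "?l = ?r")
    proof (rule nt_eqI[of _ "Tot E"])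
      show "NDom ?l = NDom ?r"
        using left_right_transpose(1)[OF fh] hk \<tau> ut by simp
      show "NCod ?l = NCod ?r" using comp_func_id_right[OF fibred_functorD[OF fk]] hk by simp
      fix x assume x: "x \<in> Obj (Tot E)"
      have u: "fob bc_unit x \<in> Obj (bc_cat B p SE)"
        by (rule cat_functor.fob_obj[OF bc_unit_functor x])
      show "component ?l x = component ?r x"
        using \<tau>.naturality[OF l.component_hom, of x] x u ut \<tau> hk
          bc_counit_natural2[OF Fc \<tau> u] by simp
    qed auto
    show "component transpose_counit k \<cdot>\<^bsub>Fib_hom B SE F\<^esub> far (NDom transpose_counit) \<tau>
      = far (NCod transpose_counit) \<tau> \<cdot>\<^bsub>Fib_hom B SE F\<^esub> component transpose_counit h"
      using eq fh fk \<tau> by (simp add: transpose_counit_def)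
  qed
  moreover have "iso_arrow (Fib_hom B SE F) (component transpose_counit h)"
    if "h \<in> Obj (Fib_hom B SE F)" for h
  proof -
    from that interpret h: fibred_functor B SE F h by simp
    have "iso_arrow (Fib_hom B SE F) (whisker_left (Tot E) h lift_identities)"
    proof (rule fibred_nat_iso_arrow[OF Fc])
      show "fibred_nat B SE F (whisker_left (Tot E) h lift_identities)"
        using w[OF h.fibred_functor_axioms] by (simp add: hom_Fib_hom)
      show "iso_arrow (Tot F) (component (whisker_left (Tot E) h lift_identities) x)"
        if "x \<in> Obj (Tot SE)" for x
        using h.far_iso lift_identities_iso that by simp
    qed
    then show ?thesis using that by (simp add: transpose_counit_def)
  qed
  ultimately show ?thesis by (simp add: nat_iso_def)
qed

subsection \<open>The unit isomorphism\<close>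

text \<open>A fibred functor \<open>g\<close> into the base change assigns to an object \<open>x\<close> a functor \<open>e\<^sub>x\<close> out of a slice
  and to an arrow \<open>m : x \<rightarrow> y\<close> over \<open>u\<close> a 2-cell from \<open>e\<^sub>x\<close> to the restriction of \<open>e\<^sub>y\<close> along \<open>u\<close>.\<close>

definition ob_part where "ob_part g x = snd (fob g x)"

definition arr_part where "arr_part g m = fst (snd (far g m))"

text \<open>Transposing \<open>g\<close> twice gives a fibred functor that assigns to \<open>x\<close> the functor sending \<open>f\<close> to the
  value of \<open>e\<^sub>z\<close> at the identity, where \<open>z\<close> is the domain of the chosen lift of \<open>f\<close> at \<open>x\<close>.  The 2-cell
  which \<open>g\<close> assigns to this lift has a component from there to the value of \<open>e\<^sub>x\<close> at \<open>f\<close>, which is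
  invertible because \<open>g\<close> preserves cartesian arrows.\<close>

definition transpose_comparison where
  "transpose_comparison g x = \<lparr>
    NDom = comp_func (slice A (q x)) (comp_func (Tot E) (bc_counit F) g) (R x),
    NCod = ob_part g x,
    component = (\<lambda>f \<in> Obj (slice A (q x)). component (arr_part g (Lift E f x)) (Ide A (Dom A f)))\<rparr>"

definition transpose_unit_inv where
  "transpose_unit_inv g = \<lparr>NDom = fob right_transpose (fob left_transpose g), NCod = g,
    component = (\<lambda>x \<in> Obj (Tot E). (Ide A (q x), transpose_comparison g x, ob_part g x))\<rparr>"

context
  fixes g assumes g: "fibred_functor A E (bc_fib B p F) g"
begin

interpretation g: fibred_functor A E "bc_fib B p F" g by (rule g)
interpretation K: cloven_fibration A "bc_fib B p F" by (rule bc_cloven[OF F.cloven_fibration_axioms])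

lemma fob_parts:
  assumes x: "x \<in> Obj (Tot E)"
  shows "fob g x = (q x, ob_part g x)" and "(q x, ob_part g x) \<in> Obj (bc_cat B p F)"
    and "fibred_functor B (Y (q x)) F (ob_part g x)"
proof -
  have o: "fob g x \<in> Obj (bc_cat B p F)" using g.fob_obj[OF x] by simp
  then have "fst (fob g x) = q x" using g.proj_fob[OF x] by simp
  then show eq: "fob g x = (q x, ob_part g x)" unfolding ob_part_def by (metis prod.collapse)
  show "(q x, ob_part g x) \<in> Obj (bc_cat B p F)" using o eq by simp
  then show "fibred_functor B (Y (q x)) F (ob_part g x)" by simp
qed

lemma far_parts:
  assumes m: "m \<in> hom (Tot E) x y"
  shows "far g m = (far (Proj E) m, arr_part g m, ob_part g y)"
    and "(far (Proj E) m, arr_part g m, ob_part g y)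
      \<in> hom (bc_cat B p F) (q x, ob_part g x) (q y, ob_part g y)"
proof -
  have x: "x \<in> Obj (Tot E)" and y: "y \<in> Obj (Tot E)"
    using hom_objD[OF E.C.category_axioms m] by auto
  have h: "far g m \<in> hom (bc_cat B p F) (q x, ob_part g x) (q y, ob_part g y)"
    using g.far_hom[OF m] fob_parts(1)[OF x] fob_parts(1)[OF y] by simp
  then obtain b t where bt: "far g m = (b, t, ob_part g y)" by (auto simp: bc_hom)
  have "b = far (Proj E) m" using g.proj_far[OF homD(1)[OF m]] homD(1)[OF h] bt by simp
  then show eq: "far g m = (far (Proj E) m, arr_part g m, ob_part g y)"
    using bt by (simp add: arr_part_def)
  show "(far (Proj E) m, arr_part g m, ob_part g y)
      \<in> hom (bc_cat B p F) (q x, ob_part g x) (q y, ob_part g y)" using h eq by simp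
qed

lemma arr_part_comp:
  assumes m: "m \<in> hom (Tot E) x y" and n: "n \<in> hom (Tot E) y z" and f: "f \<in> Obj (slice A (q x))"
  shows "component (arr_part g (n \<cdot>\<^bsub>Tot E\<^esub> m)) f
    = component (arr_part g n) (far (Proj E) m \<cdot>\<^bsub>A\<^esub> f) \<cdot>\<^bsub>Tot F\<^esub> component (arr_part g m) f"
proof -
  note u = E.far_hom[OF m]
  have "far g (n \<cdot>\<^bsub>Tot E\<^esub> m) = far g n \<cdot>\<^bsub>bc_cat B p F\<^esub> far g m" using g.far_comp[OF m n] by simp
  from this[unfolded far_parts(1)[OF E.C.comp_hom[OF m n]] far_parts(1)[OF m] far_parts(1)[OF n]
      bc_sel homD(2)[OF u]]
  have "arr_part g (n \<cdot>\<^bsub>Tot E\<^esub> m) = vcomp (slice A (q x)) (Tot F)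
      (whisker_right (slice A (q x)) (arr_part g n) (rep_map A (far (Proj E) m))) (arr_part g m)"
    by simp
  then show ?thesis using bc_comp_component[OF u f] by simp
qed

lemma counit_arr_part:
  assumes m: "m \<in> hom (Tot E) x y"
  shows "far (bc_counit F) (far g m)
    = far (ob_part g y) (far (Proj E) m, Ide A (q y)) \<cdot>\<^bsub>Tot F\<^esub> component (arr_part g m) (Ide A (q x))"
  using bc_counit_far(1)[OF far_parts(2)[OF m]] far_parts(1)[OF m] by simp

lemma counit_arr_part_vertical:
  assumes m: "m \<in> hom (Tot E) x y" and v: "far (Proj E) m = Ide A (q x)"
  shows "far (bc_counit F) (far g m) = component (arr_part g m) (Ide A (q x))"
proof -
  have x: "x \<in> Obj (Tot E)" and y: "y \<in> Obj (Tot E)"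
    using hom_objD[OF E.C.category_axioms m] by auto
  note D = bc_homD[OF far_parts(2)[OF m, unfolded v]]
  have qy: "q y = q x" using homD(3)[OF D(2)] homD(3)[OF p.C.ide_hom[OF E.fob_obj[OF x]]] by simp
  have "NCod (arr_part g m) = ob_part g y"
    using D(6) precomp_ide[OF E.fob_obj[OF x]] D(3) qy by simp
  then show ?thesis
    using bc_counit_vertical[OF F.cloven_fibration_axioms E.fob_obj[OF x] D(4)] far_parts(1)[OF m] v
    by simp
qed

lemma comparison_component:
  assumes x: "x \<in> Obj (Tot E)" and f: "f \<in> hom A c (q x)"
  shows "component (transpose_comparison g x) f = component (arr_part g (Lift E f x)) (Ide A c)"
    and "fob (NDom (transpose_comparison g x)) f = fob (ob_part g (fob (R x) f)) (Ide A c)"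
    and "component (arr_part g (Lift E f x)) (Ide A c)
      \<in> hom (Tot F) (fob (ob_part g (fob (R x) f)) (Ide A c)) (fob (ob_part g x) f)"
    and "iso_arrow (Tot F) (component (arr_part g (Lift E f x)) (Ide A c))"
    and "far (Proj F) (component (arr_part g (Lift E f x)) (Ide A c)) = Ide B (fob (Proj p) c)"
proof -
  note L = E.lift_at[OF x f]
  have fO: "f \<in> Obj (slice A (q x))" using homD[OF f] by simp
  show "component (transpose_comparison g x) f = component (arr_part g (Lift E f x)) (Ide A c)"
    using fO homD[OF f] by (simp add: transpose_comparison_def)
  have c: "c \<in> Obj A" using hom_objD[OF p.C.category_axioms f] by simp
  note i = slice_id_obj[OF p.C.category_axioms c]
  show "fob (NDom (transpose_comparison g x)) f = fob (ob_part g (fob (R x) f)) (Ide A c)"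
    using fO L(4,5) fob_parts[OF L(4)] by (simp add: transpose_comparison_def del: bc_obj)
  note h = far_parts[OF L(2), unfolded L(3,5)]
  show "component (arr_part g (Lift E f x)) (Ide A c)
      \<in> hom (Tot F) (fob (ob_part g (fob (R x) f)) (Ide A c)) (fob (ob_part g x) f)"
    using bc_component_hom[OF h(2) i(1)] p.C.comp_ide_right[OF f] by simp
  show "iso_arrow (Tot F) (component (arr_part g (Lift E f x)) (Ide A c))"
    using bc_cartesianD[OF F.cloven_fibration_axioms h(2) _ i(1)] g.preserves_cartesian[OF L(1)] h(1)
    by simp
  show "far (Proj F) (component (arr_part g (Lift E f x)) (Ide A c)) = Ide B (fob (Proj p) c)"
    using fibred_natD(4)[OF bc_homD(4)[OF h(2)], of "Ide A c"] i homD(2)[OF i(2)] by simp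
qed

text \<open>Naturality along \<open>k\<close>: the chosen lift of \<open>f \<cdot> k\<close> is that of \<open>f\<close> after the arrow \<open>l\<close> over \<open>k\<close> between
  the domains.  Applying \<open>g\<close> to this equation leaves the naturality of the 2-cell of the lift of \<open>f\<close>.\<close>

lemma comparison_fibred:
  assumes x: "x \<in> Obj (Tot E)"
  shows "fibred_nat B (Y (q x)) F (transpose_comparison g x)"
proof (rule fibred_natI)
  have cg: "fibred_functor B SE F (comp_func (Tot E) (bc_counit F) g)"
    using cat_functor.fob_obj[OF left_transpose_functor, of g] g by simp
  show N: "fibred_functor B (Y (q x)) F (NDom (transpose_comparison g x))"
    using fibred_functor_comp[OF lift_functor_Y[OF x] cg] by (simp add: transpose_comparison_def)
  show M: "fibred_functor B (Y (q x)) F (NCod (transpose_comparison g x))"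
    using fob_parts[OF x] by (simp add: transpose_comparison_def)
  have slice: "f \<in> hom A (Dom A f) (q x)" if "f \<in> Obj (Tot (Y (q x)))" for f
    using that by (simp add: hom_def)
  show "far (Proj F) (component (transpose_comparison g x) f) = Ide B (fob (Proj (Y (q x))) f)"
    if "f \<in> Obj (Tot (Y (q x)))" for f
    using comparison_component(1,5)[OF x slice[OF that]] that by simp
  interpret e: fibred_functor B "Y (q x)" F "ob_part g x" by (rule fob_parts(3)[OF x])
  show "nat_transformation (Tot (Y (q x))) (Tot F) (transpose_comparison g x)"
  proof (rule nat_transformationI)
    show "component (transpose_comparison g x) \<in> extensional (Obj (Tot (Y (q x))))"
      by (simp add: transpose_comparison_def)
    have cod: "NCod (transpose_comparison g x) = ob_part g x" by (simp add: transpose_comparison_def)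
    show "component (transpose_comparison g x) f
      \<in> hom (Tot F) (fob (NDom (transpose_comparison g x)) f) (fob (NCod (transpose_comparison g x)) f)"
      if "f \<in> Obj (Tot (Y (q x)))" for f
      using comparison_component(1-3)[OF x slice[OF that]] cod by simp
    fix n h f assume "n \<in> hom (Tot (Y (q x))) h f"
    then have n: "n \<in> hom (slice A (q x)) h f" by simp
    then obtain k where k: "n = (k, f)" "k \<in> hom A (Dom A k) (Dom A f)"
        "f \<in> hom A (Dom A f) (q x)" "h = f \<cdot>\<^bsub>A\<^esub> k" by (rule slice_homE)
    let ?c = "Dom A f" and ?d = "Dom A k" and ?o = "Comp (Tot F)"
    have c: "?c \<in> Obj A" and d: "?d \<in> Obj A" using hom_objD[OF p.C.category_axioms k(2)] by auto
    note i = slice_id_obj[OF p.C.category_axioms c] and j = slice_id_obj[OF p.C.category_axioms d]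
    note hh = p.C.comp_hom[OF k(2,3), folded k(4)]
    let ?l = "far (R x) (k, f)"
    note l = E.lift_functor_far[OF x k(2,3), folded k(4)]
    note L = E.lift_at[OF x k(3)] and M = E.lift_at[OF x hh]
    note P = far_parts[OF L(2), unfolded L(3,5)]
    note Q = far_parts[OF l(1), unfolded l(2) M(5) L(5)]
    interpret s: fibred_nat B "Y ?c" F "arr_part g (Lift E f x)" by (rule bc_homD(4)[OF P(2)])
    have kO: "k \<in> Obj (slice A ?c)" using homD[OF k(2)] by simp
    have ki: "(k, Ide A ?c) \<in> hom (slice A ?c) k (Ide A ?c)"
      using slice_homI[OF k(2) i(2)] p.C.comp_ide_left[OF k(2)] by simp
    \<comment> \<open>Naturality of the 2-cell of the chosen lift along \<open>k\<close>, seen as an arrow to the identity.\<close>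
    have "far (rep_map A f) (k, Ide A ?c) = (k, f)"
      using homD(1)[OF ki] p.C.comp_ide_right[OF k(3)] by simp
    then have nat: "?o (component (arr_part g (Lift E f x)) (Ide A ?c))
        (far (ob_part g (fob (R x) f)) (k, Ide A ?c))
      = ?o (far (ob_part g x) (k, f)) (component (arr_part g (Lift E f x)) k)"
      using s.naturality[of "(k, Ide A ?c)" k "Ide A ?c"] ki homD(1)[OF ki] bc_homD(5,6)[OF P(2)]
      by (simp del: slice_simps(2))
    have comp: "component (arr_part g (Lift E h x)) (Ide A ?d)
      = ?o (component (arr_part g (Lift E f x)) k) (component (arr_part g ?l) (Ide A ?d))"
      using arr_part_comp[OF l(1) L(2), of "Ide A ?d"] l(2,3) M(5) j p.C.comp_ide_right[OF k(2)]
      by (simp del: slice_simps(1))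
    have eps: "far (NDom (transpose_comparison g x)) n
      = ?o (far (ob_part g (fob (R x) f)) (k, Ide A ?c)) (component (arr_part g ?l) (Ide A ?d))"
      using counit_arr_part[OF l(1), unfolded l(2) M(5) L(5)] k(1) homD(1)[OF n] homD(1)[OF l(1)]
      by (simp add: transpose_comparison_def del: slice_simps)
    have h1: "component (arr_part g ?l) (Ide A ?d)
      \<in> hom (Tot F) (fob (ob_part g (fob (R x) h)) (Ide A ?d)) (fob (ob_part g (fob (R x) f)) k)"
      using bc_component_hom[OF Q(2) j(1)] p.C.comp_ide_right[OF k(2)] by simp
    have h2: "far (ob_part g (fob (R x) f)) (k, Ide A ?c)
      \<in> hom (Tot F) (fob (ob_part g (fob (R x) f)) k) (fob (ob_part g (fob (R x) f)) (Ide A ?c))"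
      using bc_counit_far(4)[OF Q(2)] .
    have h3: "component (arr_part g (Lift E f x)) (Ide A ?c)
      \<in> hom (Tot F) (fob (ob_part g (fob (R x) f)) (Ide A ?c)) (fob (ob_part g x) f)"
      by (rule comparison_component(3)[OF x k(3)])
    have h4: "component (arr_part g (Lift E f x)) k
      \<in> hom (Tot F) (fob (ob_part g (fob (R x) f)) k) (fob (ob_part g x) h)"
      using bc_component_hom[OF P(2) kO] k(4) by simp
    have h5: "far (ob_part g x) (k, f) \<in> hom (Tot F) (fob (ob_part g x) h) (fob (ob_part g x) f)"
      using e.far_hom[of n h f] n k(1) by simp
    have "?o (component (transpose_comparison g x) f) (far (NDom (transpose_comparison g x)) n)
      = ?o (far (ob_part g x) n) (component (transpose_comparison g x) h)"
      unfolding comparison_component(1)[OF x k(3)] comparison_component(1)[OF x hh] eps comp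
      using F.C.comp_assoc[OF h1 h2 h3] F.C.comp_assoc[OF h1 h4 h5] nat k(1) by simp
    then show "?o (component (transpose_comparison g x) f) (far (NDom (transpose_comparison g x)) n)
      = ?o (far (NCod (transpose_comparison g x)) n) (component (transpose_comparison g x) h)"
      using cod by simp
  qed (use fibred_functorD[OF N] fibred_functorD[OF M] in auto)
qed

lemma right_left_transpose_fob:
  assumes x: "x \<in> Obj (Tot E)"
  shows "fob (fob right_transpose (fob left_transpose g)) x = (q x, NDom (transpose_comparison g x))"
proof -
  have cg: "fibred_functor B SE F (comp_func (Tot E) (bc_counit F) g)"
    using cat_functor.fob_obj[OF left_transpose_functor, of g] g by simp
  show ?thesis
    using x cg g lift_functor_Y[OF x] E.fob_obj[OF x] by (simp add: transpose_comparison_def)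
qed

lemma unit_inv_component:
  assumes x: "x \<in> Obj (Tot E)"
  shows "component (transpose_unit_inv g) x = (Ide A (q x), transpose_comparison g x, ob_part g x)"
    and "(Ide A (q x), transpose_comparison g x, ob_part g x)
      \<in> hom (bc_cat B p F) (q x, NDom (transpose_comparison g x)) (q x, ob_part g x)"
    and "iso_arrow (bc_cat B p F) (Ide A (q x), transpose_comparison g x, ob_part g x)"
proof -
  show "component (transpose_unit_inv g) x = (Ide A (q x), transpose_comparison g x, ob_part g x)"
    using x by (simp add: transpose_unit_inv_def)
  have "NCod (transpose_comparison g x) = ob_part g x" by (simp add: transpose_comparison_def)
  then show h: "(Ide A (q x), transpose_comparison g x, ob_part g x)
      \<in> hom (bc_cat B p F) (q x, NDom (transpose_comparison g x)) (q x, ob_part g x)"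
    using bc_vertical_hom[OF E.fob_obj[OF x] comparison_fibred[OF x]] by simp
  have cart: "cartesian_arrow A (bc_fib B p F) (Ide A (q x), transpose_comparison g x, ob_part g x)"
  proof (rule bc_cartesianI[OF F.cloven_fibration_axioms h])
    fix f assume f: "f \<in> Obj (slice A (q x))"
    show "iso_arrow (Tot F) (component (transpose_comparison g x) f)"
      using comparison_component(1,4)[OF x slice_objD[OF f]] by simp
  qed
  have "(Ide A (q x), transpose_comparison g x, ob_part g x)
      \<in> hom (Tot (bc_fib B p F)) (q x, NDom (transpose_comparison g x)) (q x, ob_part g x)"
    using h by simp
  from K.cartesian_vertical_iso[OF cart this]
  show "iso_arrow (bc_cat B p F) (Ide A (q x), transpose_comparison g x, ob_part g x)"
    using hom_objD(1)[OF category_bc[OF F.cloven_fibration_axioms] h] homD(1)[OF h] by simp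
qed

text \<open>Naturality in \<open>x\<close> is the image under \<open>g\<close> of the equation that defines the arrow induced by \<open>m\<close>
  between the domains of chosen lifts.\<close>

lemma unit_inv_fibred: "fibred_nat A E (bc_fib B p F) (transpose_unit_inv g)"
proof (rule fibred_natI)
  note Fc = F.cloven_fibration_axioms
  have cg: "fibred_functor B SE F (comp_func (Tot E) (bc_counit F) g)"
    using cat_functor.fob_obj[OF left_transpose_functor, of g] g by simp
  let ?rl = "fob right_transpose (fob left_transpose g)"
  have dom: "NDom (transpose_unit_inv g) = ?rl" and cod: "NCod (transpose_unit_inv g) = g"
    by (simp_all add: transpose_unit_inv_def)
  have rl: "fibred_functor A E (bc_fib B p F) ?rl"
    using cat_functor.fob_obj[OF right_transpose_functor, of "fob left_transpose g"] cg g by simp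
  then show "fibred_functor A E (bc_fib B p F) (NDom (transpose_unit_inv g))" using dom by simp
  show "fibred_functor A E (bc_fib B p F) (NCod (transpose_unit_inv g))" using g cod by simp
  show "far (Proj (bc_fib B p F)) (component (transpose_unit_inv g) x) = Ide A (q x)"
    if "x \<in> Obj (Tot E)" for x
    using unit_inv_component[OF that] homD(1)[OF unit_inv_component(2)[OF that]] by simp
  show "nat_transformation (Tot E) (Tot (bc_fib B p F)) (transpose_unit_inv g)"
  proof (rule nat_transformationI)
    show "cat_functor (Tot E) (Tot (bc_fib B p F)) (NDom (transpose_unit_inv g))"
      "cat_functor (Tot E) (Tot (bc_fib B p F)) (NCod (transpose_unit_inv g))"
      using fibred_functorD[OF rl] g.cat_functor_axioms dom cod by auto
    show "component (transpose_unit_inv g) \<in> extensional (Obj (Tot E))"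
      by (simp add: transpose_unit_inv_def)
    show "component (transpose_unit_inv g) x \<in> hom (Tot (bc_fib B p F))
        (fob (NDom (transpose_unit_inv g)) x) (fob (NCod (transpose_unit_inv g)) x)"
      if x: "x \<in> Obj (Tot E)" for x
      unfolding dom cod right_left_transpose_fob[OF x] fob_parts(1)[OF x]
      using unit_inv_component(1,2)[OF x] by simp
    fix m x y assume m: "m \<in> hom (Tot E) x y"
    have x: "x \<in> Obj (Tot E)" and y: "y \<in> Obj (Tot E)"
      using hom_objD[OF E.C.category_axioms m] by auto
    note u = E.far_hom[OF m] and i = p.C.ide_hom[OF E.fob_obj[OF x]]
    note U = bc_unit_far[OF m] and P = far_parts[OF m]
    note ux = unit_inv_component[OF x] and uy = unit_inv_component[OF y]
    let ?cg = "comp_func (Tot E) (bc_counit F) g"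
    have cgS: "fibred_functor B SE F ?cg" using cg by simp
    note M = bc_map1_hom[OF cgS U(2)]
    let ?w = "whisker_left (slice A (q x)) ?cg (lift_nat A E m)"
    have rlm: "far ?rl m = (far (Proj E) m, ?w, NDom (transpose_comparison g y))"
      using M(1) U(1) homD(1)[OF m] g cg by (simp add: transpose_comparison_def)
    have Mh: "(far (Proj E) m, ?w, NDom (transpose_comparison g y)) \<in> hom (bc_cat B p F)
        (q x, NDom (transpose_comparison g x)) (q y, NDom (transpose_comparison g y))"
      using M(2) by (simp add: transpose_comparison_def)
    have "(Ide A (q y), transpose_comparison g y, ob_part g y) \<cdot>\<^bsub>bc_cat B p F\<^esub> far ?rl m
      = far g m \<cdot>\<^bsub>bc_cat B p F\<^esub> (Ide A (q x), transpose_comparison g x, ob_part g x)"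
      unfolding rlm P(1) bc_sel homD(2)[OF u] homD(2)[OF i]
    proof (rule bc_arr_eqI)
      show "(Ide A (q y) \<cdot>\<^bsub>A\<^esub> far (Proj E) m, vcomp (slice A (q x)) (Tot F)
          (whisker_right (slice A (q x)) (transpose_comparison g y) (rep_map A (far (Proj E) m))) ?w,
          ob_part g y) \<in> hom (bc_cat B p F) (q x, NDom (transpose_comparison g x)) (q y, ob_part g y)"
        using bc_comp_hom[OF Fc Mh uy(2)] by (simp add: homD(2)[OF u])
      show "(far (Proj E) m \<cdot>\<^bsub>A\<^esub> Ide A (q x), vcomp (slice A (q x)) (Tot F)
          (whisker_right (slice A (q x)) (arr_part g m) (rep_map A (Ide A (q x))))
          (transpose_comparison g x), ob_part g y)
          \<in> hom (bc_cat B p F) (q x, NDom (transpose_comparison g x)) (q y, ob_part g y)"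
        using bc_comp_hom[OF Fc ux(2) P(2)] by (simp add: homD(2)[OF i])
      show "Ide A (q y) \<cdot>\<^bsub>A\<^esub> far (Proj E) m = far (Proj E) m \<cdot>\<^bsub>A\<^esub> Ide A (q x)"
        using p.C.comp_ide_left[OF u] p.C.comp_ide_right[OF u] by simp
      fix f assume fO: "f \<in> Obj (slice A (q x))"
      note f = slice_objD[OF fO]
      let ?c = "Dom A f" and ?o = "Comp (Tot F)" and ?uf = "far (Proj E) m \<cdot>\<^bsub>A\<^esub> f"
      note uf = p.C.comp_hom[OF f u]
      have c: "?c \<in> Obj A" using hom_objD[OF p.C.category_axioms f] by simp
      note j = slice_id_obj[OF p.C.category_axioms c]
      note L = E.lift_at[OF x f] and N = E.lift_at[OF y uf]
      note mf = E.lift_nat_component[OF m f]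
      let ?mf = "component (lift_nat A E m) f"
      have eps: "component ?w f = component (arr_part g ?mf) (Ide A ?c)"
        using counit_arr_part_vertical[OF mf(1)] mf(2) L(5) fO homD(1)[OF mf(1)]
        by (simp del: slice_simps(1))
      have 1: "?o (component (arr_part g (Lift E ?uf y)) (Ide A ?c)) (component (arr_part g ?mf) (Ide A ?c))
        = component (arr_part g (Lift E ?uf y \<cdot>\<^bsub>Tot E\<^esub> ?mf)) (Ide A ?c)"
        using arr_part_comp[OF mf(1) N(2), of "Ide A ?c"] L(5) j mf(2) p.C.comp_ide_left[OF j(2)]
        by (simp del: slice_simps(1))
      have 2: "?o (component (arr_part g m) f) (component (arr_part g (Lift E f x)) (Ide A ?c))
        = component (arr_part g (m \<cdot>\<^bsub>Tot E\<^esub> Lift E f x)) (Ide A ?c)"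
        using arr_part_comp[OF L(2) m, of "Ide A ?c"] L(3,5) j p.C.comp_ide_right[OF f]
        by (simp del: slice_simps(1))
      show "component (vcomp (slice A (q x)) (Tot F)
          (whisker_right (slice A (q x)) (transpose_comparison g y) (rep_map A (far (Proj E) m))) ?w) f
        = component (vcomp (slice A (q x)) (Tot F)
          (whisker_right (slice A (q x)) (arr_part g m) (rep_map A (Ide A (q x))))
          (transpose_comparison g x)) f"
        unfolding bc_comp_component[OF u fO] bc_comp_component[OF i fO] p.C.comp_ide_left[OF f]
          comparison_component(1)[OF x f] comparison_component(1)[OF y uf] eps 1 2 mf(3) ..
    qed
    then show "component (transpose_unit_inv g) y \<cdot>\<^bsub>Tot (bc_fib B p F)\<^esub> far (NDom (transpose_unit_inv g)) m
      = far (NCod (transpose_unit_inv g)) m \<cdot>\<^bsub>Tot (bc_fib B p F)\<^esub> component (transpose_unit_inv g) x"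
      using ux(1) uy(1) dom cod by simp
  qed
qed

lemma unit_inv_iso: "iso_arrow (Fib_hom A E (bc_fib B p F)) (transpose_unit_inv g)"
  using fibred_nat_iso_arrow[OF K.cloven_fibration_axioms unit_inv_fibred] unit_inv_component(1,3)
  by simp

end


definition transpose_unit where
  "transpose_unit = \<lparr>NDom = comp_func (Fib_hom A E (bc_fib B p F)) right_transpose left_transpose,
    NCod = id_func (Fib_hom A E (bc_fib B p F)),
    component = (\<lambda>g \<in> Obj (Fib_hom A E (bc_fib B p F)). transpose_unit_inv g)\<rparr>"

text \<open>Naturality in \<open>g\<close> follows from that of each \<open>\<gamma>\<close> at the chosen lifts.\<close>

lemma transpose_unit_natural:
  assumes \<gamma>: "fibred_nat A E (bc_fib B p F) \<gamma>"
  shows "vcomp (Tot E) (bc_cat B p F) (transpose_unit_inv (NCod \<gamma>)) (far right_transpose (far left_transpose \<gamma>))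
    = vcomp (Tot E) (bc_cat B p F) \<gamma> (transpose_unit_inv (NDom \<gamma>))"
    (is "?l = ?r")
proof (rule nt_eqI[of _ "Tot E"])
  note Fc = F.cloven_fibration_axioms
  interpret \<gamma>: fibred_nat A E "bc_fib B p F" \<gamma> by fact
  let ?g = "NDom \<gamma>" and ?h = "NCod \<gamma>" and ?o = "Comp (Tot F)"
  note g = \<gamma>.NDom.fibred_functor_axioms and h = \<gamma>.NCod.fibred_functor_axioms
  interpret bg: category "bc_cat B p F" by (rule category_bc[OF Fc])
  have cg: "fibred_nat B SE F (whisker_left (Tot E) (bc_counit F) \<gamma>)"
    using cat_functor.far_hom[OF left_transpose_functor, of \<gamma> ?g ?h] \<gamma> by (simp add: hom_Fib_hom)
  show "NDom ?l = NDom ?r"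
    using cg \<gamma> g fibred_natD(2)[OF cg]
    by (simp add: transpose_unit_inv_def)
  show "NCod ?l = NCod ?r" by (simp add: transpose_unit_inv_def)
  fix x assume x: "x \<in> Obj (Tot E)"
  note i = p.C.ide_hom[OF E.fob_obj[OF x]]
  note ug = unit_inv_component[OF g x] and uh = unit_inv_component[OF h x]
  have ghom: "component \<gamma> y \<in> hom (bc_cat B p F) (q y, ob_part ?g y) (q y, ob_part ?h y)"
    if "y \<in> Obj (Tot E)" for y
    using \<gamma>.component_hom[OF that] fob_parts(1)[OF g that] fob_parts(1)[OF h that] by simp
  have vert: "component \<gamma> y = (Ide A (q y), fst (snd (component \<gamma> y)), ob_part ?h y)"
    if y: "y \<in> Obj (Tot E)" for y
  proof -
    obtain b t where bt: "component \<gamma> y = (b, t, ob_part ?h y)" using ghom[OF y] by (auto simp: bc_hom)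
    moreover have "b = Ide A (q y)" using \<gamma>.vertical[OF y] homD(1)[OF ghom[OF y]] bt by simp
    ultimately show ?thesis by simp
  qed
  define r where "r y = fst (snd (component \<gamma> y))" for y
  note vert = vert[folded r_def]
  have rN: "fibred_nat B (Y (q y)) F (r y)" and rcod: "NCod (r y) = ob_part ?h y"
    if y: "y \<in> Obj (Tot E)" for y
    using bc_homD[OF ghom[OF y, unfolded vert[OF y]]] precomp_ide[OF E.fob_obj[OF y]] by auto
  have eps: "far (bc_counit F) (component \<gamma> y) = component (r y) (Ide A (q y))"
    if y: "y \<in> Obj (Tot E)" for y
    using bc_counit_vertical[OF Fc E.fob_obj[OF y] rN[OF y]] rcod[OF y] vert[OF y] by simp
  let ?w = "whisker_right (slice A (q x)) (whisker_left (Tot E) (bc_counit F) \<gamma>) (R x)"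
  have u: "(q x, R x) \<in> Obj (bc_cat B p SE)"
    using lift_functor_Y[OF x] E.fob_obj[OF x] by simp
  have dom: "component (far right_transpose (far left_transpose \<gamma>)) x
    = (Ide A (q x), ?w, NDom (transpose_comparison ?h x))"
    using x \<gamma> cg u by (simp add: transpose_comparison_def del: bc_obj)
  have wh: "(Ide A (q x), ?w, NDom (transpose_comparison ?h x))
      \<in> hom (bc_cat B p F) (q x, NDom (transpose_comparison ?g x)) (q x, NDom (transpose_comparison ?h x))"
    using bc_vertical_hom[OF E.fob_obj[OF x] whisker_Y[OF lift_functor_Y[OF x] cg]]
    by (simp add: transpose_comparison_def)
  note rx = ghom[OF x, unfolded vert[OF x]]
  have "(Ide A (q x), transpose_comparison ?h x, ob_part ?h x) \<cdot>\<^bsub>bc_cat B p F\<^esub>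
      (Ide A (q x), ?w, NDom (transpose_comparison ?h x))
    = (Ide A (q x), r x, ob_part ?h x) \<cdot>\<^bsub>bc_cat B p F\<^esub>
      (Ide A (q x), transpose_comparison ?g x, ob_part ?g x)"
    unfolding bc_sel homD(2)[OF i]
  proof (rule bc_arr_eqI)
    show "(Ide A (q x) \<cdot>\<^bsub>A\<^esub> Ide A (q x), vcomp (slice A (q x)) (Tot F) (whisker_right (slice A (q x))
        (transpose_comparison ?h x) (rep_map A (Ide A (q x)))) ?w, ob_part ?h x)
        \<in> hom (bc_cat B p F) (q x, NDom (transpose_comparison ?g x)) (q x, ob_part ?h x)"
      using bc_comp_hom[OF Fc wh uh(2)] by (simp add: homD(2)[OF i])
    show "(Ide A (q x) \<cdot>\<^bsub>A\<^esub> Ide A (q x), vcomp (slice A (q x)) (Tot F) (whisker_right (slice A (q x))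
        (r x) (rep_map A (Ide A (q x)))) (transpose_comparison ?g x), ob_part ?h x)
        \<in> hom (bc_cat B p F) (q x, NDom (transpose_comparison ?g x)) (q x, ob_part ?h x)"
      using bc_comp_hom[OF Fc ug(2) rx] by (simp add: homD(2)[OF i])
    fix f assume fO: "f \<in> Obj (slice A (q x))"
    note f = slice_objD[OF fO]
    have c: "Dom A f \<in> Obj A" using hom_objD[OF p.C.category_axioms f] by simp
    note j = slice_id_obj[OF p.C.category_axioms c]
    note L = E.lift_at[OF x f]
    note Pg = far_parts[OF g L(2), unfolded L(3,5)] and Ph = far_parts[OF h L(2), unfolded L(3,5)]
    have w: "component ?w f = component (r (fob (R x) f)) (Ide A (Dom A f))"
      using eps[OF L(4)] L(4,5) fO by (simp del: slice_simps(1))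
    \<comment> \<open>Naturality at the chosen lift of \<open>f\<close>, read off at the identity.\<close>
    have "(Ide A (q x), r x, ob_part ?h x) \<cdot>\<^bsub>bc_cat B p F\<^esub> (f, arr_part ?g (Lift E f x), ob_part ?g x)
      = (f, arr_part ?h (Lift E f x), ob_part ?h x) \<cdot>\<^bsub>bc_cat B p F\<^esub>
        (Ide A (Dom A f), r (fob (R x) f), ob_part ?h (fob (R x) f))"
      using \<gamma>.naturality[OF L(2)] vert[OF x] vert[OF L(4)] Pg(1) Ph(1) L(5) by (simp del: bc_sel)
    from arg_cong[OF this[unfolded bc_sel homD(2)[OF j(2)]],
        of "\<lambda>m. component (fst (snd m)) (Ide A (Dom A f))"]
    have "?o (component (r x) f) (component (arr_part ?g (Lift E f x)) (Ide A (Dom A f)))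
      = ?o (component (arr_part ?h (Lift E f x)) (Ide A (Dom A f)))
        (component (r (fob (R x) f)) (Ide A (Dom A f)))"
      unfolding snd_conv fst_conv bc_comp_component[OF f j(1)] bc_comp_component[OF j(2) j(1)]
        p.C.comp_ide_right[OF f] p.C.comp_ide_right[OF j(2)] .
    then show "component (vcomp (slice A (q x)) (Tot F) (whisker_right (slice A (q x))
          (transpose_comparison ?h x) (rep_map A (Ide A (q x)))) ?w) f
        = component (vcomp (slice A (q x)) (Tot F) (whisker_right (slice A (q x))
          (r x) (rep_map A (Ide A (q x)))) (transpose_comparison ?g x)) f"
      unfolding bc_comp_component[OF i fO] p.C.comp_ide_left[OF f] w
        comparison_component(1)[OF g x f] comparison_component(1)[OF h x f] by (rule sym)
  qed (rule refl)
  then show "component ?l x = component ?r x"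
    using x dom ug(1) uh(1) vert[OF x] by (simp del: bc_sel)
qed auto

lemma transpose_unit_iso:
  "nat_iso (Fib_hom A E (bc_fib B p F)) (Fib_hom A E (bc_fib B p F)) transpose_unit"
proof -
  note Fc = F.cloven_fibration_axioms
  let ?H = "Fib_hom A E (bc_fib B p F)"
  have "nat_transformation ?H ?H transpose_unit"
  proof (rule nat_transformationI)
    show "cat_functor ?H ?H (NDom transpose_unit)" "cat_functor ?H ?H (NCod transpose_unit)"
      using cat_functor_comp[OF left_transpose_functor right_transpose_functor]
        cat_functor_id[OF category_Fib_hom[OF E.cloven_fibration_axioms bc_cloven[OF Fc]]]
      by (simp_all add: transpose_unit_def)
    show "component transpose_unit \<in> extensional (Obj ?H)" by (simp add: transpose_unit_def)
    show "component transpose_unit g \<in> hom ?H (fob (NDom transpose_unit) g) (fob (NCod transpose_unit) g)"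
      if "g \<in> Obj ?H" for g
      using that unit_inv_fibred[of g]
      by (simp add: transpose_unit_def hom_Fib_hom) (simp add: transpose_unit_inv_def)
    fix \<gamma> g h assume "\<gamma> \<in> hom ?H g h"
    then have \<gamma>: "fibred_nat A E (bc_fib B p F) \<gamma>" "NDom \<gamma> = g" "NCod \<gamma> = h"
      by (auto simp: hom_Fib_hom)
    then show "component transpose_unit h \<cdot>\<^bsub>?H\<^esub> far (NDom transpose_unit) \<gamma>
      = far (NCod transpose_unit) \<gamma> \<cdot>\<^bsub>?H\<^esub> component transpose_unit g"
      using transpose_unit_natural[OF \<gamma>(1)] fibred_natD(2,3)[OF \<gamma>(1)]
      by (simp add: transpose_unit_def del: left_transpose_far right_transpose_far)
  qed
  then show ?thesis
    using unit_inv_iso by (simp add: nat_iso_def) (simp add: transpose_unit_def)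
qed

theorem transpose_equivalence:
  "cat_equivalence (Fib_hom A E (bc_fib B p F)) (Fib_hom B SE F) left_transpose"
  by (rule cat_equivalenceI[OF left_transpose_functor right_transpose_functor
        transpose_unit_iso _ _ transpose_counit_iso])
    (simp_all add: transpose_unit_def transpose_counit_def)

end

section \<open>Pseudo-naturality\<close>

subsection \<open>Functoriality of the categories of fibred functors\<close>

text \<open>Splitting the action of a pair of 1-cells into its two halves makes it a composite of functors.\<close>

lemma hom_act1_eq:
  assumes "cloven_fibration B E" and "cloven_fibration B F" and "cloven_fibration B E'"
    and u: "fibred_functor B E' E u"
  shows "hom_act1 B E F E' u v
    = comp_func (Fib_hom B E F) (post_functor B E' F v) (pre_functor B E F E' u)"
    (is "?l = ?r")
proof -
  have "fob ?l g = fob ?r g" for g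
    by (cases "g \<in> Obj (Fib_hom B E F)")
      (simp_all add: hom_act1_def comp_func_def[of "Fib_hom B E F"] compose_def
        fibred_functor_comp[OF u])
  moreover have "far ?l \<gamma> = far ?r \<gamma>" for \<gamma>
    by (cases "\<gamma> \<in> Arr (Fib_hom B E F)")
      (simp_all add: hom_act1_def comp_func_def[of "Fib_hom B E F"] compose_def
        fibred_nat_whisker_right[OF u])
  ultimately show ?thesis by (intro funct.equality) auto
qed

lemma cat_functor_hom_act1:
  assumes E: "cloven_fibration B E" and F: "cloven_fibration B F" and E': "cloven_fibration B E'"
    and F': "cloven_fibration B F'"
    and u: "fibred_functor B E' E u" and v: "fibred_functor B F F' v"
  shows "cat_functor (Fib_hom B E F) (Fib_hom B E' F') (hom_act1 B E F E' u v)"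
  unfolding hom_act1_eq[OF E F E' u]
  by (rule cat_functor_comp[OF cat_functor_pre[OF E F E' u] cat_functor_post[OF E' F F' v]])

lemma hom_act1_simps [simp]:
  "fibred_functor B E F g \<Longrightarrow> fob (hom_act1 B E F E' u v) g = comp_func (Tot E') v (comp_func (Tot E') g u)"
  "fibred_nat B E F \<gamma> \<Longrightarrow> far (hom_act1 B E F E' u v) \<gamma>
    = whisker_left (Tot E') v (whisker_right (Tot E') \<gamma> u)"
  by (simp_all add: hom_act1_def)

lemma hom_act1_id:
  assumes E: "cloven_fibration B E" and F: "cloven_fibration B F"
  shows "hom_act1 B E F E (id_func (Tot E)) (id_func (Tot F)) = id_func (Fib_hom B E F)"
proof (rule funct_eqI)
  show "cat_functor (Fib_hom B E F) (Fib_hom B E F) (hom_act1 B E F E (id_func (Tot E)) (id_func (Tot F)))"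
    by (rule cat_functor_hom_act1[OF E F E F fibred_functor_id[OF E] fibred_functor_id[OF F]])
  show "cat_functor (Fib_hom B E F) (Fib_hom B E F) (id_func (Fib_hom B E F))"
    by (rule cat_functor_id[OF category_Fib_hom[OF E F]])
  have eq: "comp_func (Tot E) (id_func (Tot F)) (comp_func (Tot E) g (id_func (Tot E))) = g"
    if "fibred_functor B E F g" for g
    using comp_func_id_left[OF fibred_functorD[OF that]] comp_func_id_right[OF fibred_functorD[OF that]]
    by simp
  then show "fob (hom_act1 B E F E (id_func (Tot E)) (id_func (Tot F))) g = fob (id_func (Fib_hom B E F)) g"
    if "g \<in> Obj (Fib_hom B E F)" for g
    using that by simp
  fix \<gamma> assume "\<gamma> \<in> Arr (Fib_hom B E F)"
  then interpret \<gamma>: fibred_nat B E F \<gamma> by simp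
  have "whisker_left (Tot E) (id_func (Tot F)) (whisker_right (Tot E) \<gamma> (id_func (Tot E))) = \<gamma>"
    using eq[OF \<gamma>.NDom.fibred_functor_axioms] eq[OF \<gamma>.NCod.fibred_functor_axioms]
      homD(1)[OF \<gamma>.component_hom] \<gamma>.component_ext
    by (intro nt_eqI[of _ "Tot E"]) auto
  then show "far (hom_act1 B E F E (id_func (Tot E)) (id_func (Tot F))) \<gamma> = far (id_func (Fib_hom B E F)) \<gamma>"
    using \<gamma>.fibred_nat_axioms by simp
qed

lemma hom_act1_comp:
  assumes E: "cloven_fibration B E" and F: "cloven_fibration B F"
    and E': "cloven_fibration B E'" and F': "cloven_fibration B F'"
    and E'': "cloven_fibration B E''" and F'': "cloven_fibration B F''"
    and u: "fibred_functor B E' E u" and v: "fibred_functor B F F' v"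
    and u': "fibred_functor B E'' E' u'" and v': "fibred_functor B F' F'' v'"
  shows "hom_act1 B E F E'' (comp_func (Tot E'') u u') (comp_func (Tot F) v' v)
    = comp_func (Fib_hom B E F) (hom_act1 B E' F' E'' u' v') (hom_act1 B E F E' u v)"
proof (rule funct_eqI)
  interpret h: cat_functor "Fib_hom B E F" "Fib_hom B E' F'" "hom_act1 B E F E' u v"
    by (rule cat_functor_hom_act1[OF E F E' F' u v])
  interpret u: fibred_functor B E' E u by (rule u)
  interpret u': fibred_functor B E'' E' u' by (rule u')
  show "cat_functor (Fib_hom B E F) (Fib_hom B E'' F'')
      (hom_act1 B E F E'' (comp_func (Tot E'') u u') (comp_func (Tot F) v' v))"
    by (rule cat_functor_hom_act1[OF E F E'' F'' fibred_functor_comp[OF u' u] fibred_functor_comp[OF v v']])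
  show "cat_functor (Fib_hom B E F) (Fib_hom B E'' F'')
      (comp_func (Fib_hom B E F) (hom_act1 B E' F' E'' u' v') (hom_act1 B E F E' u v))"
    by (rule cat_functor_comp[OF h.cat_functor_axioms cat_functor_hom_act1[OF E' F' E'' F'' u' v']])
  have eq: "comp_func (Tot E'') (comp_func (Tot F) v' v) (comp_func (Tot E'') g (comp_func (Tot E'') u u'))
      = comp_func (Tot E'') v' (comp_func (Tot E'') (comp_func (Tot E') v (comp_func (Tot E') g u)) u')"
    if g: "fibred_functor B E F g" for g
  proof -
    have guu: "cat_functor (Tot E'') (Tot F) (comp_func (Tot E'') g (comp_func (Tot E'') u u'))"
      using fibred_functorD[OF fibred_functor_comp[OF fibred_functor_comp[OF u' u] g]] .
    show ?thesis
      by (simp add: comp_func_assoc[OF guu] comp_func_assoc[OF u'.cat_functor_axioms])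
  qed
  show "fob (hom_act1 B E F E'' (comp_func (Tot E'') u u') (comp_func (Tot F) v' v)) g
    = fob (comp_func (Fib_hom B E F) (hom_act1 B E' F' E'' u' v') (hom_act1 B E F E' u v)) g"
    if "g \<in> Obj (Fib_hom B E F)" for g
    using that eq[of g] h.fob_obj[OF that] by simp
  fix \<gamma> assume "\<gamma> \<in> Arr (Fib_hom B E F)"
  then interpret \<gamma>: fibred_nat B E F \<gamma> by simp
  have "whisker_left (Tot E'') (comp_func (Tot F) v' v) (whisker_right (Tot E'') \<gamma> (comp_func (Tot E'') u u'))
    = whisker_left (Tot E'') v' (whisker_right (Tot E'') (whisker_left (Tot E') v
        (whisker_right (Tot E') \<gamma> u)) u')"
    using eq[OF \<gamma>.NDom.fibred_functor_axioms] eq[OF \<gamma>.NCod.fibred_functor_axioms]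
      homD(1)[OF \<gamma>.component_hom] u.fob_obj u'.fob_obj
    by (intro nt_eqI[of _ "Tot E''"]) auto
  moreover have "fibred_nat B E' F' (far (hom_act1 B E F E' u v) \<gamma>)"
    using h.far_hom[of \<gamma> "NDom \<gamma>" "NCod \<gamma>"] \<gamma>.fibred_nat_axioms by (simp add: hom_Fib_hom)
  ultimately show "far (hom_act1 B E F E'' (comp_func (Tot E'') u u') (comp_func (Tot F) v' v)) \<gamma>
    = far (comp_func (Fib_hom B E F) (hom_act1 B E' F' E'' u' v') (hom_act1 B E F E' u v)) \<gamma>"
    using \<gamma>.fibred_nat_axioms by simp
qed

text \<open>With identities as structure cells, the coherence laws reduce to the functoriality of \<open>H\<close> on
  1-cells, which naturality carries over to \<open>G\<close> on the image of \<open>\<Phi>\<close>.\<close>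

lemma strict_natural_pseudo_natural:
  assumes \<Phi>: "\<And>x. x \<in> Cell0 K \<Longrightarrow> cat_functor (on0 H x) (on0 G x) (\<Phi> x)"
    and H: "\<And>x y k. \<lbrakk>x \<in> Cell0 K; y \<in> Cell0 K; k \<in> Obj (HomCat K x y)\<rbrakk>
      \<Longrightarrow> cat_functor (on0 H x) (on0 H y) (fob (on_hom H x y) k)"
    and G: "\<And>x y k. \<lbrakk>x \<in> Cell0 K; y \<in> Cell0 K; k \<in> Obj (HomCat K x y)\<rbrakk>
      \<Longrightarrow> cat_functor (on0 G x) (on0 G y) (fob (on_hom G x y) k)"
    and Hid: "\<And>x. x \<in> Cell0 K \<Longrightarrow> fob (on_hom H x x) (Id1 K x) = id_func (on0 H x)"
    and Hcomp: "\<And>x y z k l. \<lbrakk>x \<in> Cell0 K; y \<in> Cell0 K; z \<in> Cell0 K;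
        k \<in> Obj (HomCat K x y); l \<in> Obj (HomCat K y z)\<rbrakk>
      \<Longrightarrow> fob (on_hom H x z) (Comp1 K x y z l k)
        = comp_func (on0 H x) (fob (on_hom H y z) l) (fob (on_hom H x y) k)"
    and sq: "\<And>x y k. \<lbrakk>x \<in> Cell0 K; y \<in> Cell0 K; k \<in> Obj (HomCat K x y)\<rbrakk>
      \<Longrightarrow> comp_func (on0 H x) (fob (on_hom G x y) k) (\<Phi> x)
        = comp_func (on0 H x) (\<Phi> y) (fob (on_hom H x y) k)"
    and H2: "\<And>x y k k' \<sigma>. \<lbrakk>x \<in> Cell0 K; y \<in> Cell0 K; \<sigma> \<in> hom (HomCat K x y) k k'\<rbrakk>
      \<Longrightarrow> k \<in> Obj (HomCat K x y) \<and> k' \<in> Obj (HomCat K x y) \<and>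
        NDom (far (on_hom H x y) \<sigma>) = fob (on_hom H x y) k \<and>
        NCod (far (on_hom H x y) \<sigma>) = fob (on_hom H x y) k' \<and>
        NDom (far (on_hom G x y) \<sigma>) = fob (on_hom G x y) k \<and>
        NCod (far (on_hom G x y) \<sigma>) = fob (on_hom G x y) k'"
    and sq2: "\<And>x y k k' \<sigma> a. \<lbrakk>x \<in> Cell0 K; y \<in> Cell0 K; \<sigma> \<in> hom (HomCat K x y) k k'; a \<in> Obj (on0 H x)\<rbrakk>
      \<Longrightarrow> component (far (on_hom G x y) \<sigma>) (fob (\<Phi> x) a)
          = far (\<Phi> y) (component (far (on_hom H x y) \<sigma>) a) \<and>
        component (far (on_hom G x y) \<sigma>) (fob (\<Phi> x) a) \<in> hom (on0 G y)
          (fob (fob (on_hom G x y) k) (fob (\<Phi> x) a)) (fob (fob (on_hom G x y) k') (fob (\<Phi> x) a))"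
  shows "pseudo_natural K H G \<Phi> (\<lambda>x y k. id_nt (on0 H x) (on0 G y) (comp_func (on0 H x) (\<Phi> y) (fob (on_hom H x y) k)))"
proof (rule pseudo_natural.intro)
  fix x assume x: "x \<in> Cell0 K"
  show "cat_functor (on0 H x) (on0 G x) (\<Phi> x)" by (rule \<Phi>[OF x])
  show "id_nt (on0 H x) (on0 G x) (comp_func (on0 H x) (\<Phi> x) (fob (on_hom H x x) (Id1 K x)))
    = id_nt (on0 H x) (on0 G x) (\<Phi> x)"
    using comp_func_id_right[OF \<Phi>[OF x]] Hid[OF x] by simp
next
  fix x y k assume x: "x \<in> Cell0 K" and y: "y \<in> Cell0 K" and k: "k \<in> Obj (HomCat K x y)"
  let ?c = "comp_func (on0 H x) (\<Phi> y) (fob (on_hom H x y) k)"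
  interpret c: cat_functor "on0 H x" "on0 G y" ?c by (rule cat_functor_comp[OF H[OF x y k] \<Phi>[OF y]])
  show "nat_iso (on0 H x) (on0 G y) (id_nt (on0 H x) (on0 G y) ?c)"
    using nat_transformation_id[OF c.cat_functor_axioms] c.D.iso_ide[OF c.fob_obj]
    by (simp add: nat_iso_def)
  show "NDom (id_nt (on0 H x) (on0 G y) ?c) = comp_func (on0 H x) (fob (on_hom G x y) k) (\<Phi> x)"
    using sq[OF x y k] by simp
  show "NCod (id_nt (on0 H x) (on0 G y) ?c) = ?c" by simp
next
  fix x y k k' \<sigma> assume x: "x \<in> Cell0 K" and y: "y \<in> Cell0 K" and \<sigma>: "\<sigma> \<in> hom (HomCat K x y) k k'"
  note s = H2[OF x y \<sigma>]
  then have k: "k \<in> Obj (HomCat K x y)" "k' \<in> Obj (HomCat K x y)" by auto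
  interpret g: cat_functor "on0 G x" "on0 G y" "fob (on_hom G x y) k" by (rule G[OF x y k(1)])
  let ?\<theta> = "\<lambda>k. id_nt (on0 H x) (on0 G y) (comp_func (on0 H x) (\<Phi> y) (fob (on_hom H x y) k))"
  show "vcomp (on0 H x) (on0 G y) (?\<theta> k') (whisker_right (on0 H x) (far (on_hom G x y) \<sigma>) (\<Phi> x))
      = vcomp (on0 H x) (on0 G y) (whisker_left (on0 H x) (\<Phi> y) (far (on_hom H x y) \<sigma>)) (?\<theta> k)"
    (is "?l = ?r")
  proof (rule nt_eqI[of _ "on0 H x"])
    show "NDom ?l = NDom ?r" "NCod ?l = NCod ?r" using s sq[OF x y] by auto
    fix a assume a: "a \<in> Obj (on0 H x)"
    note t = sq2[OF x y \<sigma> a]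
    have "fob (\<Phi> y) (fob (fob (on_hom H x y) j) a) = fob (fob (on_hom G x y) j) (fob (\<Phi> x) a)"
      if "j \<in> Obj (HomCat K x y)" for j
      using arg_cong[OF sq[OF x y that], of "\<lambda>f. fob f a"] a by simp
    then show "component ?l a = component ?r a"
      using a t k g.D.comp_ide_left[OF conjunct2[OF t]] g.D.comp_ide_right[OF conjunct2[OF t]] by simp
  qed auto
next
  fix x y z k l assume x: "x \<in> Cell0 K" and y: "y \<in> Cell0 K" and z: "z \<in> Cell0 K"
    and k: "k \<in> Obj (HomCat K x y)" and l: "l \<in> Obj (HomCat K y z)"
  interpret Hk: cat_functor "on0 H x" "on0 H y" "fob (on_hom H x y) k" by (rule H[OF x y k])
  interpret Hl: cat_functor "on0 H y" "on0 H z" "fob (on_hom H y z) l" by (rule H[OF y z l])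
  interpret Gl: cat_functor "on0 G y" "on0 G z" "fob (on_hom G y z) l" by (rule G[OF y z l])
  interpret Py: cat_functor "on0 H y" "on0 G y" "\<Phi> y" by (rule \<Phi>[OF y])
  interpret Pz: cat_functor "on0 H z" "on0 G z" "\<Phi> z" by (rule \<Phi>[OF z])
  have sqa: "fob (fob (on_hom G y z) l) (fob (\<Phi> y) b) = fob (\<Phi> z) (fob (fob (on_hom H y z) l) b)"
    if "b \<in> Obj (on0 H y)" for b
    using arg_cong[OF sq[OF y z l], of "\<lambda>f. fob f b"] that by simp
  show "id_nt (on0 H x) (on0 G z) (comp_func (on0 H x) (\<Phi> z) (fob (on_hom H x z) (Comp1 K x y z l k)))
    = vcomp (on0 H x) (on0 G z)
        (whisker_right (on0 H x) (id_nt (on0 H y) (on0 G z)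
          (comp_func (on0 H y) (\<Phi> z) (fob (on_hom H y z) l))) (fob (on_hom H x y) k))
        (whisker_left (on0 H x) (fob (on_hom G y z) l) (id_nt (on0 H x) (on0 G y)
          (comp_func (on0 H x) (\<Phi> y) (fob (on_hom H x y) k))))" (is "?l = ?r")
  proof (rule nt_eqI[of _ "on0 H x"])
    show "NDom ?l = NDom ?r"
      using sq[OF y z l] comp_func_assoc[OF Hk.cat_functor_axioms, of "fob (on_hom G y z) l" "\<Phi> y"]
        comp_func_assoc[OF Hk.cat_functor_axioms, of "\<Phi> z" "fob (on_hom H y z) l"]
      by (simp add: Hcomp[OF x y z k l])
    show "NCod ?l = NCod ?r"
      using comp_func_assoc[OF Hk.cat_functor_axioms, of "\<Phi> z" "fob (on_hom H y z) l"]
      by (simp add: Hcomp[OF x y z k l])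
    fix a assume a: "a \<in> Obj (on0 H x)"
    note b = Hk.fob_obj[OF a]
    have "fob (\<Phi> z) (fob (fob (on_hom H y z) l) (fob (fob (on_hom H x y) k) a)) \<in> Obj (on0 G z)"
      using Pz.fob_obj[OF Hl.fob_obj[OF b]] .
    then show "component ?l a = component ?r a"
      using a b sqa[OF b] Gl.far_ide[OF Py.fob_obj[OF b]] Gl.D.comp_ide_left[OF Gl.D.ide_hom]
      by (simp add: Hcomp[OF x y z k l])
  qed auto
qed

subsection \<open>Naturality of transposition\<close>

lemma prod_cat_simps [simp]:
  "Obj (prod_cat C D) = Obj C \<times> Obj D" "Arr (prod_cat C D) = Arr C \<times> Arr D"
  "(\<alpha>, \<beta>) \<in> hom (prod_cat C D) (u, v) (u', v') \<longleftrightarrow> \<alpha> \<in> hom C u u' \<and> \<beta> \<in> hom D v v'"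
  by (auto simp: prod_cat_def hom_def)

lemma adjunction_cells [simp]:
  "Cell0 (two_prod (two_op (Fib A)) (Fib B)) = {E. cloven_fibration A E} \<times> {F. cloven_fibration B F}"
  "HomCat (two_prod (two_op (Fib A)) (Fib B)) (E, F) (E', F')
    = prod_cat (Fib_hom A E' E) (Fib_hom B F F')"
  "Id1 (two_prod (two_op (Fib A)) (Fib B)) (E, F) = (id_func (Tot E), id_func (Tot F))"
  "Comp1 (two_prod (two_op (Fib A)) (Fib B)) (E, F) (E', F') (E'', F'') (u', v') (u, v)
    = (comp_func (Tot E'') u u', comp_func (Tot F) v' v)"
  by (auto simp: two_prod_def two_op_def)

context base_change
begin

abbreviation hom_base_change where
  "hom_base_change \<equiv> hom_two_fun A (Fib A) (Fib B) (id_two_fun (Fib A)) (oplax_base_change B p)"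

abbreviation hom_sum where
  "hom_sum \<equiv> hom_two_fun B (Fib A) (Fib B) (oplax_sum p) (id_two_fun (Fib B))"

lemma hom_base_change_simps [simp]:
  "on0 hom_base_change (E, F) = Fib_hom A E (bc_fib B p F)"
  "fibred_functor A E' E u \<Longrightarrow> fibred_functor B F F' v \<Longrightarrow>
    fob (on_hom hom_base_change (E, F) (E', F')) (u, v) = hom_act1 A E (bc_fib B p F) E' u (bc_map1 B p F v)"
  "fibred_nat A E' E \<alpha> \<Longrightarrow> fibred_nat B F F' \<beta> \<Longrightarrow>
    far (on_hom hom_base_change (E, F) (E', F')) (\<alpha>, \<beta>)
      = hom_act2 A E (bc_fib B p F) E' (bc_fib B p F') \<alpha> (bc_map2 B p F \<beta>)"
  by (simp_all add: hom_two_fun_def oplax_base_change_def id_two_fun_def)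

lemma hom_sum_simps [simp]:
  "on0 hom_sum (E, F) = Fib_hom B (sum_fib p E) F"
  "fibred_functor A E' E u \<Longrightarrow> fibred_functor B F F' v \<Longrightarrow>
    fob (on_hom hom_sum (E, F) (E', F')) (u, v) = hom_act1 B (sum_fib p E) F (sum_fib p E') u v"
  "fibred_nat A E' E \<alpha> \<Longrightarrow> fibred_nat B F F' \<beta> \<Longrightarrow>
    far (on_hom hom_sum (E, F) (E', F')) (\<alpha>, \<beta>) = hom_act2 B (sum_fib p E) F (sum_fib p E') F' \<alpha> \<beta>"
  by (simp_all add: hom_two_fun_def oplax_sum_def id_two_fun_def)

lemma pairI: "cloven_fibration A E \<Longrightarrow> cloven_fibration B F \<Longrightarrow> base_change_pair B p E F"
  by (simp add: base_change_pair_def base_change_axioms)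

text \<open>Naturality of transposition is associativity of composition together with the strict naturality
  of the counit.\<close>

lemma transpose_natural_fob:
  assumes E: "cloven_fibration A E" and F: "cloven_fibration B F" and F': "cloven_fibration B F'"
    and u: "fibred_functor A E' E u" and v: "fibred_functor B F F' v"
    and g: "fibred_functor A E (bc_fib B p F) g"
  shows "comp_func (Tot E') v (comp_func (Tot E') (comp_func (Tot E) (bc_counit F) g) u)
    = comp_func (Tot E') (bc_counit F') (comp_func (Tot E') (bc_map1 B p F v) (comp_func (Tot E') g u))"
proof -
  note gu = fibred_functorD[OF fibred_functor_comp[OF u g], unfolded bc_fib_simps]
  have "comp_func (Tot E') (bc_counit F') (comp_func (Tot E') (bc_map1 B p F v) (comp_func (Tot E') g u))
    = comp_func (Tot E') (comp_func (bc_cat B p F) v (bc_counit F)) (comp_func (Tot E') g u)"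
    using bc_counit_natural[OF F F' v] by (simp add: comp_func_assoc[OF gu, symmetric])
  then show ?thesis
    by (simp add: comp_func_assoc[OF gu] comp_func_assoc[OF fibred_functorD[OF u]])
qed

lemma counit_natural_far:
  assumes F: "cloven_fibration B F" and F': "cloven_fibration B F'" and v: "fibred_functor B F F' v"
    and m: "m \<in> Arr (bc_cat B p F)"
  shows "far (bc_counit F') (far (bc_map1 B p F v) m) = far v (far (bc_counit F) m)"
  using arg_cong[OF bc_counit_natural[OF F F' v], of "\<lambda>f. far f m"] m by simp

lemma transpose_natural:
  assumes E: "cloven_fibration A E" and F: "cloven_fibration B F"
    and E': "cloven_fibration A E'" and F': "cloven_fibration B F'"
    and u: "fibred_functor A E' E u" and v: "fibred_functor B F F' v"
  shows "comp_func (Fib_hom A E (bc_fib B p F)) (hom_act1 B (sum_fib p E) F (sum_fib p E') u v)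
      (base_change_pair.left_transpose B p E F)
    = comp_func (Fib_hom A E (bc_fib B p F)) (base_change_pair.left_transpose B p E' F')
      (hom_act1 A E (bc_fib B p F) E' u (bc_map1 B p F v))"
proof (rule funct_eqI)
  interpret P: base_change_pair B p E F by (rule pairI[OF E F])
  interpret P': base_change_pair B p E' F' by (rule pairI[OF E' F'])
  interpret h: cat_functor "Fib_hom A E (bc_fib B p F)" "Fib_hom A E' (bc_fib B p F')"
    "hom_act1 A E (bc_fib B p F) E' u (bc_map1 B p F v)"
    by (rule cat_functor_hom_act1[OF E bc_cloven[OF F] E' bc_cloven[OF F'] u bc_map1_fibred[OF F F' v]])
  show "cat_functor (Fib_hom A E (bc_fib B p F)) (Fib_hom B (sum_fib p E') F')
     (comp_func (Fib_hom A E (bc_fib B p F)) (hom_act1 B (sum_fib p E) F (sum_fib p E') u v)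
      P.left_transpose)"
    by (rule cat_functor_comp[OF P.left_transpose_functor cat_functor_hom_act1[OF P.S.sum_cloven F
      P'.S.sum_cloven F' sum_fibred_functor[OF p.cloven_fibration_axioms E' E u] v]])
  show "cat_functor (Fib_hom A E (bc_fib B p F)) (Fib_hom B (sum_fib p E') F')
     (comp_func (Fib_hom A E (bc_fib B p F)) P'.left_transpose
      (hom_act1 A E (bc_fib B p F) E' u (bc_map1 B p F v)))"
    by (rule cat_functor_comp[OF h.cat_functor_axioms P'.left_transpose_functor])
  interpret u: fibred_functor A E' E u by (rule u)
  { fix g assume gO: "g \<in> Obj (Fib_hom A E (bc_fib B p F))"
    then have g: "fibred_functor A E (bc_fib B p F) g" by simp
    show "fob (comp_func (Fib_hom A E (bc_fib B p F)) (hom_act1 B (sum_fib p E) F (sum_fib p E') u v)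
        P.left_transpose) g = fob (comp_func (Fib_hom A E (bc_fib B p F)) P'.left_transpose
        (hom_act1 A E (bc_fib B p F) E' u (bc_map1 B p F v))) g"
      using P.left_transpose_functor[THEN cat_functor.fob_obj, OF gO] h.fob_obj[OF gO] g
        transpose_natural_fob[OF E F F' u v g] by simp }
  { fix \<gamma> assume \<gamma>A: "\<gamma> \<in> Arr (Fib_hom A E (bc_fib B p F))"
    then have \<gamma>: "fibred_nat A E (bc_fib B p F) \<gamma>" by simp
    interpret \<gamma>: fibred_nat A E "bc_fib B p F" \<gamma> by (rule \<gamma>)
    have 1: "fibred_nat B (sum_fib p E) F (whisker_left (Tot E) (bc_counit F) \<gamma>)"
      using homD(1)[OF P.left_transpose_functor[THEN cat_functor.far_hom, OF in_hom[OF \<gamma>A]]] \<gamma> by simp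
    have 2: "fibred_nat A E' (bc_fib B p F')
        (whisker_left (Tot E') (bc_map1 B p F v) (whisker_right (Tot E') \<gamma> u))"
      using homD(1)[OF h.far_hom[OF in_hom[OF \<gamma>A]]] \<gamma> by simp
    have "whisker_left (Tot E') v (whisker_right (Tot E') (whisker_left (Tot E) (bc_counit F) \<gamma>) u)
      = whisker_left (Tot E') (bc_counit F')
          (whisker_left (Tot E') (bc_map1 B p F v) (whisker_right (Tot E') \<gamma> u))"
      using transpose_natural_fob[OF E F F' u v \<gamma>.NDom.fibred_functor_axioms]
        transpose_natural_fob[OF E F F' u v \<gamma>.NCod.fibred_functor_axioms]
        counit_natural_far[OF F F' v] homD(1)[OF \<gamma>.component_hom] u.fob_obj
      by (intro nt_eqI[of _ "Tot E'"]) auto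
    then show "far (comp_func (Fib_hom A E (bc_fib B p F)) (hom_act1 B (sum_fib p E) F (sum_fib p E') u v)
        P.left_transpose) \<gamma> = far (comp_func (Fib_hom A E (bc_fib B p F)) P'.left_transpose
        (hom_act1 A E (bc_fib B p F) E' u (bc_map1 B p F v))) \<gamma>"
      using \<gamma> 1 2 by simp }
qed

lemma hom_act2_simps [simp]:
  "NDom (hom_act2 B' E F E' F' \<alpha> \<beta>) = hom_act1 B' E F E' (NDom \<alpha>) (NDom \<beta>)"
  "NCod (hom_act2 B' E F E' F' \<alpha> \<beta>) = hom_act1 B' E F E' (NCod \<alpha>) (NCod \<beta>)"
  "fibred_functor B' E F g \<Longrightarrow> component (hom_act2 B' E F E' F' \<alpha> \<beta>) g
    = hcomp (Tot E') (Tot F') \<beta> (whisker_left (Tot E') g \<alpha>)"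
  by (simp_all add: hom_act2_def)

lemma transpose_natural2:
  assumes E: "cloven_fibration A E" and F: "cloven_fibration B F"
    and E': "cloven_fibration A E'" and F': "cloven_fibration B F'"
    and \<alpha>: "fibred_nat A E' E \<alpha>" and \<beta>: "fibred_nat B F F' \<beta>"
    and g: "fibred_functor A E (bc_fib B p F) g"
  shows "hcomp (Tot E') (Tot F') \<beta> (whisker_left (Tot E') (comp_func (Tot E) (bc_counit F) g) \<alpha>)
    = whisker_left (Tot E') (bc_counit F')
        (hcomp (Tot E') (bc_cat B p F') (bc_map2 B p F \<beta>) (whisker_left (Tot E') g \<alpha>))" (is "?l = ?r")
proof (rule nt_eqI[of _ "Tot E'"])
  interpret \<alpha>: fibred_nat A E' E \<alpha> by (rule \<alpha>)
  interpret \<beta>: fibred_nat B F F' \<beta> by (rule \<beta>)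
  interpret g: fibred_functor A E "bc_fib B p F" g by (rule g)
  interpret M: fibred_nat A "bc_fib B p F" "bc_fib B p F'" "bc_map2 B p F \<beta>"
    by (rule bc_map2_fibred[OF F F' \<beta>])
  interpret e: cat_functor "bc_cat B p F'" "Tot F'" "bc_counit F'" by (rule bc_counit_functor[OF F'])
  show "NDom ?l = NDom ?r" "NCod ?l = NCod ?r"
    using transpose_natural_fob[OF E F F' \<alpha>.NDom.fibred_functor_axioms \<beta>.NDom.fibred_functor_axioms g]
      transpose_natural_fob[OF E F F' \<alpha>.NCod.fibred_functor_axioms \<beta>.NCod.fibred_functor_axioms g]
    by simp_all
  fix x assume x: "x \<in> Obj (Tot E')"
  note h = \<alpha>.component_hom[OF x]
  note gh = g.far_hom[OF h]
  have y: "fob (NCod \<alpha>) x \<in> Obj (Tot E)" using \<alpha>.NCod.fob_obj[OF x] .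
  have gy: "fob g (fob (NCod \<alpha>) x) \<in> Obj (bc_cat B p F)" using g.fob_obj[OF y] by simp
  have "far (bc_counit F') (component (bc_map2 B p F \<beta>) (fob g (fob (NCod \<alpha>) x))
      \<cdot>\<^bsub>bc_cat B p F'\<^esub> far (bc_map1 B p F (NDom \<beta>)) (far g (component \<alpha> x)))
    = far (bc_counit F') (component (bc_map2 B p F \<beta>) (fob g (fob (NCod \<alpha>) x)))
      \<cdot>\<^bsub>Tot F'\<^esub> far (bc_counit F') (far (bc_map1 B p F (NDom \<beta>)) (far g (component \<alpha> x)))"
    using e.far_comp M.NDom.far_hom[OF gh] M.component_hom[of "fob g (fob (NCod \<alpha>) x)"] gy by auto
  also have "\<dots> = component \<beta> (fob (bc_counit F) (fob g (fob (NCod \<alpha>) x)))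
      \<cdot>\<^bsub>Tot F'\<^esub> far (NDom \<beta>) (far (bc_counit F) (far g (component \<alpha> x)))"
    using bc_counit_natural2[OF F' \<beta> gy] homD(1)[OF gh]
      counit_natural_far[OF F F' \<beta>.NDom.fibred_functor_axioms, of "far g (component \<alpha> x)"] by simp
  finally show "component ?l x = component ?r x"
    using x y homD(1)[OF h] by simp
qed auto

theorem transpose_pseudo_natural_equivalence:
  "\<exists>\<theta>. pseudo_natural_equivalence (two_prod (two_op (Fib A)) (Fib B)) hom_base_change hom_sum
    (\<lambda>(E, F). base_change_pair.left_transpose B p E F) \<theta>"
proof -
  let ?K = "two_prod (two_op (Fib A)) (Fib B)"
  let ?\<Phi> = "\<lambda>(E, F). base_change_pair.left_transpose B p E F"
  note pc = p.cloven_fibration_axioms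
  note Sc = sum_fibration.sum_cloven[OF sum_fibrationI[OF pc]]
  note act_H = cat_functor_hom_act1[OF _ bc_cloven _ bc_cloven _ bc_map1_fibred]
  note act_G = cat_functor_hom_act1[OF Sc _ Sc _ sum_fibred_functor[OF pc]]
  have "pseudo_natural ?K hom_base_change hom_sum ?\<Phi> (\<lambda>x y k. id_nt (on0 hom_base_change x) (on0 hom_sum y)
      (comp_func (on0 hom_base_change x) (?\<Phi> y) (fob (on_hom hom_base_change x y) k)))"
  proof (rule strict_natural_pseudo_natural)
    show "cat_functor (on0 hom_base_change x) (on0 hom_sum x) (?\<Phi> x)" if "x \<in> Cell0 ?K" for x
      using that by (cases x) (simp add: base_change_pair.left_transpose_functor[OF pairI])
    show "cat_functor (on0 hom_base_change x) (on0 hom_base_change y) (fob (on_hom hom_base_change x y) k)"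
      if "x \<in> Cell0 ?K" "y \<in> Cell0 ?K" "k \<in> Obj (HomCat ?K x y)" for x y k
      using that by (cases x; cases y; cases k) (simp add: act_H)
    show "cat_functor (on0 hom_sum x) (on0 hom_sum y) (fob (on_hom hom_sum x y) k)"
      if "x \<in> Cell0 ?K" "y \<in> Cell0 ?K" "k \<in> Obj (HomCat ?K x y)" for x y k
      using that by (cases x; cases y; cases k) (simp add: act_G)
    show "fob (on_hom hom_base_change x x) (Id1 ?K x) = id_func (on0 hom_base_change x)" if "x \<in> Cell0 ?K" for x
      using that
      by (cases x) (simp add: fibred_functor_id bc_map1_id
          hom_act1_id[OF _ bc_cloven, unfolded bc_fib_simps])
    show "fob (on_hom hom_base_change x z) (Comp1 ?K x y z l k)
        = comp_func (on0 hom_base_change x) (fob (on_hom hom_base_change y z) l) (fob (on_hom hom_base_change x y) k)"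
      if "x \<in> Cell0 ?K" "y \<in> Cell0 ?K" "z \<in> Cell0 ?K" "k \<in> Obj (HomCat ?K x y)"
        "l \<in> Obj (HomCat ?K y z)" for x y z k l
    proof -
      obtain E F E' F' E'' F'' u v u' v' where *: "x = (E, F)" "y = (E', F')" "z = (E'', F'')"
        "k = (u, v)" "l = (u', v')" by (cases x; cases y; cases z; cases k; cases l)
      with that have c: "cloven_fibration A E" "cloven_fibration B F" "cloven_fibration A E'"
        "cloven_fibration B F'" "cloven_fibration A E''" "cloven_fibration B F''"
        "fibred_functor A E' E u" "fibred_functor B F F' v"
        "fibred_functor A E'' E' u'" "fibred_functor B F' F'' v'" by auto
      show ?thesis
        using hom_act1_comp[OF c(1) bc_cloven[OF c(2)] c(3) bc_cloven[OF c(4)] c(5) bc_cloven[OF c(6)]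
            c(7) bc_map1_fibred[OF c(2,4,8)] c(9) bc_map1_fibred[OF c(4,6,10)]]
          c fibred_functor_comp[OF c(9,7)] fibred_functor_comp[OF c(8,10)]
          bc_map1_comp[OF c(2,4,6,8,10)]
        by (simp add: *)
    qed
    show "comp_func (on0 hom_base_change x) (fob (on_hom hom_sum x y) k) (?\<Phi> x)
        = comp_func (on0 hom_base_change x) (?\<Phi> y) (fob (on_hom hom_base_change x y) k)"
      if "x \<in> Cell0 ?K" "y \<in> Cell0 ?K" "k \<in> Obj (HomCat ?K x y)" for x y k
      using that by (cases x; cases y; cases k) (simp add: transpose_natural)
    fix x y k k' \<sigma> assume x: "x \<in> Cell0 ?K" and y: "y \<in> Cell0 ?K" and \<sigma>: "\<sigma> \<in> hom (HomCat ?K x y) k k'"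
    obtain E F E' F' u v u' v' \<alpha> \<beta> where *: "x = (E, F)" "y = (E', F')" "k = (u, v)" "k' = (u', v')"
      "\<sigma> = (\<alpha>, \<beta>)" by (cases x; cases y; cases k; cases k'; cases \<sigma>)
    with x y \<sigma> have c: "cloven_fibration A E" "cloven_fibration B F" "cloven_fibration A E'"
        "cloven_fibration B F'" and \<alpha>: "fibred_nat A E' E \<alpha>" "NDom \<alpha> = u" "NCod \<alpha> = u'"
        and \<beta>: "fibred_nat B F F' \<beta>" "NDom \<beta> = v" "NCod \<beta> = v'"
      by (auto simp: hom_Fib_hom)
    have uv: "fibred_functor A E' E u" "fibred_functor A E' E u'" "fibred_functor B F F' v"
        "fibred_functor B F F' v'"
      using fibred_natD[OF \<alpha>(1)] fibred_natD[OF \<beta>(1)] \<alpha> \<beta> by auto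
    show "k \<in> Obj (HomCat ?K x y) \<and> k' \<in> Obj (HomCat ?K x y) \<and>
        NDom (far (on_hom hom_base_change x y) \<sigma>) = fob (on_hom hom_base_change x y) k \<and>
        NCod (far (on_hom hom_base_change x y) \<sigma>) = fob (on_hom hom_base_change x y) k' \<and>
        NDom (far (on_hom hom_sum x y) \<sigma>) = fob (on_hom hom_sum x y) k \<and>
        NCod (far (on_hom hom_sum x y) \<sigma>) = fob (on_hom hom_sum x y) k'"
      using * uv \<alpha> \<beta> by simp
    fix a assume a: "a \<in> Obj (on0 hom_base_change x)"
    then have g: "fibred_functor A E (bc_fib B p F) a" using * by simp
    interpret P: base_change_pair B p E F by (rule pairI[OF c(1,2)])
    interpret P': base_change_pair B p E' F' by (rule pairI[OF c(3,4)])
    have eg: "fibred_functor B (sum_fib p E) F (comp_func (Tot E) (bc_counit F) a)"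
      using cat_functor.fob_obj[OF P.left_transpose_functor, of a] g by simp
    have "fibred_nat B (sum_fib p E') F' (hcomp (Tot (sum_fib p E')) (Tot F') \<beta>
        (whisker_left (Tot (sum_fib p E')) (comp_func (Tot E) (bc_counit F) a) \<alpha>))"
      by (rule fibred_nat_hcomp[OF c(4) fibred_nat_whisker_left[OF sum_fibred_nat[OF pc c(3,1) \<alpha>(1)] eg]
        \<beta>(1)])
    moreover have "fibred_nat A E' (bc_fib B p F') (hcomp (Tot E') (Tot (bc_fib B p F'))
        (bc_map2 B p F \<beta>) (whisker_left (Tot E') a \<alpha>))"
      by (rule fibred_nat_hcomp[OF bc_cloven[OF c(4)] fibred_nat_whisker_left[OF \<alpha>(1) g]
        bc_map2_fibred[OF c(2,4) \<beta>(1)]])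
    ultimately show "component (far (on_hom hom_sum x y) \<sigma>) (fob (?\<Phi> x) a)
          = far (?\<Phi> y) (component (far (on_hom hom_base_change x y) \<sigma>) a) \<and>
        component (far (on_hom hom_sum x y) \<sigma>) (fob (?\<Phi> x) a) \<in> hom (on0 hom_sum y)
          (fob (fob (on_hom hom_sum x y) k) (fob (?\<Phi> x) a))
          (fob (fob (on_hom hom_sum x y) k') (fob (?\<Phi> x) a))"
      using g eg uv \<alpha> \<beta> transpose_natural2[OF c \<alpha>(1) \<beta>(1) g]
        transpose_natural_fob[OF c(1,2,4) uv(1,3) g] transpose_natural_fob[OF c(1,2,4) uv(2,4) g]
      by (simp add: * hom_Fib_hom)
  qed
  moreover have "cat_equivalence (on0 hom_base_change x) (on0 hom_sum x) (?\<Phi> x)" if "x \<in> Cell0 ?K" for x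
    using that by (cases x) (simp add: base_change_pair.transpose_equivalence[OF pairI])
  ultimately show ?thesis unfolding pseudo_natural_equivalence_def by blast
qed

end

theorem corollary4p20:
  fixes A :: "('ao, 'am) cat"
    and B :: "('bo, 'bm) cat"
    and p :: "('ao, 'am, 'bo, 'bm) fibration"
  assumes "cloven_fibration B p" and "Tot p = A"
  shows "right_pseudo_adjoint A B
    (oplax_sum p :: (('eo, 'em, 'ao, 'am) fibration, _, _, _, _, _) two_fun)
    (oplax_base_change B p :: (('fo, 'fm, 'bo, 'bm) fibration, _, _, _, _, _) two_fun)"
proof -
  interpret base_change B p using assms(1) by (simp add: base_change_def)
  show ?thesis
    unfolding right_pseudo_adjoint_def assms(2)[symmetric]
    using two_functor_oplax_sum[OF assms(1)] two_functor_oplax_base_change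
      transpose_pseudo_natural_equivalence by blast
qed

end
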